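(* Let $X \subseteq \mathbb{R}^d$ be a H\"older set and let $M=(M_k)_{k\in\mathbb{N}}$ be a non-quasianalytic log-convex positive sequence. Then \[ \mathcal{A}^\infty_M(X) = \mathcal{A}^\infty(X) = \mathcal{C}^\infty(X). \] In particular, $X$ is $\mathcal{A}^\infty$-admissible, i.e. $\mathcal{A}^\infty(X)=\mathcal{C}^\infty(X)$.
   Context: For $X\subseteq\mathbb{R}^d$: $\mathcal{C}^\infty(\mathbb{R},X)$ is the set of smooth $c:\mathbb{R}\to\mathbb{R}^d$ with $c(\mathbb{R})\subseteq X$. $\mathcal{A}^\infty(X)$ is the set of $f:X\to\mathbb{R}$ such that $f\circ c\in\mathcal{C}^\infty(\mathbb{R},\mathbb{R})$ for all $c\in\mathcal{C}^\infty(\mathbb{R},X)$. For a positive sequence $M$, the Denjoy--Carleman class $\mathcal{C}^M(\mathbb{R},\mathbb{R}^d)$ is the set of smooth $c$ such that for every compact $K\subseteq\mathbb{R}$ there are $C,\rho>0$ with $|c^{(k)}(t)|\le C\rho^k k!\,M_k$ for all $k\in\mathbb{N}$, $t\in K$; $\mathcal{C}^M(\mathbb{R},X)$ consists of those with image in $X$, and $\mathcal{A}^\infty_M(X)$ is the set of $f:X\to\mathbb{R}$ with $f\circ c\in\mathcal{C}^\infty(\mathbb{R},\mathbb{R})$ for all $c\in\mathcal{C}^M(\mathbb{R},X)$. $M$ is non-quasianalytic if $\sum_k M_k/((k+1)M_{k+1})<\infty$. A function $f:X\to\mathbb{R}$ belongs to $\mathcal{C}^\infty(X)$ if every $x\in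 X$ has an open neighborhood $U$ in $\mathbb{R}^d$ and a smooth $F:U\to\mathbb{R}$ with $F=f$ on $U\cap X$. H\"older sets: write $x=(x',x_d)\in\mathbb{R}^{d-1}\times\mathbb{R}$. For $0<\alpha\le1$, $r,h>0$, the truncated open cusp is $\Gamma^\alpha_d(r,h)=\{(x',x_d): |x'|<r,\ h(|x'|/r)^\alpha<x_d<h\}$. An open set $U\subseteq\mathbb{R}^d$ has the uniform cusp property of index $\alpha$ if for every $x\in\partial U$ there exist $\epsilon>0$, a truncated open cusp $\Gamma=\Gamma^\alpha_d(r,h)$ and an orthogonal $A\in O(d)$ such that $y+A\Gamma\subseteq U$ for all $y\in\overline U\cap B(x,\epsilon)$. A closed set $X$ is fat if $X=\overline{\mathrm{int}(X)}$ (and $X\neq\emptyset$). An $\alpha$-set is a fat closed set $X$ such that $\mathrm{int}(X)$ has the uniform cusp property of index $\alpha$; a H\"older set is an $\alpha$-set for some $\alpha\in(0,1]$. *)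

theory Defs
  imports "HOL-Analysis.Analysis"
begin

definition curve_derivs :: "(real \<Rightarrow> 'a::real_normed_vector) \<Rightarrow> (nat \<Rightarrow> real \<Rightarrow> 'a) \<Rightarrow> bool" where
  "curve_derivs c D \<longleftrightarrow> D 0 = c \<and> (\<forall>k t. (D k has_vector_derivative D (Suc k) t) (at t))"

definition smooth_curve :: "(real \<Rightarrow> 'a::real_normed_vector) \<Rightarrow> bool" where
  "smooth_curve c \<longleftrightarrow> (\<exists>D. curve_derivs c D)"

definition smooth_curves_in :: "'a::real_normed_vector set \<Rightarrow> (real \<Rightarrow> 'a) set" where
  "smooth_curves_in X = {c. smooth_curve c \<and> range c \<subseteq> X}"

definition DC_curves_in :: "(nat \<Rightarrow> real) \<Rightarrow> 'a::real_normed_vector set \<Rightarrow> (real \<Rightarrow> 'a) set" where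
  "DC_curves_in M X = {c. range c \<subseteq> X \<and> (\<exists>D. curve_derivs c D \<and>
      (\<forall>K. compact K \<longrightarrow> (\<exists>C \<rho>. C > 0 \<and> \<rho> > 0 \<and>
         (\<forall>k. \<forall>t\<in>K. norm (D k t) \<le> C * \<rho> ^ k * fact k * M k))))}"

definition Ainf :: "'a::real_normed_vector set \<Rightarrow> ('a \<Rightarrow> real) set" where
  "Ainf X = {f. \<forall>c\<in>smooth_curves_in X. smooth_curve (f \<circ> c)}"

definition AinfM :: "(nat \<Rightarrow> real) \<Rightarrow> 'a::real_normed_vector set \<Rightarrow> ('a \<Rightarrow> real) set" where
  "AinfM M X = {f. \<forall>c\<in>DC_curves_in M X. smooth_curve (f \<circ> c)}"

definition smooth_on :: "'a::euclidean_space set \<Rightarrow> ('a \<Rightarrow> real) \<Rightarrow> bool" where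
  "smooth_on U F \<longleftrightarrow> (\<exists>D :: 'a list \<Rightarrow> 'a \<Rightarrow> real.
      (\<forall>x\<in>U. D [] x = F x) \<and>
      (\<forall>bs. set bs \<subseteq> Basis \<longrightarrow> continuous_on U (D bs)) \<and>
      (\<forall>bs b x. set bs \<subseteq> Basis \<longrightarrow> b \<in> Basis \<longrightarrow> x \<in> U \<longrightarrow>
          ((\<lambda>t. D bs (x + t *\<^sub>R b)) has_real_derivative D (b # bs) x) (at 0)))"

definition Cinf :: "'a::euclidean_space set \<Rightarrow> ('a \<Rightarrow> real) set" where
  "Cinf X = {f. \<forall>x\<in>X. \<exists>U F. open U \<and> x \<in> U \<and> smooth_on U F \<and> (\<forall>y\<in>U \<inter> X. F y = f y)}"

definition non_quasianalytic :: "(nat \<Rightarrow> real) \<Rightarrow> bool" where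
  "non_quasianalytic M \<longleftrightarrow> summable (\<lambda>k. M k / ((real k + 1) * M (Suc k)))"

definition log_convex_seq :: "(nat \<Rightarrow> real) \<Rightarrow> bool" where
  "log_convex_seq M \<longleftrightarrow> (\<forall>k\<ge>1. (M k)\<^sup>2 \<le> M (k - 1) * M (k + 1))"

(* distinguished last coordinate direction e_d (any fixed basis vector; the choice is
   immaterial since A ranges over all of O(d)) *)
definition e_last :: "'a::euclidean_space" where
  "e_last = (SOME b. b \<in> Basis)"

(* truncated open cusp Gamma^alpha_d(r,h), with x' = x - (x.e_d) e_d and x_d = x.e_d *)
definition cusp :: "real \<Rightarrow> real \<Rightarrow> real \<Rightarrow> 'a::euclidean_space set" where
  "cusp \<alpha> r h = {x. norm (x - (x \<bullet> e_last) *\<^sub>R e_last) < r \<and>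
      h * (norm (x - (x \<bullet> e_last) *\<^sub>R e_last) / r) powr \<alpha> < x \<bullet> e_last \<and> x \<bullet> e_last < h}"

definition uniform_cusp_property :: "real \<Rightarrow> 'a::euclidean_space set \<Rightarrow> bool" where
  "uniform_cusp_property \<alpha> U \<longleftrightarrow> (\<forall>x\<in>frontier U. \<exists>\<epsilon>>0. \<exists>r>0. \<exists>h>0. \<exists>A.
      orthogonal_transformation A \<and>
      (\<forall>y\<in>closure U \<inter> ball x \<epsilon>. (\<lambda>z. y + A z) ` (cusp \<alpha> r h :: 'a set) \<subseteq> U))"

definition fat :: "'a::real_normed_vector set \<Rightarrow> bool" where
  "fat X \<longleftrightarrow> X \<noteq> {} \<and> X = closure (interior X)"

definition alpha_set :: "real \<Rightarrow> 'a::euclidean_space set \<Rightarrow> bool" where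
  "alpha_set \<alpha> X \<longleftrightarrow> closed X \<and> fat X \<and> uniform_cusp_property \<alpha> (interior X)"

definition hoelder_set :: "'a::euclidean_space set \<Rightarrow> bool" where
  "hoelder_set X \<longleftrightarrow> (\<exists>\<alpha>. 0 < \<alpha> \<and> \<alpha> \<le> 1 \<and> alpha_set \<alpha> X)"

end

theory Submission
  imports Defs
begin

text \<open>
  Only \<open>AinfM M X \<subseteq> Cinf X\<close> needs work; the other inclusions are the chain rule and the inclusion of the curve classes.

  Let \<open>f \<in> AinfM M X\<close>. The cusp property provides at each \<open>x \<in> X\<close> a direction \<open>e\<close> and an exponent \<open>q\<close> such that the curves
  \<open>u \<mapsto> y + u\<^sup>2 e + u\<^sup>q w\<close> stay in \<open>X\<close> for all \<open>y \<in> X\<close> near \<open>x\<close> and all small \<open>w\<close> (with \<open>e = 0\<close> and \<open>q = 1\<close> at interior points).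
  Since \<open>M\<close> is not quasianalytic, infinitely many such arcs can be joined to one curve of class \<open>C\<^sup>M\<close>, hence all
  derivatives of \<open>u \<mapsto> f (y + u\<^sup>2 e + u\<^sup>q w)\<close> are bounded uniformly in \<open>y\<close> and \<open>w\<close>. In the interior this bounds the pure
  differences of \<open>f\<close> of all orders, therefore also the mixed ones, and \<open>f\<close> is smooth there. Near the boundary, mixed
  differences with step \<open>u\<^sup>q\<close> based at \<open>y + u\<^sup>2 e\<close> vanish to order \<open>q k\<close> at \<open>u = 0\<close> with the \<open>k\<close>-th partial derivatives of \<open>f\<close> at \<open>y\<close>
  as leading coefficients, so all partial derivatives of \<open>f\<close> are bounded near each point of \<open>X\<close>. Finally \<open>f\<close> is
  extended across the boundary by polynomial extrapolation along \<open>e\<close>, with steps tending to \<open>0\<close> and orders tending to \<open>\<infinity>\<close>,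
  glued by cutoff functions.
\<close>

text \<open>Nothing is known about \<open>f\<close> beyond its behaviour along curves, not even
  continuity. Derivatives therefore have to be produced from finite differences, with bounds uniform
  in the base point before any limit is taken. Uniformity comes from a contradiction: one curve runs
  through a sequence of offending arcs, and the sizes of these arcs must be fixed before the
  offending points are known.

  The square in \<open>u\<^sup>2\<close> lets an arc descend to \<open>y\<close> and return on the
  same side, smoothly through u = 0. A step of order \<open>u\<^sup>q\<close> is what the width of
  the cusp at height \<open>u\<^sup>2\<close> allows; this is why k partial derivatives of f require
  q k derivatives along the arc.

  Bounded partial derivatives in the interior do not by themselves give an extension: two close
  points of X may be joined inside X by comparatively long paths only, and their Taylor polynomials
  are then hard to compare. Extrapolation samples f on rays in the single direction
  \<open>e\<close>, so one-dimensional Taylor estimates on segments inside X suffice. Letting the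
  orders tend to infinity yields one smooth extension instead of one extension for each finite
  order.\<close>

section \<open>Families of derivatives on the real line\<close>

text \<open>The derivatives are two-sided at every point of \<open>S\<close>, open or not, while
  \<open>g\<close> matters on \<open>S\<close> only. A family may thus be restricted to a closed
  interval and still be differentiated at the end points.\<close>

definition derivs_on :: "real set \<Rightarrow> (real \<Rightarrow> real) \<Rightarrow> (nat \<Rightarrow> real \<Rightarrow> real) \<Rightarrow> bool" where
  "derivs_on S g D \<longleftrightarrow> (\<forall>x\<in>S. D 0 x = g x) \<and>
     (\<forall>k. \<forall>x\<in>S. (D k has_real_derivative D (Suc k) x) (at x))"

lemma derivs_onI:
  assumes "\<And>x. x \<in> S \<Longrightarrow> D 0 x = g x"
    and "\<And>k x. x \<in> S \<Longrightarrow> (D k has_real_derivative D (Suc k) x) (at x)"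
  shows "derivs_on S g D"
  using assms by (simp add: derivs_on_def)

lemma derivs_onD:
  assumes "derivs_on S g D" "x \<in> S"
  shows "D 0 x = g x" "(D k has_real_derivative D (Suc k) x) (at x)"
  using assms by (auto simp: derivs_on_def)

lemma derivs_on_mono: "derivs_on S g D \<Longrightarrow> T \<subseteq> S \<Longrightarrow> derivs_on T g D"
  by (auto simp: derivs_on_def)

lemma derivs_on_cong: "derivs_on S g D \<Longrightarrow> (\<And>x. x \<in> S \<Longrightarrow> g x = g' x) \<Longrightarrow> derivs_on S g' D"
  by (auto simp: derivs_on_def)

lemma curve_derivs_iff_derivs_on: "curve_derivs c D \<longleftrightarrow> derivs_on UNIV c D" for c :: "real \<Rightarrow> real"
  by (auto simp: curve_derivs_def derivs_on_def has_real_derivative_iff_has_vector_derivative)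

lemma derivs_on_unique:
  assumes "open S" "derivs_on S g D" "derivs_on S g E" "x \<in> S"
  shows "D k x = E k x"
  using assms(4)
proof (induction k arbitrary: x)
  case 0
  then show ?case using assms derivs_onD(1) by metis
next
  case (Suc k)
  have "(D k has_real_derivative D (Suc k) x) (at x)"
    using assms(2) Suc.prems by (rule derivs_onD)
  then have "(E k has_real_derivative D (Suc k) x) (at x)"
    by (rule has_field_derivative_transform_within_open[OF _ assms(1) Suc.prems]) (use Suc.IH in simp)
  moreover have "(E k has_real_derivative E (Suc k) x) (at x)"
    using assms(3) Suc.prems by (rule derivs_onD)
  ultimately show ?case by (rule DERIV_unique)
qed

lemma derivs_on_deriv:
  assumes "open S" "derivs_on S g D"
  shows "derivs_on S g (\<lambda>k. (deriv ^^ k) g)" "x \<in> S \<Longrightarrow> (deriv ^^ k) g x = D k x"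
proof -
  have eq: "\<forall>x\<in>S. (deriv ^^ k) g x = D k x" for k
  proof (induction k)
    case 0
    then show ?case using assms by (simp add: derivs_on_def)
  next
    case (Suc k)
    show ?case
    proof
      fix x assume x: "x \<in> S"
      have "(D k has_real_derivative D (Suc k) x) (at x)"
        using assms(2) x by (rule derivs_onD)
      then have "((deriv ^^ k) g has_real_derivative D (Suc k) x) (at x)"
        by (rule has_field_derivative_transform_within_open[OF _ assms(1) x]) (use Suc.IH in simp)
      then show "(deriv ^^ Suc k) g x = D (Suc k) x" by (simp add: DERIV_imp_deriv)
    qed
  qed
  then show "x \<in> S \<Longrightarrow> (deriv ^^ k) g x = D k x" by blast
  show "derivs_on S g (\<lambda>k. (deriv ^^ k) g)"
  proof (rule derivs_onI)
    fix k x assume x: "x \<in> S"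
    have "(D k has_real_derivative D (Suc k) x) (at x)"
      using assms(2) x by (rule derivs_onD)
    then have "((deriv ^^ k) g has_real_derivative D (Suc k) x) (at x)"
      by (rule has_field_derivative_transform_within_open[OF _ assms(1) x]) (use eq in simp)
    then show "((deriv ^^ k) g has_real_derivative (deriv ^^ Suc k) g x) (at x)"
      using eq x by metis
  qed simp
qed

text \<open>The local families need not fit together as given; iterating \<open>deriv\<close>
  selects the same family everywhere.\<close>

lemma smooth_curve_local:
  fixes g :: "real \<Rightarrow> real"
  assumes "\<And>t. \<exists>S D. open S \<and> t \<in> S \<and> derivs_on S g D"
  shows "smooth_curve g"
proof -
  have "derivs_on UNIV g (\<lambda>k. (deriv ^^ k) g)"
  proof (rule derivs_onI)
    fix k t
    obtain S D where S: "open S" "t \<in> S" "derivs_on S g D" using assms by blast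
    show "((deriv ^^ k) g has_real_derivative (deriv ^^ Suc k) g t) (at t)"
      using derivs_onD(2)[OF derivs_on_deriv(1)[OF S(1,3)] S(2)] .
  qed simp
  then show ?thesis by (auto simp: smooth_curve_def curve_derivs_iff_derivs_on)
qed

lemma derivs_on_affine:
  assumes "derivs_on S g D" "\<And>x. x \<in> T \<Longrightarrow> a + b * x \<in> S"
  shows "derivs_on T (\<lambda>x. g (a + b * x)) (\<lambda>k x. b ^ k * D k (a + b * x))"
proof (rule derivs_onI)
  fix k x assume "x \<in> T"
  then have "(D k has_real_derivative D (Suc k) (a + b * x)) (at (a + b * x))"
    using assms derivs_onD(2) by blast
  then have "((\<lambda>x. D k (a + b * x)) has_real_derivative D (Suc k) (a + b * x) * b) (at x)"
    by (rule DERIV_chain2) (auto intro!: derivative_eq_intros)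
  then show "((\<lambda>x. b ^ k * D k (a + b * x)) has_real_derivative b ^ Suc k * D (Suc k) (a + b * x)) (at x)"
    by (auto intro!: derivative_eq_intros)
qed (use assms in \<open>auto simp: derivs_on_def\<close>)

lemma derivs_on_diff:
  assumes "derivs_on S g D" "derivs_on S h E"
  shows "derivs_on S (\<lambda>x. g x - h x) (\<lambda>k x. D k x - E k x)"
  using assms by (auto simp: derivs_on_def intro!: derivative_eq_intros)

lemma derivs_on_taylor:
  assumes "derivs_on {-r<..<r} g D" "\<bar>x\<bar> < r"
  shows "\<exists>t. \<bar>t\<bar> \<le> \<bar>x\<bar> \<and> g x = (\<Sum>m<n. D m 0 / fact m * x ^ m) + D n t / fact n * x ^ n"
proof -
  have "\<forall>m t. m < n \<and> \<bar>t\<bar> \<le> \<bar>x\<bar> \<longrightarrow> DERIV (D m) t :> D (Suc m) t"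
    using assms by (auto intro!: derivs_onD)
  moreover have "D 0 x = g x" using derivs_onD(1)[OF assms(1), of x] assms(2) by (simp add: abs_less_iff)
  ultimately show ?thesis using Maclaurin_bi_le[of D "D 0" n x] by auto
qed

text \<open>If the coefficients below j vanish, Taylor's formula reads g x = D j \<xi> / j! x^j with
  an intermediate point \<xi>; dividing by x^j and letting x tend to 0 from the right gives D j 0 =
  0, because j < k.\<close>

lemma derivs_zero_of_small:
  assumes D: "derivs_on {-r<..<r} g D" and r: "0 < r"
    and B: "\<And>x. 0 < x \<Longrightarrow> x < r \<Longrightarrow> \<bar>g x\<bar> \<le> B * x ^ k"
  shows "j < k \<Longrightarrow> D j 0 = 0"
proof (induction j rule: less_induct)
  case (less j)
  define \<phi> where "\<phi> x = (SOME t. \<bar>t\<bar> \<le> \<bar>x\<bar> \<and> g x = D j t / fact j * x ^ j)" for x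
  have \<phi>: "\<bar>\<phi> x\<bar> \<le> \<bar>x\<bar> \<and> g x = D j (\<phi> x) / fact j * x ^ j" if x: "\<bar>x\<bar> < r" for x
  proof -
    have "(\<Sum>m<j. D m 0 / fact m * x ^ m) = 0"
      using less by (intro sum.neutral) auto
    with derivs_on_taylor[OF D x, of j] have "\<exists>t. \<bar>t\<bar> \<le> \<bar>x\<bar> \<and> g x = D j t / fact j * x ^ j" by simp
    then show ?thesis unfolding \<phi>_def by (rule someI_ex)
  qed
  have ev: "\<forall>\<^sub>F x in at_right 0. 0 < x \<and> x < r"
    using r by (auto simp: eventually_at_right)
  have "(\<phi> \<longlongrightarrow> 0) (at_right 0)"
  proof (rule Lim_null_comparison[where g="\<lambda>x. x"])
    show "\<forall>\<^sub>F x in at_right 0. norm (\<phi> x) \<le> x"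
    proof (rule eventually_mono[OF ev])
      show "norm (\<phi> x) \<le> x" if "0 < x \<and> x < r" for x using \<phi>[of x] that by simp
    qed
  qed (auto intro!: tendsto_eq_intros)
  moreover have "isCont (D j) 0"
    using derivs_onD(2)[OF D, of 0 j] r DERIV_isCont by auto
  ultimately have lim: "((\<lambda>x. D j (\<phi> x)) \<longlongrightarrow> D j 0) (at_right 0)"
    by (rule isCont_tendsto_compose[rotated])
  have "((\<lambda>x. D j (\<phi> x)) \<longlongrightarrow> 0) (at_right 0)"
  proof (rule Lim_null_comparison[where g="\<lambda>x. fact j * B * x ^ (k - j)"])
    show "\<forall>\<^sub>F x in at_right 0. norm (D j (\<phi> x)) \<le> fact j * B * x ^ (k - j)"
    proof (rule eventually_mono[OF ev])
      fix x assume x: "0 < x \<and> x < r"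
      have "\<bar>D j (\<phi> x)\<bar> * x ^ j = fact j * \<bar>g x\<bar>"
        using \<phi>[of x] x by (simp add: abs_mult)
      also have "\<dots> \<le> fact j * (B * x ^ k)" using B x by (intro mult_left_mono) auto
      also have "\<dots> = fact j * B * x ^ (k - j) * x ^ j"
        using less.prems by (simp flip: power_add)
      finally show "norm (D j (\<phi> x)) \<le> fact j * B * x ^ (k - j)"
        using x by simp
    qed
    show "((\<lambda>x. fact j * B * x ^ (k - j)) \<longlongrightarrow> 0) (at_right 0)"
      using less.prems by (auto intro!: tendsto_eq_intros)
  qed
  with lim show ?case using tendsto_unique trivial_limit_at_right_real by blast
qed

text \<open>The coefficient of x^k is what later becomes a partial derivative: the lower Taylor
  coefficients vanish by flatness, and the next derivative controls the remainder.\<close>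

lemma derivs_on_flat_remainder:
  assumes D: "derivs_on {-r<..<r} g D" and r: "0 < r"
    and B: "\<And>x. 0 < x \<Longrightarrow> x < r \<Longrightarrow> \<bar>g x\<bar> \<le> B * x ^ k"
    and C: "\<And>x. \<bar>x\<bar> < r \<Longrightarrow> \<bar>D (Suc k) x\<bar> \<le> C" and x: "0 < x" "x < r"
  shows "\<bar>g x - x ^ k * (D k 0 / fact k)\<bar> \<le> C * x ^ Suc k"
proof -
  have "\<bar>x\<bar> < r" using x by simp
  from derivs_on_taylor[OF D this, of "Suc k"] obtain t where t: "\<bar>t\<bar> \<le> \<bar>x\<bar>"
    "g x = (\<Sum>m<Suc k. D m 0 / fact m * x ^ m) + D (Suc k) t / fact (Suc k) * x ^ Suc k" by blast
  have "(\<Sum>m<k. D m 0 / fact m * x ^ m) = 0"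
    using derivs_zero_of_small[OF D r B] by (intro sum.neutral) auto
  then have "g x - x ^ k * (D k 0 / fact k) = D (Suc k) t / fact (Suc k) * x ^ Suc k"
    using t by simp
  then have "\<bar>g x - x ^ k * (D k 0 / fact k)\<bar> = \<bar>D (Suc k) t\<bar> / fact (Suc k) * x ^ Suc k"
    using x by (simp add: abs_mult power_abs)
  also have "\<dots> \<le> C / 1 * x ^ Suc k"
    using C[of t] t(1) x by (intro mult_right_mono frac_le fact_ge_1) auto
  finally show ?thesis by simp
qed

text \<open>A finite limit L makes g of order x^N, so the Taylor coefficients below N vanish and g x
  / x^N is a value of D N divided by N!. In this way a bound for a derivative along a curve becomes
  a bound for a leading coefficient.\<close>

lemma leading_coeff_bound:
  assumes D: "derivs_on {-r<..<r} g D" and r: "0 < r"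
    and B: "\<And>x. \<bar>x\<bar> < r \<Longrightarrow> \<bar>D N x\<bar> \<le> B"
    and L: "((\<lambda>x. g x / x ^ N) \<longlongrightarrow> L) (at_right 0)"
  shows "\<bar>L\<bar> \<le> B"
proof -
  have "\<forall>\<^sub>F x in at_right 0. \<bar>g x / x ^ N\<bar> < \<bar>L\<bar> + 1"
    using order_tendstoD(2)[OF tendsto_rabs[OF L], of "\<bar>L\<bar> + 1"] by simp
  then obtain s where s: "0 < s" "\<And>x. 0 < x \<Longrightarrow> x < s \<Longrightarrow> \<bar>g x / x ^ N\<bar> < \<bar>L\<bar> + 1"
    unfolding eventually_at_right_field by blast
  define r' where "r' = min r s"
  have r': "0 < r'" "r' \<le> r" "r' \<le> s" using s r by (auto simp: r'_def)
  have D': "derivs_on {-r'<..<r'} g D" using D by (rule derivs_on_mono) (use r' in auto)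
  have small: "\<bar>g x\<bar> \<le> (\<bar>L\<bar> + 1) * x ^ N" if "0 < x" "x < r'" for x
    using s(2)[of x] that r' by (simp add: field_simps)
  have "\<bar>g x / x ^ N\<bar> \<le> B" if x: "0 < x" "x < r'" for x
  proof -
    have "\<bar>x\<bar> < r'" using x by simp
    from derivs_on_taylor[OF D' this, of N] obtain t where t: "\<bar>t\<bar> \<le> \<bar>x\<bar>"
      "g x = (\<Sum>m<N. D m 0 / fact m * x ^ m) + D N t / fact N * x ^ N" by blast
    have "(\<Sum>m<N. D m 0 / fact m * x ^ m) = 0"
      using derivs_zero_of_small[OF D' r'(1) small] by (intro sum.neutral) auto
    then have "g x / x ^ N = D N t / fact N" using t x by simp
    then have "\<bar>g x / x ^ N\<bar> = \<bar>D N t\<bar> / fact N" by simp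
    also have "\<dots> \<le> B / 1"
      using B[of t] t(1) x r' by (intro frac_le) auto
    finally show ?thesis by simp
  qed
  then have "\<forall>\<^sub>F x in at_right 0. \<bar>g x / x ^ N\<bar> \<le> B"
    using r' by (auto simp: eventually_at_right)
  then show ?thesis
    using tendsto_upperbound[OF tendsto_rabs[OF L]] trivial_limit_at_right_real by blast
qed

text \<open>Induction through the function g y - g (y + u): its n-th derivative is at most B u by
  the mean value theorem, and its n-th difference is the (n+1)-st difference of g by Pascal's
  rule.\<close>

lemma pure_difference_bound:
  assumes D: "derivs_on S g D" and S: "{x..x + real n * u} \<subseteq> S" and u: "0 \<le> u"
    and B: "\<And>y. y \<in> {x..x + real n * u} \<Longrightarrow> \<bar>D n y\<bar> \<le> B"
  shows "\<bar>\<Sum>i\<le>n. (-1) ^ i * real (n choose i) * g (x + real i * u)\<bar> \<le> B * u ^ n"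
  using D S B
proof (induction n arbitrary: g D S B)
  case 0
  then show ?case using derivs_onD(1)[OF 0(1), of x] by auto
next
  case (Suc n)
  let ?h = "\<lambda>y. g y - g (y + u)" and ?E = "\<lambda>k y. D k y - D k (y + u)"
  have sub: "y \<in> S" "y + u \<in> S" if "y \<in> {x..x + real n * u}" for y
    using that Suc.prems(2) u by (auto simp: algebra_simps subset_iff)
  have E: "derivs_on {x..x + real n * u} ?h ?E"
    using derivs_on_diff[OF derivs_on_mono[OF Suc.prems(1), of "{x..x + real n * u}"]
        derivs_on_affine[OF Suc.prems(1), of "{x..x + real n * u}" u 1]] sub
    by (simp add: add.commute subset_iff)
  have bound: "\<bar>?E n y\<bar> \<le> B * u" if y: "y \<in> {x..x + real n * u}" for y
  proof (cases "u = 0")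
    case False
    have in': "t \<in> {x..x + real (Suc n) * u}" if "y \<le> t" "t \<le> y + u" for t
      using that y u by (auto simp: algebra_simps)
    have "\<exists>z. y < z \<and> z < y + u \<and> D n (y + u) - D n y = (y + u - y) * D (Suc n) z"
    proof (rule MVT2)
      fix t assume "y \<le> t" "t \<le> y + u"
      then have "t \<in> S" using in' Suc.prems(2) by blast
      with Suc.prems(1) show "DERIV (D n) t :> D (Suc n) t" by (rule derivs_onD)
    qed (use False u in simp)
    then obtain z where z: "y < z" "z < y + u" "D n (y + u) - D n y = u * D (Suc n) z" by auto
    have "\<bar>D (Suc n) z\<bar> \<le> B" using Suc.prems(3) in' z by auto
    then have "u * \<bar>D (Suc n) z\<bar> \<le> u * B" using u by (rule mult_left_mono)
    moreover have "\<bar>?E n y\<bar> = u * \<bar>D (Suc n) z\<bar>"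
      using z(3) u by (metis abs_minus_commute abs_mult abs_of_nonneg)
    ultimately show ?thesis by (simp add: mult.commute)
  qed simp
  have "\<bar>\<Sum>i\<le>n. (-1) ^ i * real (n choose i) * ?h (x + real i * u)\<bar> \<le> B * u * u ^ n"
    by (rule Suc.IH[OF E]) (use bound in auto)
  moreover have "(\<Sum>i\<le>Suc n. (-1) ^ i * real (Suc n choose i) * g (x + real i * u))
     = (\<Sum>i\<le>n. (-1) ^ i * real (n choose i) * ?h (x + real i * u))"
  proof -
    have a: "(\<Sum>i\<le>Suc n. (-1) ^ i * real (Suc n choose i) * g (x + real i * u))
        = g x + (\<Sum>i\<le>n. (-1) ^ Suc i * real (n choose i) * g (x + real (Suc i) * u))
          + (\<Sum>i\<le>n. (-1) ^ Suc i * real (n choose Suc i) * g (x + real (Suc i) * u))"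
      by (subst sum.atMost_Suc_shift) (simp add: algebra_simps sum.distrib sum_negf sum_subtractf)
    \<comment> \<open>The term i = n + 1 has coefficient 0; it is kept so that the shift of the
      index matches \<open>a\<close>.\<close>
    have "(\<Sum>i\<le>Suc n. (-1) ^ i * real (n choose i) * g (x + real i * u))
       = g x + (\<Sum>i\<le>n. (-1) ^ Suc i * real (n choose Suc i) * g (x + real (Suc i) * u))"
      by (subst sum.atMost_Suc_shift) simp
    then have b: "g x + (\<Sum>i\<le>n. (-1) ^ Suc i * real (n choose Suc i) * g (x + real (Suc i) * u))
       = (\<Sum>i\<le>n. (-1) ^ i * real (n choose i) * g (x + real i * u))"
      by (simp add: binomial_eq_0)
    show ?thesis unfolding a using b
      by (simp add: algebra_simps sum_subtractf sum_negf)
  qed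
  ultimately show ?case by (simp add: mult.assoc)
qed

section \<open>Bump functions with controlled derivatives\<close>

text \<open>The weights \<open>q j / sqrt (\<Sum>i\<ge>j. q i)\<close> are still summable, by comparison with a telescoping
  series of square roots of the tails.\<close>

lemma summable_dominating_sequence:
  fixes q :: "nat \<Rightarrow> real"
  assumes "\<And>j. 0 < q j" "summable q"
  obtains a where "\<And>j. 0 < a j" "summable a" "(\<lambda>j. q j / a j) \<longlonglongrightarrow> 0"
proof -
  define r where "r j = (\<Sum>i. q (i + j))" for j
  have sm: "summable (\<lambda>i. q (i + j))" for j using assms(2) by (simp add: summable_iff_shift)
  have r_pos: "0 < r j" for j unfolding r_def by (rule suminf_pos[OF sm]) (use assms in auto)
  have r_Suc: "r j = q j + r (Suc j)" for j
    using suminf_split_head[OF sm[of j]] by (simp add: r_def)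
  have r_lim: "r \<longlonglongrightarrow> 0" unfolding r_def using suminf_exist_split2[OF assms(2)] by simp
  define a where "a j = q j / sqrt (r j)" for j
  have a_pos: "0 < a j" for j using assms r_pos by (simp add: a_def)
  have a_le: "a j \<le> 2 * (sqrt (r j) - sqrt (r (Suc j)))" for j
  proof -
    have "q j = (sqrt (r j) - sqrt (r (Suc j))) * (sqrt (r j) + sqrt (r (Suc j)))"
      using r_Suc[of j] r_pos[of j] r_pos[of "Suc j"] by (simp add: algebra_simps)
    also have "\<dots> \<le> (sqrt (r j) - sqrt (r (Suc j))) * (sqrt (r j) + sqrt (r j))"
      using r_Suc[of j] assms(1)[of j] by (intro mult_left_mono add_left_mono) auto
    finally show ?thesis using r_pos[of j] by (simp add: a_def field_simps)
  qed
  have tel: "(\<lambda>j. sqrt (r j) - sqrt (r (Suc j))) sums (sqrt (r 0) - sqrt 0)"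
    by (rule telescope_sums') (intro tendsto_real_sqrt r_lim)
  have "summable (\<lambda>j. 2 * (sqrt (r j) - sqrt (r (Suc j))))"
    using sums_summable[OF tel] by (rule summable_mult)
  then have "summable a"
    by (rule summable_comparison_test'[where N=0]) (use a_le a_pos less_imp_le in \<open>auto simp: abs_of_pos\<close>)
  moreover have "(\<lambda>j. q j / a j) = (\<lambda>j. sqrt (r j))"
  proof
    show "q j / a j = sqrt (r j)" for j using assms(1)[of j] by (simp add: a_def)
  qed
  then have "(\<lambda>j. q j / a j) \<longlonglongrightarrow> 0"
    using tendsto_real_sqrt[OF r_lim] by simp
  ultimately show thesis using that a_pos by blast
qed

text \<open>Once s j < \<rho> the quotients \<open>P k\<close> decrease, so their maximum over the
  finitely many earlier indices bounds all of them. Applied with every \<rho> > 0, this yields the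
  Beurling type of the bump below.\<close>

lemma prod_le_geometric_of_tendsto_0:
  fixes s :: "nat \<Rightarrow> real"
  assumes "\<And>j. 0 < s j" "s \<longlonglongrightarrow> 0" "0 < \<rho>"
  shows "\<exists>C>0. \<forall>k. (\<Prod>j<k. s j) \<le> C * \<rho> ^ k"
proof -
  obtain N where N: "\<And>j. j \<ge> N \<Longrightarrow> s j < \<rho>"
    using order_tendstoD(2)[OF assms(2,3)] by (auto simp: eventually_sequentially)
  define P where "P k = (\<Prod>j<k. s j) / \<rho> ^ k" for k
  have P_pos: "0 < P k" for k using assms by (auto simp: P_def intro!: divide_pos_pos prod_pos)
  define C where "C = Max (P ` {..N})"
  have C: "P k \<le> C" if "k \<le> N" for k using that by (auto simp: C_def intro!: Max_ge)
  have dec: "P k \<le> C" if "N \<le> k" for k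
    using that
  proof (induction k rule: dec_induct)
    case (step k)
    have "P (Suc k) = P k * (s k / \<rho>)" using assms(3) by (simp add: P_def field_simps)
    also have "\<dots> \<le> P k * 1"
      using N[of k] step assms(3) P_pos[of k] by (intro mult_left_mono) auto
    finally show ?case using step by simp
  qed (rule C, simp)
  have "(\<Prod>j<k. s j) \<le> C * \<rho> ^ k" for k
    using C[of k] dec[of k] assms(3) by (cases "k \<le> N") (auto simp: P_def field_simps)
  moreover have "0 < C" using C[of 0] P_pos[of 0] by simp
  ultimately show ?thesis by blast
qed

section \<open>Iterated moving averages\<close>

definition steklov :: "real \<Rightarrow> (real \<Rightarrow> real) \<Rightarrow> real \<Rightarrow> real" where
  "steklov a g x = integral {x - a..x + a} g / (2 * a)"

lemma steklov_const_on:
  assumes "0 < a" "\<And>y. \<bar>y - x\<bar> \<le> a \<Longrightarrow> g y = v"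
  shows "steklov a g x = v"
proof -
  have "integral {x - a..x + a} g = integral {x - a..x + a} (\<lambda>_. v)"
    by (rule integral_cong) (use assms in \<open>auto simp: abs_le_iff\<close>)
  then show ?thesis using assms by (simp add: steklov_def)
qed

lemma steklov_mono:
  assumes "0 < a" "continuous_on UNIV g" "continuous_on UNIV h" "\<And>y. \<bar>y - x\<bar> \<le> a \<Longrightarrow> g y \<le> h y"
  shows "steklov a g x \<le> steklov a h x"
  unfolding steklov_def
  by (intro divide_right_mono integral_le integrable_continuous_real)
     (use assms in \<open>auto simp: abs_le_iff intro: continuous_on_subset\<close>)

lemma steklov_dist:
  assumes a: "0 < a" and c: "continuous_on UNIV g" "continuous_on UNIV h"
    and e: "\<And>y. \<bar>y - x\<bar> \<le> a \<Longrightarrow> \<bar>g y - h y\<bar> \<le> e"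
  shows "\<bar>steklov a g x - steklov a h x\<bar> \<le> e"
proof -
  have i: "g integrable_on {x - a..x + a}" "h integrable_on {x - a..x + a}"
    using c by (auto intro!: integrable_continuous_real intro: continuous_on_subset)
  have "norm (integral (cbox (x - a) (x + a)) (\<lambda>y. g y - h y)) \<le> e * measure lborel (cbox (x - a) (x + a))"
    by (rule has_integral_bound[OF _ integrable_integral])
       (use i a e order_trans[OF abs_ge_zero e[of x]] in \<open>auto intro!: integrable_diff simp: abs_le_iff\<close>)
  then have "\<bar>integral {x - a..x + a} g - integral {x - a..x + a} h\<bar> \<le> e * (2 * a)"
    using i a by (simp add: integral_diff)
  then show ?thesis using a by (simp add: steklov_def field_simps flip: diff_divide_distrib)
qed

lemma steklov_shift: "steklov a (\<lambda>y. g (y + s)) x = steklov a g (x + s)"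
  using integral_shift_real_ivl[of "x + s - a" s "x + s + a" g]
  by (simp add: steklov_def algebra_simps)

lemma steklov_DERIV:
  assumes a: "0 < a" and c: "continuous_on UNIV g"
  shows "(steklov a g has_real_derivative (g (x + a) - g (x - a)) / (2 * a)) (at x)"
proof -
  define z where "z = x - a - 1"
  define I where "I y = integral {z..y} g" for y
  have I: "(I has_real_derivative g y) (at y)" if "z < y" for y
  proof -
    have "((\<lambda>u. integral {z..u} g) has_real_derivative g y) (at y within {z..y+1})"
      by (rule integral_has_real_derivative) (use c that in \<open>auto intro: continuous_on_subset\<close>)
    then show ?thesis using that at_within_Icc_at[of z y "y + 1"] by (simp add: I_def[abs_def])
  qed
  have eq: "steklov a g y = (I (y + a) - I (y - a)) / (2 * a)" if "y \<in> {z + a<..}" for y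
  proof -
    have "I (y - a) + integral {y - a..y + a} g = I (y + a)"
      unfolding I_def
      by (rule Henstock_Kurzweil_Integration.integral_combine)
         (use that a c in \<open>auto intro!: integrable_continuous_real intro: continuous_on_subset\<close>)
    then show ?thesis by (simp add: steklov_def flip: divide_diff_eq_iff)
  qed
  have 1: "((\<lambda>y. I (y + a)) has_real_derivative g (x + a)) (at x)"
    using I[of "x + a"] a by (simp add: DERIV_shift z_def)
  have 2: "((\<lambda>y. I (y - a)) has_real_derivative g (x - a)) (at x)"
    using I[of "x - a"] DERIV_shift[of I _ x "- a"] by (simp add: z_def)
  have "((\<lambda>y. (I (y + a) - I (y - a)) / (2 * a)) has_real_derivative (g (x + a) - g (x - a)) / (2 * a)) (at x)"
    by (rule DERIV_cdivide[OF DERIV_diff[OF 1 2]])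
  then show ?thesis
    by (rule has_field_derivative_transform_within_open[where S="{z + a<..}"])
       (use eq in \<open>auto simp: z_def\<close>)
qed

lemma lipschitz_continuous_on:
  fixes g :: "real \<Rightarrow> real"
  assumes "\<And>x y. \<bar>g x - g y\<bar> \<le> L * \<bar>x - y\<bar>"
  shows "continuous_on S g"
proof -
  have "0 \<le> L" using assms[of 1 0] by (smt (verit) mult_cancel_left2)
  then have "L-lipschitz_on S g" using assms by (auto simp: lipschitz_on_def dist_real_def)
  then show ?thesis by (rule lipschitz_on_continuous_on)
qed

lemma steklov_lipschitz:
  assumes a: "0 < a" and L: "\<And>x y. \<bar>g x - g y\<bar> \<le> L * \<bar>x - y\<bar>"
  shows "\<bar>steklov a g x - steklov a g y\<bar> \<le> L * \<bar>x - y\<bar>"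
proof -
  note c = lipschitz_continuous_on[OF L, of UNIV]
  have "\<bar>steklov a (\<lambda>z. g (z + (x - y))) y - steklov a g y\<bar> \<le> L * \<bar>x - y\<bar>"
  proof (rule steklov_dist[OF a _ c])
    show "continuous_on UNIV (\<lambda>z. g (z + (x - y)))"
      by (rule continuous_on_compose2[OF c]) (auto intro!: continuous_intros)
    show "\<bar>g (z + (x - y)) - g z\<bar> \<le> L * \<bar>x - y\<bar>" for z using L[of "z + (x - y)" z] by simp
  qed
  then show ?thesis by (simp add: steklov_shift)
qed

text \<open>\<open>steklov_iter a g k n\<close> averages \<open>g\<close> over the radii \<open>a k, \<dots>, a (k + n - 1)\<close>; its limit for
  \<open>n \<rightarrow> \<infinity>\<close> is the infinite convolution that starts at index \<open>k\<close>.\<close>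

fun steklov_iter :: "(nat \<Rightarrow> real) \<Rightarrow> (real \<Rightarrow> real) \<Rightarrow> nat \<Rightarrow> nat \<Rightarrow> real \<Rightarrow> real" where
  "steklov_iter a g k 0 = g"
| "steklov_iter a g k (Suc n) = steklov (a k) (steklov_iter a g (Suc k) n)"

text \<open>The k-th derivative of the average \<open>G j\<close>: each differentiation turns the
  outermost average into a symmetric difference quotient of radius a j and exposes the next function
  \<open>G (Suc j)\<close>.\<close>

fun iterated_quotient :: "(nat \<Rightarrow> real) \<Rightarrow> (nat \<Rightarrow> real \<Rightarrow> real) \<Rightarrow> nat \<Rightarrow> nat \<Rightarrow> real \<Rightarrow> real" where
  "iterated_quotient a G j 0 = G j"
| "iterated_quotient a G j (Suc k) = (\<lambda>x. (iterated_quotient a G (Suc j) k (x + a j)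
      - iterated_quotient a G (Suc j) k (x - a j)) / (2 * a j))"

text \<open>Infinite convolution with boxes of radii a j, the classical construction of
  non-quasianalytic bumps. Summability of the radii gives convergence, since one average moves an
  L-Lipschitz function by at most L a j, and bounds how far values spread. Each derivative uses up
  one box and costs 1 / a j, starting from the bound 1 for the functions \<open>G j\<close>.\<close>

lemma smooth_average:
  fixes g :: "real \<Rightarrow> real" and a :: "nat \<Rightarrow> real"
  assumes a: "\<And>j. 0 < a j" "summable a"
    and L: "\<And>x y. \<bar>g x - g y\<bar> \<le> L * \<bar>x - y\<bar>"
    and g01: "\<And>x. 0 \<le> g x \<and> g x \<le> 1"
  obtains \<psi> D where "derivs_on UNIV \<psi> D"
    "\<And>k x. \<bar>D k x\<bar> \<le> 1 / (\<Prod>j<k. a j)"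
    "\<And>x. 0 \<le> \<psi> x \<and> \<psi> x \<le> 1"
    "\<And>x v. (\<And>y. \<bar>y - x\<bar> \<le> suminf a \<Longrightarrow> g y = v) \<Longrightarrow> \<psi> x = v"
proof -
  let ?T = "steklov_iter a g"
  have L0: "0 \<le> L" using L[of 1 0] by (smt (verit) mult_cancel_left2)
  have T_lip: "\<bar>?T k n x - ?T k n y\<bar> \<le> L * \<bar>x - y\<bar>" for k n x y
    by (induction n arbitrary: k x y) (auto intro!: L steklov_lipschitz a)
  have T_cont: "continuous_on UNIV (?T k n)" for k n by (rule lipschitz_continuous_on[OF T_lip])
  have T_01: "0 \<le> ?T k n x \<and> ?T k n x \<le> 1" for k n x
  proof (induction n arbitrary: k x)
    case (Suc n)
    have "steklov (a k) (\<lambda>_. 0) x \<le> ?T k (Suc n) x"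
      unfolding steklov_iter.simps by (rule steklov_mono[OF a(1) _ T_cont]) (use Suc in auto)
    moreover have "?T k (Suc n) x \<le> steklov (a k) (\<lambda>_. 1) x"
      unfolding steklov_iter.simps by (rule steklov_mono[OF a(1) T_cont]) (use Suc in auto)
    ultimately show ?case using a(1)[of k] steklov_const_on[of "a k" x "\<lambda>_. 0" 0] steklov_const_on[of "a k" x "\<lambda>_. 1" 1] by simp
  qed (use g01 in simp)
  \<comment> \<open>The additional average is the innermost one, of radius a (n + k); the outer
    averages do not enlarge a uniform distance.\<close>
  have T_step: "\<bar>?T k (Suc n) x - ?T k n x\<bar> \<le> L * a (n + k)" for k n x
  proof (induction n arbitrary: k x)
    case 0
    have "\<bar>steklov (a k) g x - steklov (a k) (\<lambda>_. g x) x\<bar> \<le> L * a k"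
    proof (rule steklov_dist[OF a(1) lipschitz_continuous_on[OF L]])
      show "\<bar>g y - g x\<bar> \<le> L * a k" if "\<bar>y - x\<bar> \<le> a k" for y
        using L[of y x] mult_left_mono[OF that L0] by linarith
    qed auto
    then show ?case using steklov_const_on[OF a(1)[of k], of x "\<lambda>_. g x" "g x"] by simp
  next
    case (Suc n)
    show ?case
      using Suc[of "Suc k"] by (auto intro!: steklov_dist[OF a(1)] T_cont simp del: steklov_iter.simps simp: steklov_iter.simps(2)[of _ _ k])
  qed
  have T_const: "?T k n x = v" if "\<And>y. \<bar>y - x\<bar> \<le> (\<Sum>j=k..<k+n. a j) \<Longrightarrow> g y = v" for k n x v
    using that
  proof (induction n arbitrary: k x)
    case (Suc n)
    have s: "(\<Sum>j=k..<k + Suc n. a j) = a k + (\<Sum>j=Suc k..<Suc k + n. a j)"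
      by (simp add: sum.atLeast_Suc_lessThan)
    have "?T (Suc k) n y = v" if y: "\<bar>y - x\<bar> \<le> a k" for y
    proof (rule Suc.IH)
      fix z assume "\<bar>z - y\<bar> \<le> (\<Sum>j=Suc k..<Suc k + n. a j)"
      then have "\<bar>z - x\<bar> \<le> (\<Sum>j=k..<k + Suc n. a j)" unfolding s using y by linarith
      then show "g z = v" by (rule Suc.prems)
    qed
    then show ?case by (simp add: steklov_const_on[OF a(1)])
  qed simp
  define G where "G k x = lim (\<lambda>n. ?T k n x)" for k x
  define R where "R k n = (\<Sum>i. L * a (i + n + k))" for k n
  have smL: "summable (\<lambda>i. L * a (i + m))" for m
    using a(2) by (intro summable_mult) (simp add: summable_iff_shift)
  have R_lim: "R k \<longlonglongrightarrow> 0" for k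
  proof -
    have "(\<lambda>n. \<Sum>i. L * a (i + n)) \<longlonglongrightarrow> 0"
      by (rule suminf_exist_split2) (use smL[of 0] in simp)
    then have "(\<lambda>n. \<Sum>i. L * a (i + (n + k))) \<longlonglongrightarrow> 0" by (rule LIMSEQ_ignore_initial_segment)
    then show ?thesis by (simp add: R_def[abs_def] add.assoc)
  qed
  have G_lim: "(\<lambda>n. ?T k n x) \<longlonglongrightarrow> G k x" and G_err: "\<bar>G k x - ?T k n x\<bar> \<le> R k n" for k n x
  proof -
    have sm: "summable (\<lambda>i. ?T k (Suc i + m) x - ?T k (i + m) x)" for m
      by (rule summable_comparison_test'[OF smL[of "m + k"], of 0])
         (use T_step[of k] in \<open>simp add: add.assoc[symmetric] del: steklov_iter.simps\<close>)
    have "(\<lambda>n. \<Sum>i<n. ?T k (Suc i) x - ?T k i x) \<longlonglongrightarrow> (\<Sum>i. ?T k (Suc i) x - ?T k i x)"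
      using sm[of 0] by (intro summable_LIMSEQ) simp
    then have "(\<lambda>n. ?T k n x - ?T k 0 x) \<longlonglongrightarrow> (\<Sum>i. ?T k (Suc i) x - ?T k i x)"
      by (simp only: sum_lessThan_telescope[of "\<lambda>i. ?T k i x"])
    from tendsto_add[OF this tendsto_const[of "?T k 0 x"]]
    have "convergent (\<lambda>n. ?T k n x)" by (auto simp: convergent_def)
    then show lim: "(\<lambda>n. ?T k n x) \<longlonglongrightarrow> G k x" by (simp add: G_def convergent_LIMSEQ_iff)
    have "(\<lambda>i. ?T k (Suc i + n) x - ?T k (i + n) x) sums (G k x - ?T k (0 + n) x)"
      by (rule telescope_sums[where f="\<lambda>i. ?T k (i + n) x"]) (rule LIMSEQ_ignore_initial_segment[OF lim])
    then have "\<bar>G k x - ?T k n x\<bar> = \<bar>\<Sum>i. ?T k (Suc i + n) x - ?T k (i + n) x\<bar>"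
      by (simp add: sums_iff)
    also have "\<dots> \<le> R k n"
    proof -
      have le: "\<bar>?T k (Suc i + n) x - ?T k (i + n) x\<bar> \<le> L * a (i + n + k)" for i
        using T_step[of k "i + n" x] by simp
      have smR: "summable (\<lambda>i. L * a (i + n + k))" using smL[of "n + k"] by (simp add: add.assoc)
      have sa: "summable (\<lambda>i. \<bar>?T k (Suc i + n) x - ?T k (i + n) x\<bar>)"
        by (rule summable_comparison_test'[OF smR, of 0]) (use le in auto)
      show ?thesis unfolding R_def
        using summable_rabs[OF sa] suminf_le[OF le sa smR] by linarith
    qed
    finally show "\<bar>G k x - ?T k n x\<bar> \<le> R k n" .
  qed
  have G_lip: "\<bar>G k x - G k y\<bar> \<le> L * \<bar>x - y\<bar>" for k x y
    by (rule LIMSEQ_le_const2[OF tendsto_rabs[OF tendsto_diff[OF G_lim G_lim]]]) (use T_lip in blast)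
  have G_cont: "continuous_on UNIV (G k)" for k by (rule lipschitz_continuous_on[OF G_lip])
  have G_01: "0 \<le> G k x \<and> G k x \<le> 1" for k x
    using LIMSEQ_le_const[OF G_lim] LIMSEQ_le_const2[OF G_lim] T_01 by blast
  \<comment> \<open>The error \<open>R (Suc k) n\<close> does not depend on the point, so averaging
    passes to the limit.\<close>
  have G_rec: "G k = steklov (a k) (G (Suc k))" for k
  proof
    fix x
    have "\<bar>steklov (a k) (G (Suc k)) x - ?T k (Suc n) x\<bar> \<le> R (Suc k) n" for n
      using G_err by (auto intro!: steklov_dist[OF a(1)] G_cont T_cont)
    then have "(\<lambda>n. steklov (a k) (G (Suc k)) x - ?T k (Suc n) x) \<longlonglongrightarrow> 0"
      by (intro Lim_null_comparison[OF _ R_lim[of "Suc k"]]) auto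
    moreover have "(\<lambda>n. steklov (a k) (G (Suc k)) x - ?T k (Suc n) x) \<longlonglongrightarrow> steklov (a k) (G (Suc k)) x - G k x"
      by (intro tendsto_diff tendsto_const LIMSEQ_Suc[OF G_lim])
    ultimately show "G k x = steklov (a k) (G (Suc k)) x" using LIMSEQ_unique by fastforce
  qed
  have G_der: "(G k has_real_derivative (G (Suc k) (x + a k) - G (Suc k) (x - a k)) / (2 * a k)) (at x)" for k x
    using steklov_DERIV[OF a(1) G_cont, of k "Suc k" x] by (simp add: G_rec[of k, symmetric])
  let ?Q = "iterated_quotient a G"
  have Q_der: "(?Q j k has_real_derivative ?Q j (Suc k) x) (at x)" for j k x
  proof (induction k arbitrary: j x)
    case 0 then show ?case using G_der by simp
  next
    case (Suc k)
    have "((\<lambda>y. ?Q (Suc j) k (y + a j)) has_real_derivative ?Q (Suc j) (Suc k) (x + a j)) (at x)"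
      using Suc[of "Suc j" "x + a j"] by (simp only: DERIV_shift)
    moreover have "((\<lambda>y. ?Q (Suc j) k (y - a j)) has_real_derivative ?Q (Suc j) (Suc k) (x - a j)) (at x)"
      using Suc[of "Suc j" "x - a j"] DERIV_shift[of "?Q (Suc j) k" _ x "- a j"] by simp
    ultimately show ?case
      unfolding iterated_quotient.simps(2)[of a G j] by (intro DERIV_cdivide DERIV_diff)
  qed
  have Q_bd: "\<bar>?Q j k x\<bar> \<le> 1 / (\<Prod>i<k. a (i + j))" for j k x
  proof (induction k arbitrary: j x)
    case 0 then show ?case using G_01[of j x] by simp
  next
    case (Suc k)
    have pr: "(\<Prod>i<Suc k. a (i + j)) = a j * (\<Prod>i<k. a (i + Suc j))"
      by (subst prod.lessThan_Suc_shift) simp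
    have "\<bar>?Q j (Suc k) x\<bar> = \<bar>?Q (Suc j) k (x + a j) - ?Q (Suc j) k (x - a j)\<bar> / (2 * a j)"
      using a(1)[of j] by simp
    also have "\<dots> \<le> (2 * (1 / (\<Prod>i<k. a (i + Suc j)))) / (2 * a j)"
      using Suc[of "Suc j" "x + a j"] Suc[of "Suc j" "x - a j"] a(1)[of j]
      by (intro divide_right_mono) linarith+
    also have "\<dots> = 1 / (\<Prod>i<Suc k. a (i + j))" unfolding pr using a(1)[of j] by simp
    finally show ?case .
  qed
  show thesis
  proof (rule that[of "G 0" "?Q 0"])
    show "derivs_on UNIV (G 0) (?Q 0)" by (rule derivs_onI) (use Q_der in auto)
    show "\<bar>?Q 0 k x\<bar> \<le> 1 / (\<Prod>j<k. a j)" for k x using Q_bd[of 0 k x] by simp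
    show "0 \<le> G 0 x \<and> G 0 x \<le> 1" for x by (rule G_01)
    show "G 0 x = v" if v: "\<And>y. \<bar>y - x\<bar> \<le> suminf a \<Longrightarrow> g y = v" for x v
    proof -
      have "?T 0 n x = v" for n
      proof (rule T_const)
        fix y assume "\<bar>y - x\<bar> \<le> (\<Sum>j=0..<0+n. a j)"
        also have "\<dots> \<le> suminf a"
          using sum_le_suminf[OF a(2), of "{0..<n}"] a(1) by (auto simp: less_imp_le)
        finally show "g y = v" by (rule v)
      qed
      then show ?thesis by (simp add: G_def)
    qed
  qed
qed

text \<open>The estimate is required for every \<rho> (Beurling type), whereas C^M asks for some
  \<rho> (Roumieu type). The surplus pays for the compression of time by the factors
  \<open>1 / \<tau> n\<close> when infinitely many loops are joined. The weights will be W k = k! M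
  k.\<close>

definition beurling :: "(nat \<Rightarrow> real) \<Rightarrow> real \<Rightarrow> (real \<Rightarrow> real) \<Rightarrow> (nat \<Rightarrow> real \<Rightarrow> real) \<Rightarrow> bool" where
  "beurling W R g D \<longleftrightarrow> derivs_on UNIV g D \<and> (\<forall>k x. R < \<bar>x\<bar> \<longrightarrow> D k x = 0) \<and>
     (\<forall>\<rho>>0. \<exists>C>0. \<forall>k x. \<bar>D k x\<bar> \<le> C * \<rho> ^ k * W k)"

lemma derivs_zero_on_open:
  assumes "derivs_on UNIV g D" "open S" "\<And>x. x \<in> S \<Longrightarrow> g x = 0" "x \<in> S"
  shows "D k x = 0"
proof -
  have "derivs_on S g (\<lambda>_ _. 0)" by (rule derivs_onI) (use assms(3) in auto)
  from derivs_on_unique[OF assms(2) derivs_on_mono[OF assms(1)] this assms(4)] show ?thesis by simp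
qed

text \<open>With q j = W j / W (j+1) one has W k = W 0 / (q 0 ... q (k-1)). Radii a j that are still
  summable but satisfy q j / a j \<rightarrow> 0 turn the bound 1 / (a 0 ... a (k-1)) into W k times
  a product that decays faster than every geometric sequence.\<close>

lemma beurling_bump:
  assumes W: "\<And>k. 0 < W k" and sm: "summable (\<lambda>k. W k / W (Suc k))"
  obtains \<psi> D where "beurling W 1 \<psi> D" "\<And>x. \<bar>x\<bar> \<le> 1/2 \<Longrightarrow> \<psi> x = 1"
    "\<And>x. 1 \<le> \<bar>x\<bar> \<Longrightarrow> \<psi> x = 0" "\<And>x. 0 \<le> \<psi> x \<and> \<psi> x \<le> 1"
proof -
  define q where "q k = W k / W (Suc k)" for k
  have q: "\<And>j. 0 < q j" "summable q" using W sm by (auto simp: q_def[abs_def])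
  obtain a0 where a0: "\<And>j. 0 < a0 j" "summable a0" "(\<lambda>j. q j / a0 j) \<longlonglongrightarrow> 0"
    using summable_dominating_sequence[OF q] by blast
  \<comment> \<open>Normalises the total radius to 1/8, the margin left by g below: g is 1 up to 5/8
    and 0 from 7/8 on, while the bump must be 1 up to 1/2 and 0 from 1 on.\<close>
  define \<theta> where "\<theta> = 1 / (8 * suminf a0)"
  have \<theta>: "0 < \<theta>" using suminf_pos[OF a0(2,1)] by (simp add: \<theta>_def)
  define a where "a j = \<theta> * a0 j" for j
  have a: "\<And>j. 0 < a j" "summable a" using a0 \<theta> by (auto simp: a_def[abs_def])
  have sa: "suminf a = 1/8"
    using suminf_mult[OF a0(2), of \<theta>] suminf_pos[OF a0(2,1)] by (simp add: a_def[abs_def] \<theta>_def)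
  have "(\<lambda>j. (q j / a0 j) / \<theta>) \<longlonglongrightarrow> 0 / \<theta>" by (intro tendsto_divide a0 tendsto_const) (use \<theta> in auto)
  then have lim: "(\<lambda>j. q j / a j) \<longlonglongrightarrow> 0" by (simp add: a_def mult.commute)
  define g where "g x = max 0 (min 1 (4 * (7/8 - \<bar>x\<bar>)))" for x :: real
  have g_lip: "\<bar>g x - g y\<bar> \<le> 4 * \<bar>x - y\<bar>" for x y unfolding g_def by (auto simp: max_def min_def abs_if)
  have g01: "0 \<le> g x \<and> g x \<le> 1" for x unfolding g_def by linarith
  obtain \<psi> D where \<psi>: "derivs_on UNIV \<psi> D" "\<And>k x. \<bar>D k x\<bar> \<le> 1 / (\<Prod>j<k. a j)"
    "\<And>x. 0 \<le> \<psi> x \<and> \<psi> x \<le> 1" "\<And>x v. (\<And>y. \<bar>y - x\<bar> \<le> suminf a \<Longrightarrow> g y = v) \<Longrightarrow> \<psi> x = v"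
    using smooth_average[OF a g_lip g01] by blast
  have zero: "\<psi> x = 0" if "1 \<le> \<bar>x\<bar>" for x
    by (rule \<psi>(4)) (use that sa in \<open>auto simp: g_def max_def min_def abs_if split: if_splits\<close>)
  have one: "\<psi> x = 1" if "\<bar>x\<bar> \<le> 1/2" for x
    by (rule \<psi>(4)) (use that sa in \<open>auto simp: g_def max_def min_def abs_if split: if_splits\<close>)
  have W_prod: "W k = W 0 / (\<Prod>j<k. q j)" for k
  proof (induction k)
    case (Suc k)
    have "(\<Prod>j<Suc k. q j) = (\<Prod>j<k. q j) * (W k / W (Suc k))" by (simp add: q_def)
    then have "W 0 / (\<Prod>j<Suc k. q j) = (W 0 / (\<Prod>j<k. q j)) * (W (Suc k) / W k)" by simp
    also have "\<dots> = W (Suc k)" unfolding Suc[symmetric] using W[of k] by simp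
    finally show ?case by simp
  qed simp
  have "beurling W 1 \<psi> D"
    unfolding beurling_def
  proof (intro conjI allI impI)
    show "D k x = 0" if "1 < \<bar>x\<bar>" for k x
    proof (rule derivs_zero_on_open[OF \<psi>(1)])
      show "open {x::real. 1 < \<bar>x\<bar>}" by (intro open_Collect_less continuous_intros)
    qed (use that zero in auto)
    fix \<rho> :: real assume "0 < \<rho>"
    then obtain C where C: "C > 0" "\<And>k. (\<Prod>j<k. q j / a j) \<le> C * \<rho> ^ k"
      using prod_le_geometric_of_tendsto_0[of "\<lambda>j. q j / a j" \<rho>] q(1) a(1) lim by fastforce
    have "\<bar>D k x\<bar> \<le> C / W 0 * \<rho> ^ k * W k" for k x
    proof -
      have p: "0 < (\<Prod>j<k. q j)" "0 < (\<Prod>j<k. a j)" using q a by (auto intro!: prod_pos)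
      have "\<bar>D k x\<bar> \<le> 1 / (\<Prod>j<k. a j)" by (rule \<psi>(2))
      also have "\<dots> = (\<Prod>j<k. q j / a j) * W k / W 0"
      proof -
        have "p / a * (w / p) / w = 1 / a" if "0 < p" "0 < w" for p a w :: real using that by simp
        from this[OF p(1) W[of 0]] show ?thesis unfolding W_prod[of k] prod_dividef by simp
      qed
      also have "\<dots> \<le> C * \<rho> ^ k * W k / W 0"
        using C(2)[of k] W[of k] W[of 0] by (intro divide_right_mono mult_right_mono) auto
      finally show ?thesis by simp
    qed
    then show "\<exists>C>0. \<forall>k x. \<bar>D k x\<bar> \<le> C * \<rho> ^ k * W k"
      using C(1) W[of 0] by (intro exI[of _ "C / W 0"]) auto
  qed (rule \<psi>(1))
  then show thesis using that zero one \<psi>(3) by blast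
qed

lemma beurling_scale:
  assumes "beurling W R g D" "0 < s" "\<And>k. 0 < W k"
  shows "beurling W (R * s) (\<lambda>x. g (x / s)) (\<lambda>k x. (1 / s) ^ k * D k (x / s))"
  unfolding beurling_def
proof (intro conjI allI impI)
  show "derivs_on UNIV (\<lambda>x. g (x / s)) (\<lambda>k x. (1 / s) ^ k * D k (x / s))"
    using derivs_on_affine[of UNIV g D UNIV 0 "1 / s"] assms by (simp add: beurling_def)
  show "(1 / s) ^ k * D k (x / s) = 0" if "R * s < \<bar>x\<bar>" for k x
    using assms that by (simp add: beurling_def field_simps)
  fix \<rho> :: real assume "0 < \<rho>"
  then obtain C where C: "C > 0" "\<And>k x. \<bar>D k x\<bar> \<le> C * (\<rho> * s) ^ k * W k"
    using assms unfolding beurling_def by (metis mult_pos_pos)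
  have "\<bar>(1 / s) ^ k * D k (x / s)\<bar> \<le> C * \<rho> ^ k * W k" for k x
    using C(2)[of k "x / s"] assms(2) by (simp add: abs_mult power_mult_distrib power_divide field_simps)
  then show "\<exists>C>0. \<forall>k x. \<bar>(1 / s) ^ k * D k (x / s)\<bar> \<le> C * \<rho> ^ k * W k" using C by blast
qed

text \<open>The k-th derivative of x g x is x D k + k D (k-1). The factor k is absorbed by 2^k, at
  the price of using the estimate for \<rho>/2, and Q compares the weights of neighbouring
  orders.\<close>

lemma beurling_times_ident:
  assumes b: "beurling W R g D" and R: "0 < R" and W: "\<And>k. 0 < W k" and Q: "\<And>k. W k \<le> Q * W (Suc k)"
  shows "\<exists>E. beurling W R (\<lambda>x. x * g x) E"
proof -
  define E where "E k x = x * D k x + real k * D (k - 1) x" for k x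
  have D: "derivs_on UNIV g D" and D0: "\<And>k x. R < \<bar>x\<bar> \<Longrightarrow> D k x = 0" using b by (auto simp: beurling_def)
  have Q0: "0 < Q" using Q[of 0] W[of 0] W[of 1] by (smt (verit) One_nat_def mult_nonpos_nonneg)
  have "beurling W R (\<lambda>x. x * g x) E"
    unfolding beurling_def
  proof (intro conjI allI impI)
    show "derivs_on UNIV (\<lambda>x. x * g x) E"
    proof (rule derivs_onI)
      show "(E k has_real_derivative E (Suc k) x) (at x)" for k x
        using derivs_onD(2)[OF D, of x k] derivs_onD(2)[OF D, of x "k - 1"]
        by (cases k) (auto simp: E_def[abs_def] algebra_simps intro!: derivative_eq_intros)
    qed (use derivs_onD(1)[OF D] in \<open>auto simp: E_def\<close>)
    show "E k x = 0" if "R < \<bar>x\<bar>" for k x using D0[OF that] by (simp add: E_def)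
    fix \<rho> :: real assume \<rho>: "0 < \<rho>"
    then obtain C where C: "C > 0" "\<And>k x. \<bar>D k x\<bar> \<le> C * (\<rho> / 2) ^ k * W k"
      using b unfolding beurling_def by (metis half_gt_zero)
    have pw: "real k \<le> 2 ^ k" for k using of_nat_less_two_power[of k, where 'a=real] by simp
    have "\<bar>E k x\<bar> \<le> (C * R + 2 * C * Q / \<rho>) * \<rho> ^ k * W k" for k x
    proof -
      have "\<bar>x * D k x\<bar> \<le> R * (C * (\<rho> / 2) ^ k * W k)"
      proof (cases "R < \<bar>x\<bar>")
        case True
        then show ?thesis using D0 R C W[of k] \<rho> by (simp add: less_imp_le)
      next
        case False
        then show ?thesis using C(2)[of k x] R by (auto simp: abs_mult intro!: mult_mono)
      qed
      also have "\<dots> \<le> R * (C * \<rho> ^ k * W k)"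
        using R C W[of k] \<rho> by (intro mult_left_mono mult_right_mono power_mono) auto
      finally have 1: "\<bar>x * D k x\<bar> \<le> R * (C * \<rho> ^ k * W k)" .
      have 2: "\<bar>real k * D (k - 1) x\<bar> \<le> 2 * C * Q / \<rho> * \<rho> ^ k * W k"
      proof (cases k)
        case 0
        then show ?thesis using C Q0 \<rho> W[of 0] by simp
      next
        case (Suc j)
        have "\<bar>real k * D (k - 1) x\<bar> = real k * \<bar>D j x\<bar>" by (simp add: Suc abs_mult)
        also have "\<dots> \<le> 2 ^ k * (C * (\<rho> / 2) ^ j * (Q * W k))"
          using pw[of k] C(2)[of j x] Q[of j] C(1) \<rho> less_imp_le[OF W]
          by (intro mult_mono order_trans[OF C(2)]) (auto simp: Suc intro!: mult_left_mono)
        also have "\<dots> = 2 * C * Q / \<rho> * \<rho> ^ k * W k"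
          using \<rho> by (simp add: Suc power_divide)
        finally show ?thesis .
      qed
      show ?thesis using 1 2 by (simp add: E_def algebra_simps)
    qed
    then show "\<exists>C>0. \<forall>k x. \<bar>E k x\<bar> \<le> C * \<rho> ^ k * W k"
      using C R Q0 \<rho> by (intro exI[of _ "C * R + 2 * C * Q / \<rho>"]) (auto intro!: add_pos_pos)
  qed
  then show ?thesis by blast
qed

lemma beurling_times_power:
  assumes "\<exists>D. beurling W R g D" "0 < R" "\<And>k. 0 < W k" "\<And>k. W k \<le> Q * W (Suc k)"
  shows "\<exists>E. beurling W R (\<lambda>x. x ^ n * g x) E"
proof (induction n)
  case (Suc n)
  then obtain E where "beurling W R (\<lambda>x. x ^ n * g x) E" by blast
  from beurling_times_ident[OF this assms(2-4)] show ?case by (simp add: mult.assoc)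
qed (use assms in simp)

text \<open>\<theta> is the difference of two unit translates of a smooth step, so sums over integer
  translates telescope to a difference of two values of the step, one in each of its constant
  parts.\<close>

lemma smooth_partition_function:
  obtains \<theta> D A where "derivs_on UNIV \<theta> D" "\<And>k x. 1 < \<bar>x\<bar> \<Longrightarrow> D k x = 0" "\<And>k x. \<bar>D k x\<bar> \<le> A k"
    "\<And>x K. \<bar>x\<bar> \<le> real K \<Longrightarrow> (\<Sum>m\<in>{-int K..int K}. \<theta> (x - of_int m)) = 1"
proof -
  \<comment> \<open>Total radius 1/4: the step g rises from 0 at 1/4 to 1 at 3/4, so its average is
    0 up to 0 and 1 from 1 on.\<close>
  define a where "a j = (1/2) ^ j / (8::real)" for j :: nat
  have a: "\<And>j. 0 < a j" "summable a" by (auto simp: a_def[abs_def])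
  have sa: "suminf a = 1/4"
    using suminf_divide[OF summable_geometric[of "1/2::real"], of 8] suminf_geometric[of "1/2::real"]
    by (simp add: a_def[abs_def])
  define g where "g x = max 0 (min 1 (2 * x - 1/2))" for x :: real
  have g_lip: "\<bar>g x - g y\<bar> \<le> 2 * \<bar>x - y\<bar>" for x y unfolding g_def by (auto simp: max_def min_def abs_if)
  have g01: "0 \<le> g x \<and> g x \<le> 1" for x unfolding g_def by linarith
  obtain \<psi> E where \<psi>: "derivs_on UNIV \<psi> E" "\<And>k x. \<bar>E k x\<bar> \<le> 1 / (\<Prod>j<k. a j)"
    "\<And>x. 0 \<le> \<psi> x \<and> \<psi> x \<le> 1" "\<And>x v. (\<And>y. \<bar>y - x\<bar> \<le> suminf a \<Longrightarrow> g y = v) \<Longrightarrow> \<psi> x = v"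
    using smooth_average[OF a g_lip g01] by blast
  have zero: "\<psi> x = 0" if "x \<le> 0" for x
    by (rule \<psi>(4)) (use that sa in \<open>auto simp: g_def max_def min_def abs_if split: if_splits\<close>)
  have one: "\<psi> x = 1" if "1 \<le> x" for x
    by (rule \<psi>(4)) (use that sa in \<open>auto simp: g_def max_def min_def abs_if split: if_splits\<close>)
  define \<theta> where "\<theta> x = \<psi> (1 + x) - \<psi> x" for x
  define D where "D k x = E k (1 + x) - E k x" for k x
  have D: "derivs_on UNIV \<theta> D"
    using derivs_on_diff[OF derivs_on_affine[OF \<psi>(1), of UNIV 1 1] \<psi>(1)]
    by (simp add: \<theta>_def[abs_def] D_def[abs_def])
  have tel: "(\<Sum>m\<in>{-int K..int K}. \<theta> (x - of_int m)) = \<psi> (1 + x + real K) - \<psi> (x - real K)" for x K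
  proof (induction K)
    case (Suc K)
    have "{-int (Suc K)..int (Suc K)} = insert (- int (Suc K)) (insert (int (Suc K)) {-int K..int K})" by auto
    then show ?case using Suc by (simp add: \<theta>_def algebra_simps)
  qed (simp add: \<theta>_def)
  show thesis
  proof (rule that[OF D])
    show "D k x = 0" if "1 < \<bar>x\<bar>" for k x
    proof (rule derivs_zero_on_open[OF D])
      show "open {x::real. 1 < \<bar>x\<bar>}" by (intro open_Collect_less continuous_intros)
      show "\<theta> y = 0" if "y \<in> {x. 1 < \<bar>x\<bar>}" for y
        using that one[of y] one[of "1 + y"] zero[of y] zero[of "1 + y"] by (cases "0 \<le> y") (auto simp: \<theta>_def)
    qed (use that in simp)
    show "\<bar>D k x\<bar> \<le> 2 / (\<Prod>j<k. a j)" for k x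
      using \<psi>(2)[of k x] \<psi>(2)[of k "1 + x"] unfolding D_def by simp
    show "(\<Sum>m\<in>{-int K..int K}. \<theta> (x - of_int m)) = 1" if "\<bar>x\<bar> \<le> real K" for x K
      unfolding tel using one[of "1 + x + real K"] zero[of "x - real K"] that by simp
  qed
qed

section \<open>Curves visiting a sequence of cusps\<close>

lemma curve_derivs_series:
  fixes \<gamma> :: "nat \<Rightarrow> nat \<Rightarrow> real \<Rightarrow> 'a::euclidean_space"
  assumes d: "\<And>n k t. (\<gamma> n k has_vector_derivative \<gamma> n (Suc k) t) (at t)"
    and b: "\<And>n k t. norm (\<gamma> n k t) \<le> (1/2) ^ n * W k"
  shows "curve_derivs (\<lambda>t. x + (\<Sum>n. \<gamma> n 0 t)) (\<lambda>k t. (if k = 0 then x else 0) + (\<Sum>n. \<gamma> n k t))"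
    and "norm (\<Sum>n. \<gamma> n k t) \<le> 2 * W k"
proof -
  have sW: "summable (\<lambda>n. (1/2) ^ n * W k)" for k by (intro summable_mult2) simp
  have sm: "summable (\<lambda>n. \<gamma> n k t)" for k t
    by (rule summable_comparison_test'[OF sW[of k], of 0]) (use b in auto)
  have UL: "uniform_limit UNIV (\<lambda>n t. \<Sum>i<n. \<gamma> i k t) (\<lambda>t. \<Sum>i. \<gamma> i k t) sequentially" for k
    by (rule Weierstrass_m_test[OF _ sW[of k]]) (use b in auto)
  have der: "((\<lambda>t. \<Sum>n. \<gamma> n k t) has_vector_derivative (\<Sum>n. \<gamma> n (Suc k) t)) (at t)" for k t
  proof -
    have "\<exists>g. \<forall>t\<in>UNIV. (\<lambda>n. \<gamma> n k t) sums (g t) \<and>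
        (g has_derivative (\<lambda>h. h *\<^sub>R (\<Sum>n. \<gamma> n (Suc k) t))) (at t within UNIV)"
    proof (rule has_derivative_series)
      show "(\<gamma> n k has_derivative (\<lambda>h. h *\<^sub>R \<gamma> n (Suc k) t)) (at t)" for n t
        using d by (simp add: has_vector_derivative_def)
      show "(\<lambda>n. \<gamma> n k 0) sums (\<Sum>n. \<gamma> n k 0)" using sm by (rule summable_sums)
      fix e :: real assume "e > 0"
      with UL[of "Suc k"] have "\<forall>\<^sub>F n in sequentially. \<forall>t\<in>UNIV. dist (\<Sum>i<n. \<gamma> i (Suc k) t) (\<Sum>i. \<gamma> i (Suc k) t) < e"
        by (rule uniform_limitD)
      then show "\<forall>\<^sub>F n in sequentially. \<forall>t\<in>UNIV. \<forall>h.
          norm ((\<Sum>i<n. h *\<^sub>R \<gamma> i (Suc k) t) - h *\<^sub>R (\<Sum>n. \<gamma> n (Suc k) t)) \<le> e * norm h"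
      proof (rule eventually_mono, intro ballI allI)
        fix n t h
        assume *: "\<forall>t\<in>UNIV. dist (\<Sum>i<n. \<gamma> i (Suc k) t) (\<Sum>i. \<gamma> i (Suc k) t) < e"
        have "(\<Sum>i<n. h *\<^sub>R \<gamma> i (Suc k) t) - h *\<^sub>R (\<Sum>n. \<gamma> n (Suc k) t)
            = h *\<^sub>R ((\<Sum>i<n. \<gamma> i (Suc k) t) - (\<Sum>n. \<gamma> n (Suc k) t))"
          by (simp add: scaleR_sum_right scaleR_diff_right)
        moreover have "norm ((\<Sum>i<n. \<gamma> i (Suc k) t) - (\<Sum>n. \<gamma> n (Suc k) t)) \<le> e"
          using * by (simp add: dist_norm less_imp_le)
        ultimately show "norm ((\<Sum>i<n. h *\<^sub>R \<gamma> i (Suc k) t) - h *\<^sub>R (\<Sum>n. \<gamma> n (Suc k) t)) \<le> e * norm h"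
          by (simp add: mult.commute[of e] mult_left_mono)
      qed
    qed auto
    then obtain g where g: "\<And>t. (\<lambda>n. \<gamma> n k t) sums (g t)"
      "\<And>t. (g has_derivative (\<lambda>h. h *\<^sub>R (\<Sum>n. \<gamma> n (Suc k) t))) (at t)" by auto
    have "g = (\<lambda>t. \<Sum>n. \<gamma> n k t)" using g(1) by (auto simp: sums_iff)
    then show ?thesis using g(2)[of t] by (simp add: has_vector_derivative_def)
  qed
  show "curve_derivs (\<lambda>t. x + (\<Sum>n. \<gamma> n 0 t)) (\<lambda>k t. (if k = 0 then x else 0) + (\<Sum>n. \<gamma> n k t))"
    unfolding curve_derivs_def using der by (auto intro!: derivative_eq_intros)
  have "norm (\<Sum>n. \<gamma> n k t) \<le> (\<Sum>n. (1/2) ^ n * W k)"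
  proof -
    have sn: "summable (\<lambda>n. norm (\<gamma> n k t))"
      by (rule summable_comparison_test'[OF sW[of k], of 0]) (use b in auto)
    show ?thesis using summable_norm[OF sn] suminf_le[OF b sn sW] by linarith
  qed
  also have "\<dots> = 2 * W k"
    using suminf_mult2[OF summable_geometric[of "1/2::real"], of "W k"] suminf_geometric[of "1/2::real"] by simp
  finally show "norm (\<Sum>n. \<gamma> n k t) \<le> 2 * W k" .
qed

text \<open>The loop \<open>u \<mapsto> x + \<sigma>\<^sup>2 a(u) e + b(u) (y - x) + \<sigma>\<^sup>q d(u) w\<close> climbs from \<open>x\<close> along \<open>e\<close>, shifts to the
  line above \<open>y\<close>, descends to \<open>y\<close> and runs through \<open>y + s\<^sup>2 e + s\<^sup>q w\<close> with \<open>s = \<sigma> u\<close>.\<close>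

definition loop :: "(real \<Rightarrow> real) \<Rightarrow> nat \<Rightarrow> 'a::real_vector \<Rightarrow> 'a \<Rightarrow> real \<Rightarrow> 'a \<Rightarrow> 'a \<Rightarrow> real \<Rightarrow> 'a" where
  "loop \<psi> q e x \<sigma> y w u = (\<sigma>\<^sup>2 * (u\<^sup>2 * \<psi> (u / 4))) *\<^sub>R e + \<psi> (u / 2) *\<^sub>R (y - x)
     + (\<sigma> ^ q * (u ^ q * \<psi> (u / 2))) *\<^sub>R w"

text \<open>Each stretch of the loop lies in a ball provided by \<open>P\<close>: over y for |u|
  \<le> 1, over x for 1 < |u| < 4. In the transition 1 < |u| \<le> 2 the shift y - x takes one half
  of the radius c |\<sigma> u|^q and w the other half.\<close>

lemma loop_in_set:
  fixes X :: "'a::euclidean_space set"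
  assumes P: "\<And>y u. y \<in> X \<Longrightarrow> norm (y - x) < \<epsilon> \<Longrightarrow> u \<noteq> 0 \<Longrightarrow> \<bar>u\<bar> < h \<Longrightarrow>
      ball (y + u\<^sup>2 *\<^sub>R e) (c * \<bar>u\<bar> ^ q) \<subseteq> X"
    and \<psi>: "\<And>x. \<bar>x\<bar> \<le> 1/2 \<Longrightarrow> \<psi> x = 1" "\<And>x. 1 \<le> \<bar>x\<bar> \<Longrightarrow> \<psi> x = 0" "\<And>x. 0 \<le> \<psi> x \<and> \<psi> x \<le> 1"
    and x: "x \<in> X" and pos: "0 < c" "0 < \<epsilon>" "0 < q"
    and y: "y \<in> X" "norm (y - x) < \<epsilon>" "norm (y - x) < c / 2 * \<sigma> ^ q"
    and w: "norm w \<le> c / 2" and \<sigma>: "0 < \<sigma>" "4 * \<sigma> < h"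
  shows "x + loop \<psi> q e x \<sigma> y w u \<in> X"
    and "\<bar>u\<bar> < 1 \<Longrightarrow> x + loop \<psi> q e x \<sigma> y w u = y + (\<sigma> * u)\<^sup>2 *\<^sub>R e + (\<sigma> * u) ^ q *\<^sub>R w"
    and "4 \<le> \<bar>u\<bar> \<Longrightarrow> loop \<psi> q e x \<sigma> y w u = 0"
proof -
  have eq1: "x + loop \<psi> q e x \<sigma> y w u = y + (\<sigma> * u)\<^sup>2 *\<^sub>R e + (\<sigma> * u) ^ q *\<^sub>R w" if "\<bar>u\<bar> \<le> 1" for u
    using that by (simp add: loop_def \<psi> power_mult_distrib)
  then show "\<bar>u\<bar> < 1 \<Longrightarrow> x + loop \<psi> q e x \<sigma> y w u = y + (\<sigma> * u)\<^sup>2 *\<^sub>R e + (\<sigma> * u) ^ q *\<^sub>R w" by simp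
  show eq4: "4 \<le> \<bar>u\<bar> \<Longrightarrow> loop \<psi> q e x \<sigma> y w u = 0" by (simp add: loop_def \<psi>)
  have x0: "norm (x - x) < \<epsilon>" using pos by simp
  consider "u = 0" | "u \<noteq> 0" "\<bar>u\<bar> \<le> 1" | "1 < \<bar>u\<bar>" "\<bar>u\<bar> \<le> 2" | "2 < \<bar>u\<bar>" "\<bar>u\<bar> < 4" | "4 \<le> \<bar>u\<bar>" by linarith
  then show "x + loop \<psi> q e x \<sigma> y w u \<in> X"
  proof cases
    case 1
    then show ?thesis using eq1[of u] y pos by (simp add: power_0_left)
  next
    case 2
    have su: "\<sigma> * \<bar>u\<bar> < h" using 2 \<sigma> mult_left_mono[of "\<bar>u\<bar>" 1 \<sigma>] by linarith
    have "\<bar>\<sigma> * u\<bar> ^ q * norm w \<le> \<bar>\<sigma> * u\<bar> ^ q * (c / 2)" by (intro mult_left_mono w) auto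
    also have "\<dots> < c * \<bar>\<sigma> * u\<bar> ^ q" using 2 \<sigma> pos by simp
    finally have "x + loop \<psi> q e x \<sigma> y w u \<in> ball (y + (\<sigma> * u)\<^sup>2 *\<^sub>R e) (c * \<bar>\<sigma> * u\<bar> ^ q)"
      unfolding eq1[OF 2(2)] by (simp add: dist_norm power_abs)
    then show ?thesis using P[OF y(1,2), of "\<sigma> * u"] 2 \<sigma> su by (auto simp: abs_mult)
  next
    case 3
    define z where "z = \<psi> (u / 2) *\<^sub>R (y - x) + (\<sigma> ^ q * (u ^ q * \<psi> (u / 2))) *\<^sub>R w"
    have eq: "x + loop \<psi> q e x \<sigma> y w u = x + (\<sigma> * u)\<^sup>2 *\<^sub>R e + z"
      using 3 by (simp add: loop_def z_def \<psi> power_mult_distrib)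
    have su: "\<sigma> * \<bar>u\<bar> < h" using 3 \<sigma> mult_left_mono[of "\<bar>u\<bar>" 2 \<sigma>] by linarith
    have "norm z \<le> \<psi> (u / 2) * norm (y - x) + (\<sigma> ^ q * (\<bar>u\<bar> ^ q * \<psi> (u / 2))) * norm w"
      unfolding z_def using \<psi>(3)[of "u / 2"] \<sigma>
      by (intro order_trans[OF norm_triangle_ineq]) (simp add: abs_mult power_abs)
    also have "\<dots> \<le> norm (y - x) + (\<sigma> ^ q * \<bar>u\<bar> ^ q) * norm w"
      using \<psi>(3)[of "u / 2"] \<sigma> by (intro add_mono mult_right_mono mult_left_le_one_le mult_left_mono mult_right_le_one_le) auto
    also have "\<dots> \<le> norm (y - x) + (\<sigma> ^ q * \<bar>u\<bar> ^ q) * (c / 2)"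
      using w \<sigma> by (intro add_left_mono mult_left_mono) auto
    also have "\<dots> < c / 2 * (\<sigma> ^ q * \<bar>u\<bar> ^ q) + (\<sigma> ^ q * \<bar>u\<bar> ^ q) * (c / 2)"
    proof -
      have "c / 2 * \<sigma> ^ q * 1 \<le> c / 2 * \<sigma> ^ q * \<bar>u\<bar> ^ q"
        using 3 pos \<sigma> by (intro mult_left_mono one_le_power) auto
      then show ?thesis using y(3) unfolding mult.assoc by linarith
    qed
    finally have "norm z < c * \<bar>\<sigma> * u\<bar> ^ q" using \<sigma> by (simp add: abs_mult power_mult_distrib)
    then have "x + loop \<psi> q e x \<sigma> y w u \<in> ball (x + (\<sigma> * u)\<^sup>2 *\<^sub>R e) (c * \<bar>\<sigma> * u\<bar> ^ q)"
      unfolding eq by (simp add: dist_norm)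
    moreover have "ball (x + (\<sigma> * u)\<^sup>2 *\<^sub>R e) (c * \<bar>\<sigma> * u\<bar> ^ q) \<subseteq> X"
      by (rule P[OF x x0]) (use 3 \<sigma> su in \<open>auto simp: abs_mult\<close>)
    ultimately show ?thesis by blast
  next
    case 4
    \<comment> \<open>Only a multiple of e is left on this stretch; writing it as
      \<open>v\<^sup>2\<close> makes \<open>P\<close> applicable with v in place of u.\<close>
    define v where "v = \<sigma> * u * sqrt (\<psi> (u / 4))"
    have eq: "x + loop \<psi> q e x \<sigma> y w u = x + v\<^sup>2 *\<^sub>R e"
      using 4 \<psi>(3)[of "u / 4"] by (simp add: loop_def v_def \<psi>(2) power_mult_distrib algebra_simps)
    show ?thesis
    proof (cases "v = 0")
      case True
      then show ?thesis using eq x by simp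
    next
      case False
      have "\<bar>v\<bar> \<le> \<sigma> * \<bar>u\<bar> * 1"
        unfolding v_def using \<psi>(3)[of "u / 4"] \<sigma> by (auto simp: abs_mult mult.assoc intro!: mult_left_mono mult_left_le)
      also have "\<dots> < h" using 4 \<sigma> mult_left_mono[of "\<bar>u\<bar>" 4 \<sigma>] by linarith
      finally have "ball (x + v\<^sup>2 *\<^sub>R e) (c * \<bar>v\<bar> ^ q) \<subseteq> X" using P[OF x x0] False by blast
      moreover have "x + v\<^sup>2 *\<^sub>R e \<in> ball (x + v\<^sup>2 *\<^sub>R e) (c * \<bar>v\<bar> ^ q)" using False pos by simp
      ultimately show ?thesis unfolding eq by blast
    qed
  next
    case 5
    then show ?thesis using eq4 x by simp
  qed
qed

lemma dyadic_intervals_disjoint: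
  fixes t :: real
  assumes "\<bar>t - (1/2) ^ n\<bar> < (1/2) ^ n / 4" "\<bar>t - (1/2) ^ m\<bar> < (1/2) ^ m / 4"
  shows "n = m"
proof -
  have False if "n < m" "\<bar>t - (1/2) ^ n\<bar> < (1/2) ^ n / 4" "\<bar>t - (1/2) ^ m\<bar> < (1/2) ^ m / 4" for n m :: nat
  proof -
    have "(1/2::real) ^ m \<le> (1/2) ^ Suc n" using that by (intro power_decreasing) auto
    moreover have "(0::real) < (1/2) ^ n" by simp
    ultimately show False using that(2,3) unfolding abs_less_iff by simp
  qed
  from this[of n m] this[of m n] assms show ?thesis by (metis linorder_neqE_nat)
qed

text \<open>If the bound failed, points \<open>y\<^sub>n \<rightarrow> x\<close> violating it ever more strongly could be visited by one curve:
  loops around them, run through in the dyadic intervals around \<open>2\<^sup>-\<^sup>n\<close>. The derivatives of \<open>\<psi>\<close> beat every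
  factor \<open>\<rho>\<^sup>k\<close>, so the size \<open>\<sigma>\<^sub>n\<close> of the loops can be chosen in advance, depending on \<open>M\<close> only.\<close>

lemma bounded_derivatives_along_cusps:
  fixes X :: "'a::euclidean_space set" and f :: "'a \<Rightarrow> real"
  assumes f: "f \<in> AinfM M X" and M: "\<And>k. 0 < M k" and nq: "non_quasianalytic M"
    and x: "x \<in> X" and pos: "0 < c" "0 < h" "0 < \<epsilon>" "0 < q"
    and P: "\<And>y u. y \<in> X \<Longrightarrow> norm (y - x) < \<epsilon> \<Longrightarrow> u \<noteq> 0 \<Longrightarrow> \<bar>u\<bar> < h \<Longrightarrow>
      ball (y + u\<^sup>2 *\<^sub>R e) (c * \<bar>u\<bar> ^ q) \<subseteq> X"
  shows "\<exists>B r. 0 < r \<and> (\<forall>y w. y \<in> X \<longrightarrow> norm (y - x) < r \<longrightarrow> norm w \<le> c / 2 \<longrightarrow>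
    (\<exists>D. derivs_on {-r<..<r} (\<lambda>u. f (y + u\<^sup>2 *\<^sub>R e + u ^ q *\<^sub>R w)) D \<and> (\<forall>u. \<bar>u\<bar> < r \<longrightarrow> \<bar>D N u\<bar> \<le> B)))"
    (is "\<exists>B r. ?good B r")
proof (rule ccontr)
  assume not_good: "\<not> (\<exists>B r. ?good B r)"
  define W where "W k = fact k * M k" for k
  have W: "0 < W k" for k using M by (simp add: W_def)
  have Weq: "(\<lambda>k. W k / W (Suc k)) = (\<lambda>k. M k / ((real k + 1) * M (Suc k)))"
    by (auto simp: W_def add.commute)
  have smW: "summable (\<lambda>k. W k / W (Suc k))" unfolding Weq using nq by (simp add: non_quasianalytic_def)
  obtain Q where Q: "\<And>k. W k \<le> Q * W (Suc k)"
  proof -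
    have "Bseq (\<lambda>k. W k / W (Suc k))" by (rule convergent_imp_Bseq[OF convergentI[OF summable_LIMSEQ_zero[OF smW]]])
    then obtain Q where "\<And>k. norm (W k / W (Suc k)) \<le> Q" by (auto simp: Bseq_def)
    then have "\<And>k. W k \<le> Q * W (Suc k)" using W by (simp add: abs_of_pos pos_divide_le_eq)
    then show thesis by (rule that)
  qed
  obtain \<psi> D\<psi> where \<psi>: "beurling W 1 \<psi> D\<psi>" "\<And>x. \<bar>x\<bar> \<le> 1/2 \<Longrightarrow> \<psi> x = 1"
    "\<And>x. 1 \<le> \<bar>x\<bar> \<Longrightarrow> \<psi> x = 0" "\<And>x. 0 \<le> \<psi> x \<and> \<psi> x \<le> 1"
    using beurling_bump[OF W smW] by blast
  have b4: "\<exists>D. beurling W (1 * 4) (\<lambda>u. \<psi> (u / 4)) D" and b2: "\<exists>D. beurling W (1 * 2) (\<lambda>u. \<psi> (u / 2)) D"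
    using beurling_scale[OF \<psi>(1) _ W, of 4] beurling_scale[OF \<psi>(1) _ W, of 2] by auto
  obtain A where A: "beurling W 4 (\<lambda>u. u\<^sup>2 * \<psi> (u / 4)) A" using beurling_times_power[OF b4 _ W Q, of 2] by auto
  obtain B where B: "beurling W 2 (\<lambda>u. \<psi> (u / 2)) B" using b2 by auto
  obtain E where E: "beurling W 2 (\<lambda>u. u ^ q * \<psi> (u / 2)) E" using beurling_times_power[OF b2 _ W Q, of q] by auto
  \<comment> \<open>A loop occupies |u| < 4, that is, a time interval of radius 4 \<tau> n = 2^-n /
    4 around 2^-n; these intervals are disjoint by \<open>dyadic_intervals_disjoint\<close>.\<close>
  define \<tau> where "\<tau> n = (1/2::real) ^ n / 16" for n
  have \<tau>: "0 < \<tau> n" for n by (simp add: \<tau>_def)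
  have "\<exists>C>0. \<forall>k u. \<bar>A k u\<bar> \<le> C * \<tau> n ^ k * W k \<and> \<bar>B k u\<bar> \<le> C * \<tau> n ^ k * W k \<and> \<bar>E k u\<bar> \<le> C * \<tau> n ^ k * W k" for n
  proof -
    obtain C1 where C1: "C1 > 0" "\<And>k u. \<bar>A k u\<bar> \<le> C1 * \<tau> n ^ k * W k"
      using A \<tau>[of n] unfolding beurling_def by blast
    obtain C2 where C2: "C2 > 0" "\<And>k u. \<bar>B k u\<bar> \<le> C2 * \<tau> n ^ k * W k"
      using B \<tau>[of n] unfolding beurling_def by blast
    obtain C3 where C3: "C3 > 0" "\<And>k u. \<bar>E k u\<bar> \<le> C3 * \<tau> n ^ k * W k"
      using E \<tau>[of n] unfolding beurling_def by blast
    have le: "C' * \<tau> n ^ k * W k \<le> (C1 + C2 + C3) * \<tau> n ^ k * W k" if "C' \<le> C1 + C2 + C3" for C' k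
      using that \<tau>[of n] W[of k] by (intro mult_right_mono) auto
    have "\<bar>A k u\<bar> \<le> (C1 + C2 + C3) * \<tau> n ^ k * W k" "\<bar>B k u\<bar> \<le> (C1 + C2 + C3) * \<tau> n ^ k * W k"
      "\<bar>E k u\<bar> \<le> (C1 + C2 + C3) * \<tau> n ^ k * W k" for k u
      using order_trans[OF C1(2) le] order_trans[OF C2(2) le] order_trans[OF C3(2) le] C1(1) C2(1) C3(1)
      by simp_all
    moreover have "0 < C1 + C2 + C3" using C1(1) C2(1) C3(1) by simp
    ultimately show ?thesis by blast
  qed
  then obtain C where C: "\<And>n. 0 < C n" "\<And>n k u. \<bar>A k u\<bar> \<le> C n * \<tau> n ^ k * W k"
    "\<And>n k u. \<bar>B k u\<bar> \<le> C n * \<tau> n ^ k * W k" "\<And>n k u. \<bar>E k u\<bar> \<le> C n * \<tau> n ^ k * W k" by metis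
  define S where "S = norm e + 1 + c"
  have S: "0 < S" using pos norm_ge_zero[of e] unfolding S_def by linarith
  \<comment> \<open>Fixed before the points y n are chosen: C n S \<sigma> n bounds the three
    summands of the n-th loop together, in units of \<open>\<tau> n ^ k * W k\<close>, and has to be
    summable in n.\<close>
  define \<sigma> where "\<sigma> n = min (min 1 (h / 8)) ((1/2) ^ n / (C n * S))" for n
  have \<sigma>: "0 < \<sigma> n" "4 * \<sigma> n < h" "\<sigma> n \<le> 1" "C n * S * \<sigma> n \<le> (1/2) ^ n" for n
  proof -
    show "0 < \<sigma> n" using pos C(1)[of n] S by (simp add: \<sigma>_def)
    have "\<sigma> n \<le> h / 8" unfolding \<sigma>_def by linarith
    then show "4 * \<sigma> n < h" using pos by linarith
    show "\<sigma> n \<le> 1" by (simp add: \<sigma>_def)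
    have "\<sigma> n \<le> (1/2) ^ n / (C n * S)" by (simp add: \<sigma>_def)
    then show "C n * S * \<sigma> n \<le> (1/2) ^ n" using C(1)[of n] S by (simp add: field_simps)
  qed
  \<comment> \<open>The three bounds serve the cusp condition at y n, the window |u| < \<sigma> n in
    which the loop agrees with the arc, and the shift from x to y n.\<close>
  define r where "r n = min \<epsilon> (min (\<sigma> n) (c / 2 * \<sigma> n ^ q))" for n
  have r: "0 < r n" "r n \<le> \<epsilon>" "r n \<le> \<sigma> n" "r n \<le> c / 2 * \<sigma> n ^ q" for n
    using pos \<sigma>(1)[of n] by (auto simp: r_def)
  let ?\<phi> = "\<lambda>y w u. f (y + u\<^sup>2 *\<^sub>R e + u ^ q *\<^sub>R w)"
  \<comment> \<open>\<open>(\<tau> n / \<sigma> n) ^ N\<close> is the chain rule factor between the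
    parameter u of the arc and the time of the curve, so a violation forces the N-th derivative of f
    \<circ> cv above n.\<close>
  define viol where "viol n y w \<longleftrightarrow> (\<forall>D. derivs_on {-r n<..<r n} (?\<phi> y w) D \<longrightarrow>
      (\<exists>u. \<bar>u\<bar> < r n \<and> real n * (\<tau> n / \<sigma> n) ^ N < \<bar>D N u\<bar>))" for n y w
  have "\<exists>y w. y \<in> X \<and> norm (y - x) < r n \<and> norm w \<le> c / 2 \<and> viol n y w" for n
  proof (rule ccontr)
    assume contra: "\<not> ?thesis"
    have "?good (real n * (\<tau> n / \<sigma> n) ^ N) (r n)"
    proof (intro conjI allI impI r(1))
      fix y w :: 'a assume "y \<in> X" "norm (y - x) < r n" "norm w \<le> c / 2"
      with contra have "\<not> viol n y w" by blast
      then obtain D where "derivs_on {-r n<..<r n} (?\<phi> y w) D"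
        and D: "\<not> (\<exists>u. \<bar>u\<bar> < r n \<and> real n * (\<tau> n / \<sigma> n) ^ N < \<bar>D N u\<bar>)" unfolding viol_def by blast
      moreover have "\<bar>D N u\<bar> \<le> real n * (\<tau> n / \<sigma> n) ^ N" if "\<bar>u\<bar> < r n" for u
        using D that by (intro leI) blast
      ultimately show "\<exists>D. derivs_on {-r n<..<r n} (?\<phi> y w) D \<and> (\<forall>u. \<bar>u\<bar> < r n \<longrightarrow> \<bar>D N u\<bar> \<le> real n * (\<tau> n / \<sigma> n) ^ N)"
        by blast
    qed
    then show False using not_good by blast
  qed
  then obtain y w where y: "\<And>n. y n \<in> X" "\<And>n. norm (y n - x) < r n" and w: "\<And>n. norm (w n) \<le> c / 2"
    and viol: "\<And>n. viol n (y n) (w n)" by metis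
  define T where "T n t = (t - (1/2) ^ n) / \<tau> n" for n t
  define \<gamma> where "\<gamma> n k t = (1 / \<tau> n) ^ k *\<^sub>R ((\<sigma> n)\<^sup>2 *\<^sub>R A k (T n t) *\<^sub>R e + B k (T n t) *\<^sub>R (y n - x)
      + \<sigma> n ^ q *\<^sub>R E k (T n t) *\<^sub>R w n)" for n k t
  have \<gamma>0: "\<gamma> n 0 t = loop \<psi> q e x (\<sigma> n) (y n) (w n) (T n t)" for n t
    using A B E by (simp add: \<gamma>_def loop_def beurling_def derivs_on_def)
  have \<gamma>_der: "(\<gamma> n k has_vector_derivative \<gamma> n (Suc k) t) (at t)" for n k t
  proof -
    have *: "((\<lambda>t. F k (T n t)) has_vector_derivative (1 / \<tau> n) * F (Suc k) (T n t)) (at t)"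
      if "derivs_on UNIV g F" for g F
    proof -
      have "(T n has_real_derivative 1 / \<tau> n) (at t)"
        unfolding T_def[abs_def] using \<tau>[of n] by (auto intro!: derivative_eq_intros)
      then have "((\<lambda>t. F k (T n t)) has_real_derivative F (Suc k) (T n t) * (1 / \<tau> n)) (at t)"
        by (intro DERIV_chain2[where f="F k"] derivs_onD(2)[OF that]) auto
      then show ?thesis by (simp add: has_real_derivative_iff_has_vector_derivative mult.commute)
    qed
    have d: "derivs_on UNIV (\<lambda>u. u\<^sup>2 * \<psi> (u / 4)) A" "derivs_on UNIV (\<lambda>u. \<psi> (u / 2)) B" "derivs_on UNIV (\<lambda>u. u ^ q * \<psi> (u / 2)) E"
      using A B E by (auto simp: beurling_def)
    have v: "((\<lambda>t. F k (T n t) *\<^sub>R z) has_vector_derivative ((1 / \<tau> n) * F (Suc k) (T n t)) *\<^sub>R z) (at t)"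
      if "derivs_on UNIV g F" for g F and z :: 'a
      using has_vector_derivative_scaleR[OF *[OF that, unfolded has_real_derivative_iff_has_vector_derivative[symmetric]] has_vector_derivative_const[of z]]
      by simp
    have "(\<gamma> n k has_vector_derivative (1 / \<tau> n) ^ k *\<^sub>R ((\<sigma> n)\<^sup>2 *\<^sub>R ((1 / \<tau> n) * A (Suc k) (T n t)) *\<^sub>R e
        + ((1 / \<tau> n) * B (Suc k) (T n t)) *\<^sub>R (y n - x) + \<sigma> n ^ q *\<^sub>R ((1 / \<tau> n) * E (Suc k) (T n t)) *\<^sub>R w n)) (at t)"
      unfolding \<gamma>_def[abs_def]
      by (intro has_vector_derivative_add bounded_linear.has_vector_derivative[OF bounded_linear_scaleR_right] v[OF d(1)] v[OF d(2)] v[OF d(3)])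
    then show ?thesis by (simp add: \<gamma>_def scaleR_add_right mult.commute mult.left_commute)
  qed
  have \<gamma>_bd: "norm (\<gamma> n k t) \<le> (1/2) ^ n * W k" for n k t
  proof -
    let ?K = "C n * \<tau> n ^ k * W k"
    have K: "0 \<le> ?K" using C(1)[of n] \<tau>[of n] W[of k] by simp
    have s1: "(\<sigma> n)\<^sup>2 \<le> \<sigma> n" using \<sigma>(1,3)[of n] by (simp add: power2_eq_square mult_left_le)
    have s2: "\<sigma> n ^ q \<le> \<sigma> n" using \<sigma>(1,3)[of n] pos power_decreasing[of 1 q "\<sigma> n"] by simp
    have "norm ((\<sigma> n)\<^sup>2 *\<^sub>R A k (T n t) *\<^sub>R e + B k (T n t) *\<^sub>R (y n - x) + \<sigma> n ^ q *\<^sub>R E k (T n t) *\<^sub>R w n)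
        \<le> (\<sigma> n)\<^sup>2 * (\<bar>A k (T n t)\<bar> * norm e) + \<bar>B k (T n t)\<bar> * norm (y n - x) + \<sigma> n ^ q * (\<bar>E k (T n t)\<bar> * norm (w n))"
      using \<sigma>(1)[of n] by (intro norm_triangle_le add_mono) (auto intro!: norm_triangle_le simp: abs_mult)
    also have "\<dots> \<le> \<sigma> n * (?K * norm e) + ?K * \<sigma> n + \<sigma> n * (?K * c)"
      using C(2-4)[where n=n and k=k and u="T n t"] s1 s2 w[of n] y(2)[of n] r(3)[of n] \<sigma>(1)[of n] pos K
      by (intro add_mono mult_mono) (auto intro: less_imp_le)
    also have "\<dots> = \<tau> n ^ k * (C n * S * \<sigma> n * W k)" by (simp add: S_def algebra_simps)
    also have "\<dots> \<le> \<tau> n ^ k * ((1/2) ^ n * W k)"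
      using \<tau>[of n] W[of k] \<sigma>(4)[of n] by (intro mult_left_mono mult_right_mono) auto
    finally have "norm (\<gamma> n k t) \<le> (1 / \<tau> n) ^ k * (\<tau> n ^ k * ((1/2) ^ n * W k))"
      unfolding \<gamma>_def norm_scaleR using \<tau>[of n] by (auto simp: power_abs intro!: mult_left_mono)
    also have "\<dots> = (1/2) ^ n * W k" using \<tau>[of n] by (simp add: power_divide)
    finally show ?thesis .
  qed
  define cv where "cv t = x + (\<Sum>n. \<gamma> n 0 t)" for t
  define dcv where "dcv k t = (if k = 0 then x else 0) + (\<Sum>n. \<gamma> n k t)" for k t
  have cv: "curve_derivs cv dcv"
    unfolding cv_def[abs_def] dcv_def[abs_def] by (rule curve_derivs_series[of \<gamma> W, OF \<gamma>_der \<gamma>_bd])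
  have norm_dcv: "norm (dcv k t) \<le> (2 + norm x / W 0) * 1 ^ k * fact k * M k" for k t
  proof -
    have "norm (dcv k t) \<le> (if k = 0 then norm x else 0) + 2 * W k"
      using curve_derivs_series(2)[of \<gamma> W, OF \<gamma>_der \<gamma>_bd, of k t] unfolding dcv_def
      by (auto intro!: norm_triangle_le)
    also have "\<dots> \<le> (2 + norm x / W 0) * W k"
      using W[of k] W[of 0] by (auto simp: algebra_simps)
    finally show ?thesis by (simp add: W_def mult.assoc)
  qed
  have loop: "x + loop \<psi> q e x (\<sigma> n) (y n) (w n) u \<in> X"
    "\<bar>u\<bar> < 1 \<Longrightarrow> x + loop \<psi> q e x (\<sigma> n) (y n) (w n) u = y n + (\<sigma> n * u)\<^sup>2 *\<^sub>R e + (\<sigma> n * u) ^ q *\<^sub>R w n"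
    "4 \<le> \<bar>u\<bar> \<Longrightarrow> loop \<psi> q e x (\<sigma> n) (y n) (w n) u = 0" for n u
    by (rule loop_in_set[OF P \<psi>(2,3,4) x pos(1,3,4) y(1) less_le_trans[OF y(2) r(2)] less_le_trans[OF y(2) r(4)] w \<sigma>(1,2)];
        assumption)+
  have active: "cv t = x + loop \<psi> q e x (\<sigma> n) (y n) (w n) (T n t)" if "\<bar>T n t\<bar> < 4" for n t
  proof -
    have near: "\<bar>t - (1/2) ^ n\<bar> < (1/2) ^ n / 4" if "\<bar>T n t\<bar> < 4" for n
    proof -
      have "\<bar>T n t\<bar> = \<bar>t - (1/2) ^ n\<bar> / \<tau> n" using \<tau>[of n] by (simp add: T_def)
      then show ?thesis using that \<tau>[of n] by (simp add: pos_divide_less_eq) (simp add: \<tau>_def)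
    qed
    have "\<gamma> m 0 t = 0" if "m \<noteq> n" for m
    proof (cases "\<bar>T m t\<bar> < 4")
      case True
      then show ?thesis using dyadic_intervals_disjoint[OF near[OF True] near[OF \<open>\<bar>T n t\<bar> < 4\<close>]] that by simp
    next
      case False
      then show ?thesis unfolding \<gamma>0 by (intro loop(3)) linarith
    qed
    then have "(\<Sum>m. \<gamma> m 0 t) = (\<Sum>m\<in>{n}. \<gamma> m 0 t)" by (intro suminf_finite) auto
    then show ?thesis by (simp add: cv_def \<gamma>0)
  qed
  \<comment> \<open>At times outside all the intervals, such as t = 0, the curve rests at x.\<close>
  have "cv t \<in> X" for t
  proof (cases "\<exists>n. \<bar>T n t\<bar> < 4")
    case True
    then show ?thesis using active loop(1) by auto
  next
    case False
    then have "\<gamma> n 0 t = 0" for n unfolding \<gamma>0 by (intro loop(3) leI) blast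
    then show ?thesis using x by (simp add: cv_def)
  qed
  then have "cv \<in> DC_curves_in M X"
  proof -
    assume "\<And>t. cv t \<in> X"
    moreover have "0 < 2 + norm x / W 0" using W[of 0] by (intro add_pos_nonneg) auto
    then have "\<forall>K. compact K \<longrightarrow> (\<exists>C \<rho>. C > 0 \<and> \<rho> > 0 \<and>
        (\<forall>k. \<forall>t\<in>K. norm (dcv k t) \<le> C * \<rho> ^ k * fact k * M k))"
      using norm_dcv zero_less_one by blast
    ultimately show ?thesis unfolding DC_curves_in_def using cv by blast
  qed
  then have "smooth_curve (f \<circ> cv)" using f by (auto simp: AinfM_def)
  then obtain F where F: "derivs_on UNIV (f \<circ> cv) F" by (auto simp: smooth_curve_def curve_derivs_iff_derivs_on)
  \<comment> \<open>Near time 2^-n the curve is the n-th arc up to an affine change of time. The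
    times found here lie in [0, 2], where the continuous N-th derivative must be bounded.\<close>
  have large: "\<exists>t\<in>{0..2}. real n < \<bar>F N t\<bar>" for n
  proof -
    let ?D = "\<lambda>k u. (\<tau> n / \<sigma> n) ^ k * F k ((1/2) ^ n + \<tau> n / \<sigma> n * u)"
    have "derivs_on {-r n<..<r n} (\<lambda>u. (f \<circ> cv) ((1/2) ^ n + \<tau> n / \<sigma> n * u)) ?D"
      by (rule derivs_on_affine[OF F]) simp
    then have "derivs_on {-r n<..<r n} (?\<phi> (y n) (w n)) ?D"
    proof (rule derivs_on_cong)
      fix u assume u: "u \<in> {-r n<..<r n}"
      have Tu: "T n ((1/2) ^ n + \<tau> n / \<sigma> n * u) = u / \<sigma> n" using \<tau>[of n] by (simp add: T_def)
      have "\<bar>u\<bar> < \<sigma> n" using u r(3)[of n] by auto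
      then have *: "\<bar>u / \<sigma> n\<bar> < 1" using \<sigma>(1)[of n] by simp
      have "cv ((1/2) ^ n + \<tau> n / \<sigma> n * u) = x + loop \<psi> q e x (\<sigma> n) (y n) (w n) (u / \<sigma> n)"
        by (rule active[of n "(1/2) ^ n + \<tau> n / \<sigma> n * u", unfolded Tu]) (use * in linarith)
      also have "\<dots> = y n + u\<^sup>2 *\<^sub>R e + u ^ q *\<^sub>R w n"
        using loop(2)[OF *, of n] \<sigma>(1)[of n] by simp
      finally show "(f \<circ> cv) ((1/2) ^ n + \<tau> n / \<sigma> n * u) = ?\<phi> (y n) (w n) u" by simp
    qed
    with viol[of n] obtain u where u: "\<bar>u\<bar> < r n" "real n * (\<tau> n / \<sigma> n) ^ N < \<bar>?D N u\<bar>" unfolding viol_def by blast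
    let ?t = "(1/2) ^ n + \<tau> n / \<sigma> n * u"
    have p: "0 < (\<tau> n / \<sigma> n) ^ N" using \<tau>[of n] \<sigma>(1)[of n] by simp
    have "real n < \<bar>F N ?t\<bar>" using u(2) p by (simp add: abs_mult mult.commute)
    moreover have "?t \<in> {0..2}"
    proof -
      have "\<bar>u\<bar> / \<sigma> n \<le> 1" using u(1) r(3)[of n] \<sigma>(1)[of n] by simp
      then have "\<bar>\<tau> n / \<sigma> n * u\<bar> \<le> \<tau> n" using \<tau>[of n] \<sigma>(1)[of n] mult_left_mono[of "\<bar>u\<bar> / \<sigma> n" 1 "\<tau> n"] by (simp add: abs_mult)
      moreover have "(1/2::real) ^ n \<le> 1" by (simp add: power_le_one)
      moreover have "\<tau> n \<le> (1/2) ^ n" by (simp add: \<tau>_def)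
      ultimately show ?thesis unfolding atLeastAtMost_iff by linarith
    qed
    ultimately show ?thesis by blast
  qed
  have "continuous_on {0..2} (F N)"
    by (rule DERIV_continuous_on[OF has_field_derivative_at_within[OF derivs_onD(2)[OF F]]]) auto
  then have "bounded (F N ` {0..2})" by (intro compact_imp_bounded compact_continuous_image) auto
  then obtain K where K: "\<And>t. t \<in> {0..2} \<Longrightarrow> \<bar>F N t\<bar> \<le> K"
    unfolding bounded_iff real_norm_def by blast
  obtain n where "K < real n" using reals_Archimedean2 by blast
  with large[of n] K show False by force
qed

section \<open>Mixed differences\<close>

fun mixed_diff :: "('a::real_vector \<Rightarrow> real) \<Rightarrow> 'a list \<Rightarrow> 'a \<Rightarrow> real" where
  "mixed_diff f [] y = f y"
| "mixed_diff f (h # hs) y = mixed_diff f hs (y + h) - mixed_diff f hs y"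

lemma mixed_diff_zero: "0 \<in> set hs \<Longrightarrow> mixed_diff f hs y = 0"
  by (induction hs arbitrary: y) auto

text \<open>The steps may move affinely with i. Expanding the mixed difference one step at a time
  leaves 2^(length ps) sums, each a pure difference whose base point has collected some of the
  \<open>fst p\<close> and whose step has collected the matching \<open>snd p\<close>.\<close>

lemma mixed_diff_moving_bound:
  fixes f :: "'a::real_normed_vector \<Rightarrow> real"
  assumes B: "\<And>z v. norm (z - y0) \<le> R \<Longrightarrow> norm v \<le> R \<Longrightarrow>
      \<bar>\<Sum>i\<le>n. (-1) ^ i * real (n choose i) * f (z + real i *\<^sub>R v)\<bar> \<le> B"
  shows "norm (z - y0) + (\<Sum>p\<leftarrow>ps. norm (fst p)) \<le> R \<Longrightarrow> norm v + (\<Sum>p\<leftarrow>ps. norm (snd p)) \<le> R \<Longrightarrow>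
    \<bar>\<Sum>i\<le>n. (-1) ^ i * real (n choose i) *
      mixed_diff f (map (\<lambda>p. fst p + real i *\<^sub>R snd p) ps) (z + real i *\<^sub>R v)\<bar> \<le> 2 ^ length ps * B"
proof (induction ps arbitrary: z v)
  case Nil
  then show ?case using B by simp
next
  case (Cons p ps)
  let ?m = "\<lambda>i z v. (-1) ^ i * real (n choose i) *
      mixed_diff f (map (\<lambda>p. fst p + real i *\<^sub>R snd p) ps) (z + real i *\<^sub>R v)"
  have "norm (z + fst p - y0) \<le> norm (z - y0) + norm (fst p)" "norm (v + snd p) \<le> norm v + norm (snd p)"
    using norm_triangle_ineq[of "z - y0" "fst p"] by (simp_all add: algebra_simps norm_triangle_ineq)
  then have 1: "\<bar>\<Sum>i\<le>n. ?m i (z + fst p) (v + snd p)\<bar> \<le> 2 ^ length ps * B"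
    using Cons.prems by (intro Cons.IH) auto
  have 2: "\<bar>\<Sum>i\<le>n. ?m i z v\<bar> \<le> 2 ^ length ps * B"
  proof (rule Cons.IH)
    show "norm (z - y0) + (\<Sum>p\<leftarrow>ps. norm (fst p)) \<le> R"
      using Cons.prems(1) norm_ge_zero[of "fst p"] unfolding list.map sum_list.Cons by linarith
    show "norm v + (\<Sum>p\<leftarrow>ps. norm (snd p)) \<le> R"
      using Cons.prems(2) norm_ge_zero[of "snd p"] unfolding list.map sum_list.Cons by linarith
  qed
  have "(\<Sum>i\<le>n. (-1) ^ i * real (n choose i) *
      mixed_diff f (map (\<lambda>p. fst p + real i *\<^sub>R snd p) (p # ps)) (z + real i *\<^sub>R v))
    = (\<Sum>i\<le>n. ?m i (z + fst p) (v + snd p)) - (\<Sum>i\<le>n. ?m i z v)"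
    by (simp add: sum_subtractf[symmetric] algebra_simps)
  then show ?case using 1 2 by simp
qed

text \<open>Djokovic's identity: \<open>mixed_diff f [h\<^sub>1, \<dots>, h\<^sub>n]\<close> is the sum over \<open>i \<le> n\<close> of
  \<open>(-1)\<^sup>i (n choose i) mixed_diff f [(1 - i/1) h\<^sub>1, \<dots>, (1 - i/n) h\<^sub>n]\<close>, because for \<open>i \<noteq> 0\<close> the list contains a
  zero. Expanding the mixed differences on the right leaves pure differences only.\<close>

lemma mixed_diff_le_pure_diff:
  fixes f :: "'a::real_normed_vector \<Rightarrow> real"
  assumes B: "\<And>z v. norm (z - y) \<le> R \<Longrightarrow> norm v \<le> R \<Longrightarrow>
      \<bar>\<Sum>i\<le>length hs. (-1) ^ i * real (length hs choose i) * f (z + real i *\<^sub>R v)\<bar> \<le> B"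
    and R: "(\<Sum>h\<leftarrow>hs. norm h) \<le> R"
  shows "\<bar>mixed_diff f hs y\<bar> \<le> 2 ^ length hs * B"
proof -
  let ?n = "length hs"
  define ps where "ps = map (\<lambda>j. (hs ! j, - (1 / real (Suc j)) *\<^sub>R (hs ! j))) [0..<?n]"
  have fst_ps: "map fst ps = hs" by (simp add: ps_def comp_def map_nth)
  have snd_le: "(\<Sum>p\<leftarrow>ps. norm (snd p)) \<le> (\<Sum>p\<leftarrow>ps. norm (fst p))"
    by (rule sum_list_mono) (auto simp: ps_def field_simps)
  have fst_sum: "(\<Sum>p\<leftarrow>ps. norm (fst p)) = (\<Sum>h\<leftarrow>hs. norm h)"
    unfolding fst_ps[symmetric] map_map comp_def ..
  have "\<bar>\<Sum>i\<le>?n. (-1) ^ i * real (?n choose i) *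
      mixed_diff f (map (\<lambda>p. fst p + real i *\<^sub>R snd p) ps) (y + real i *\<^sub>R 0)\<bar> \<le> 2 ^ length ps * B"
    by (rule mixed_diff_moving_bound[where R=R and ?y0.0=y]) (use B R snd_le fst_sum in auto)
  moreover have "(\<Sum>i\<le>?n. (-1) ^ i * real (?n choose i) *
      mixed_diff f (map (\<lambda>p. fst p + real i *\<^sub>R snd p) ps) (y + real i *\<^sub>R 0)) = mixed_diff f hs y"
  proof -
    have z: "mixed_diff f (map (\<lambda>p. fst p + real i *\<^sub>R snd p) ps) y = 0" if "i \<in> {..?n} - {0}" for i
    proof (rule mixed_diff_zero)
      from that obtain j where j: "i = Suc j" "j < ?n" by (cases i) auto
      have "fst (ps ! j) + real i *\<^sub>R snd (ps ! j) = 0" using j by (simp add: ps_def)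
      moreover have "ps ! j \<in> set ps" using j by (intro nth_mem) (simp add: ps_def)
      ultimately show "0 \<in> set (map (\<lambda>p. fst p + real i *\<^sub>R snd p) ps)" by force
    qed
    have "(\<Sum>i\<le>?n. (-1) ^ i * real (?n choose i) *
      mixed_diff f (map (\<lambda>p. fst p + real i *\<^sub>R snd p) ps) y) = (\<Sum>i\<in>{0}. (-1) ^ i * real (?n choose i) *
      mixed_diff f (map (\<lambda>p. fst p + real i *\<^sub>R snd p) ps) y)"
      by (rule sum.mono_neutral_right) (use z in auto)
    then show ?thesis using fst_ps by simp
  qed
  ultimately show ?thesis by (simp add: ps_def)
qed

lemma mixed_diff_telescope:
  "mixed_diff f hs (y + real n *\<^sub>R h) - mixed_diff f hs y = (\<Sum>i<n. mixed_diff f (h # hs) (y + real i *\<^sub>R h))"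
proof (induction n)
  case (Suc n)
  have "y + real n *\<^sub>R h + h = y + real (Suc n) *\<^sub>R h" by (simp add: algebra_simps)
  then have "mixed_diff f (h # hs) (y + real n *\<^sub>R h)
      = mixed_diff f hs (y + real (Suc n) *\<^sub>R h) - mixed_diff f hs (y + real n *\<^sub>R h)"
    by (simp only: mixed_diff.simps)
  then show ?case using Suc by (simp del: mixed_diff.simps of_nat_Suc)
qed simp

lemma mixed_diff_continuous_on:
  fixes f :: "'a::real_normed_vector \<Rightarrow> real"
  assumes "continuous_on U f"
  shows "(\<And>z v::'a. z \<in> S \<Longrightarrow> norm v \<le> (\<Sum>h\<leftarrow>hs. norm h) \<Longrightarrow> z + v \<in> U) \<Longrightarrow> continuous_on S (mixed_diff f hs)"
proof (induction hs arbitrary: S)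
  case Nil
  have "S \<subseteq> U" using Nil[of _ 0] by auto
  then show ?case using assms continuous_on_subset by auto
next
  case (Cons h hs)
  have 1: "continuous_on ((\<lambda>y. y + h) ` S) (mixed_diff f hs)"
  proof (rule Cons.IH)
    fix z v :: 'a assume "z \<in> (\<lambda>y. y + h) ` S" and v: "norm v \<le> (\<Sum>h\<leftarrow>hs. norm h)"
    then obtain y where y: "y \<in> S" "z = y + h" by blast
    have "norm (h + v) \<le> (\<Sum>h\<leftarrow>h # hs. norm h)" using v norm_triangle_ineq[of h v] by simp
    then show "z + v \<in> U" using Cons.prems[OF y(1), of "h + v"] y(2) by (simp add: add.assoc)
  qed
  have 2: "continuous_on S (mixed_diff f hs)"
  proof (rule Cons.IH)
    fix z v :: 'a assume "z \<in> S" "norm v \<le> (\<Sum>h\<leftarrow>hs. norm h)"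
    moreover have "(\<Sum>h\<leftarrow>hs. norm h) \<le> (\<Sum>h\<leftarrow>h # hs. norm h)" by simp
    ultimately show "z + v \<in> U" using Cons.prems[of z v] by linarith
  qed
  have "continuous_on S (\<lambda>y. mixed_diff f hs (y + h))"
    by (rule continuous_on_compose2[OF 1]) (auto intro!: continuous_intros)
  from continuous_on_diff[OF this 2] show ?case by simp
qed

text \<open>A mixed difference with steps u^q h is a signed sum of 2^(length hs) values of f on
  curves of the same kind, with w increased by partial sums of hs; R leaves room for all of
  them.\<close>

lemma derivs_on_mixed_diff:
  fixes f :: "'a::real_normed_vector \<Rightarrow> real"
  assumes "\<And>w. norm w \<le> R \<Longrightarrow> \<exists>D. derivs_on S (\<lambda>u. f (\<gamma> u + u ^ q *\<^sub>R w)) D \<and> (\<forall>u\<in>S. \<bar>D N u\<bar> \<le> B)"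
  shows "norm w + (\<Sum>h\<leftarrow>hs. norm h) \<le> R \<Longrightarrow>
    \<exists>D. derivs_on S (\<lambda>u. mixed_diff f (map (\<lambda>h. u ^ q *\<^sub>R h) hs) (\<gamma> u + u ^ q *\<^sub>R w)) D \<and>
      (\<forall>u\<in>S. \<bar>D N u\<bar> \<le> 2 ^ length hs * B)"
proof (induction hs arbitrary: w)
  case Nil
  then show ?case using assms by simp
next
  case (Cons h hs)
  have "norm (w + h) \<le> norm w + norm h" by (rule norm_triangle_ineq)
  then obtain D where D: "derivs_on S (\<lambda>u. mixed_diff f (map (\<lambda>h. u ^ q *\<^sub>R h) hs) (\<gamma> u + u ^ q *\<^sub>R (w + h))) D"
    "\<And>u. u \<in> S \<Longrightarrow> \<bar>D N u\<bar> \<le> 2 ^ length hs * B"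
    using Cons.IH[of "w + h"] Cons.prems by auto
  have "norm w + (\<Sum>h\<leftarrow>hs. norm h) \<le> R"
    using Cons.prems norm_ge_zero[of h] unfolding list.map sum_list.Cons by linarith
  then obtain E where E: "derivs_on S (\<lambda>u. mixed_diff f (map (\<lambda>h. u ^ q *\<^sub>R h) hs) (\<gamma> u + u ^ q *\<^sub>R w)) E"
    "\<And>u. u \<in> S \<Longrightarrow> \<bar>E N u\<bar> \<le> 2 ^ length hs * B"
    using Cons.IH[of w] by blast
  have "derivs_on S (\<lambda>u. mixed_diff f (map (\<lambda>h. u ^ q *\<^sub>R h) (h # hs)) (\<gamma> u + u ^ q *\<^sub>R w)) (\<lambda>k u. D k u - E k u)"
    using derivs_on_diff[OF D(1) E(1)] by (simp add: scaleR_add_right add.assoc)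
  moreover have "\<bar>D N u - E N u\<bar> \<le> 2 ^ length (h # hs) * B" if "u \<in> S" for u
    using D(2)[OF that] E(2)[OF that] by simp
  ultimately show ?case by (intro exI[of _ "\<lambda>k u. D k u - E k u"]) auto
qed

text \<open>As a function of u the mixed difference is a signed sum of values on lines, hence smooth
  with bounded derivative of order k + 1. It is O(u^k), because mixed differences are dominated by
  pure ones and these by the k-th derivatives on lines. So its Taylor expansion starts at u^k. The
  coefficient L depends on y and hs, the radius and the constant do not.\<close>

lemma mixed_diff_expansion:
  fixes f :: "'a::euclidean_space \<Rightarrow> real"
  assumes lines: "\<And>N. \<exists>B r. 0 < r \<and> (\<forall>y w. norm (y - x) < r \<longrightarrow> norm w \<le> 1/2 \<longrightarrow>
      (\<exists>D. derivs_on {-r<..<r} (\<lambda>u. f (y + u *\<^sub>R w)) D \<and> (\<forall>u. \<bar>u\<bar> < r \<longrightarrow> \<bar>D N u\<bar> \<le> B)))"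
  shows "\<exists>r C. 0 < r \<and> (\<forall>y hs. norm (y - x) < r \<longrightarrow> length hs = k \<longrightarrow> set hs \<subseteq> Basis \<longrightarrow>
    (\<exists>L. \<forall>u. 0 < u \<longrightarrow> u < r \<longrightarrow> \<bar>mixed_diff f (map ((*\<^sub>R) u) hs) y - u ^ k * L\<bar> \<le> C * u ^ Suc k))"
proof -
  obtain B1 r1 where r1: "0 < r1" and B1: "\<And>y w. norm (y - x) < r1 \<Longrightarrow> norm w \<le> 1/2 \<Longrightarrow>
      \<exists>D. derivs_on {-r1<..<r1} (\<lambda>u. f (y + u *\<^sub>R w)) D \<and> (\<forall>u. \<bar>u\<bar> < r1 \<longrightarrow> \<bar>D (Suc k) u\<bar> \<le> B1)"
    using lines[of "Suc k"] by blast
  obtain B2 r2 where r2: "0 < r2" and B2: "\<And>y w. norm (y - x) < r2 \<Longrightarrow> norm w \<le> 1/2 \<Longrightarrow>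
      \<exists>D. derivs_on {-r2<..<r2} (\<lambda>u. f (y + u *\<^sub>R w)) D \<and> (\<forall>u. \<bar>u\<bar> < r2 \<longrightarrow> \<bar>D k u\<bar> \<le> B2)"
    using lines[of k] by blast
  \<comment> \<open>\<open>lines\<close> speaks of directions of norm at most 1/2. A direction v of
    norm up to k u is therefore divided by s u, and the entries of hs are divided by s.\<close>
  define s where "s = 2 * (real k + 1)"
  have s: "2 \<le> s" "real k / s \<le> 1/2" "real k \<le> s" by (auto simp: s_def field_simps)
  define r where "r = min r1 r2 / (2 * s * s)"
  have "0 < r" using r1 r2 s by (simp add: r_def)
  have r_le: "2 * (s * s * r) \<le> r1" "2 * (s * s * r) \<le> r2" using s by (auto simp: r_def)
  have mul_le: "s * r \<le> s * s * r" "r \<le> s * r" using s \<open>0 < r\<close> by (auto simp: mult_le_cancel_right1)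
  let ?\<psi> = "\<lambda>hs y u. mixed_diff f (map ((*\<^sub>R) u) hs) y"
  have small: "\<bar>?\<psi> hs y u\<bar> \<le> (2 ^ k * B2 * s ^ k) * u ^ k"
    if y: "norm (y - x) < r" and hs: "length hs = k" "set hs \<subseteq> Basis" and u: "0 < u" "u < r" for y hs u
  proof -
    have sum: "(\<Sum>h\<leftarrow>map ((*\<^sub>R) u) hs. norm h) = real k * u"
    proof -
      have "map norm (map ((*\<^sub>R) u) hs) = map (\<lambda>_. u) hs" using hs u by (auto simp: subset_iff)
      then show ?thesis using hs by (simp add: sum_list_triv del: map_map)
    qed
    have "\<bar>?\<psi> hs y u\<bar> \<le> 2 ^ length (map ((*\<^sub>R) u) hs) * (B2 * (s * u) ^ k)"
    proof (rule mixed_diff_le_pure_diff[where R="real k * u"])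
      fix z v :: 'a assume z: "norm (z - y) \<le> real k * u" and v: "norm v \<le> real k * u"
      have "norm (z - x) < r2"
      proof -
        have "norm (z - x) \<le> norm (z - y) + norm (y - x)" using norm_triangle_ineq[of "z - y" "y - x"] by simp
        also have "\<dots> < s * r + r" using z y u s mult_mono[of "real k" s u r] by linarith
        finally show ?thesis using mul_le r_le(2) by linarith
      qed
      moreover have "norm ((1 / (s * u)) *\<^sub>R v) \<le> 1/2"
      proof -
        have "norm v / (s * u) \<le> real k * u / (s * u)" using v s u by (intro divide_right_mono) auto
        also have "\<dots> = real k / s" using u by simp
        also have "\<dots> \<le> 1/2" by (rule s)
        finally show ?thesis using s u by (simp add: abs_of_pos)
      qed
      ultimately obtain D where D: "derivs_on {-r2<..<r2} (\<lambda>t. f (z + t *\<^sub>R (1 / (s * u)) *\<^sub>R v)) D"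
        "\<And>t. \<bar>t\<bar> < r2 \<Longrightarrow> \<bar>D k t\<bar> \<le> B2" using B2 by blast
      have "real k * (s * u) < r2"
      proof -
        have "real k * (s * u) \<le> s * (s * r)" using s u by (intro mult_mono) auto
        moreover have "0 < s * s * r" using s \<open>0 < r\<close> by simp
        ultimately show ?thesis using r_le(2) by (simp add: mult.assoc)
      qed
      then have "\<bar>\<Sum>i\<le>k. (-1) ^ i * real (k choose i) * f (z + (0 + real i * (s * u)) *\<^sub>R (1 / (s * u)) *\<^sub>R v)\<bar> \<le> B2 * (s * u) ^ k"
        using s u r2 by (intro pure_difference_bound[OF D(1)] D(2)) auto
      then show "\<bar>\<Sum>i\<le>length (map ((*\<^sub>R) u) hs). (-1) ^ i * real (length (map ((*\<^sub>R) u) hs) choose i) * f (z + real i *\<^sub>R v)\<bar> \<le> B2 * (s * u) ^ k"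
        using s u hs by simp
    qed (use sum in simp)
    then show ?thesis using hs by (simp add: power_mult_distrib mult_ac)
  qed
  define C where "C = s ^ Suc k * (2 ^ k * B1)"
  have "\<exists>L. \<forall>u. 0 < u \<longrightarrow> u < r \<longrightarrow> \<bar>?\<psi> hs y u - u ^ k * L\<bar> \<le> C * u ^ Suc k"
    if y: "norm (y - x) < r" and hs: "length hs = k" "set hs \<subseteq> Basis" for y hs
  proof -
    let ?hs = "map ((*\<^sub>R) (1 / s)) hs"
    have "map norm ?hs = map (\<lambda>_. 1 / s) hs" using hs s by (auto simp: subset_iff)
    then have sum: "(\<Sum>h\<leftarrow>?hs. norm h) = real k / s" using hs by (simp add: sum_list_triv del: map_map)
    have "r \<le> r1" using mul_le r_le \<open>0 < r\<close> s by linarith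
    have "\<exists>D. derivs_on {-r1<..<r1} (\<lambda>u. mixed_diff f (map (\<lambda>h. u ^ 1 *\<^sub>R h) ?hs) (y + u ^ 1 *\<^sub>R 0)) D \<and>
        (\<forall>u\<in>{-r1<..<r1}. \<bar>D (Suc k) u\<bar> \<le> 2 ^ length ?hs * B1)"
    proof (rule derivs_on_mixed_diff[where R="1/2" and \<gamma>="\<lambda>_. y"])
      fix w :: 'a assume "norm w \<le> 1/2"
      with B1[of y w] y \<open>r \<le> r1\<close> obtain D where "derivs_on {-r1<..<r1} (\<lambda>u. f (y + u *\<^sub>R w)) D"
        "\<forall>u. \<bar>u\<bar> < r1 \<longrightarrow> \<bar>D (Suc k) u\<bar> \<le> B1" by force
      then show "\<exists>D. derivs_on {-r1<..<r1} (\<lambda>u. f (y + u ^ 1 *\<^sub>R w)) D \<and> (\<forall>u\<in>{-r1<..<r1}. \<bar>D (Suc k) u\<bar> \<le> B1)"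
        by (intro exI[of _ D]) auto
    qed (use sum s in simp)
    then obtain D where D1: "derivs_on {-r1<..<r1} (\<lambda>u. mixed_diff f (map (\<lambda>h. u *\<^sub>R h) ?hs) y) D"
      and D2: "\<forall>u\<in>{-r1<..<r1}. \<bar>D (Suc k) u\<bar> \<le> 2 ^ k * B1" using hs by auto
    have D2': "\<bar>D (Suc k) u\<bar> \<le> 2 ^ k * B1" if "\<bar>u\<bar> < r1" for u
      using D2 that by (simp add: abs_less_iff)
    note D = D1 D2'
    have sr: "\<bar>s * u\<bar> < r1" if "\<bar>u\<bar> < r" for u
    proof -
      have "\<bar>s * u\<bar> \<le> s * r" using s that by (auto simp: abs_mult intro!: mult_left_mono)
      moreover have "0 < s * s * r" using s \<open>0 < r\<close> by simp
      ultimately show ?thesis using mul_le r_le by linarith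
    qed
    have "derivs_on {-r<..<r} (\<lambda>u. mixed_diff f (map (\<lambda>h. (0 + s * u) *\<^sub>R h) ?hs) y) (\<lambda>j u. s ^ j * D j (0 + s * u))"
      by (rule derivs_on_affine[OF D(1)]) (use sr in \<open>force simp: abs_less_iff\<close>)
    moreover have maps: "map (\<lambda>h. (0 + s * u) *\<^sub>R h) ?hs = map ((*\<^sub>R) u) hs" for u using s by simp
    ultimately have E: "derivs_on {-r<..<r} (?\<psi> hs y) (\<lambda>j u. s ^ j * D j (s * u))"
      unfolding maps by simp
    have "\<bar>s ^ Suc k * D (Suc k) (s * u)\<bar> \<le> C" if "\<bar>u\<bar> < r" for u
      unfolding C_def using D(2)[OF sr[OF that]] s by (auto simp: abs_mult intro!: mult_left_mono)
    from derivs_on_flat_remainder[OF E \<open>0 < r\<close> small[OF y hs] this] show ?thesis by blast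
  qed
  then show ?thesis using \<open>0 < r\<close> by blast
qed

text \<open>The expansion provides a coefficient L for each y and hs separately, and only near a
  given x; the limit along u = 1 / (n + 1) selects one function for all of them.\<close>

definition partial_lim :: "('a::real_vector \<Rightarrow> real) \<Rightarrow> 'a list \<Rightarrow> 'a \<Rightarrow> real" where
  "partial_lim f hs y = lim (\<lambda>n. real (Suc n) ^ length hs * mixed_diff f (map ((*\<^sub>R) (1 / real (Suc n))) hs) y)"

lemma partial_lim_eqI:
  assumes L: "\<And>u. 0 < u \<Longrightarrow> u < r \<Longrightarrow> \<bar>mixed_diff f (map ((*\<^sub>R) u) hs) y - u ^ length hs * L\<bar> \<le> C * u ^ Suc (length hs)"
    and r: "0 < r"
  shows "partial_lim f hs y = L"
proof -
  let ?m = "\<lambda>n. real (Suc n) ^ length hs * mixed_diff f (map ((*\<^sub>R) (1 / real (Suc n))) hs) y"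
  have lim0: "(\<lambda>n. 1 / real (Suc n)) \<longlonglongrightarrow> 0" using LIMSEQ_inverse_real_of_nat by (simp add: inverse_eq_divide)
  then have ev: "\<forall>\<^sub>F n in sequentially. 1 / real (Suc n) < r" using order_tendstoD(2) r by blast
  have "\<forall>\<^sub>F n in sequentially. norm (?m n - L) \<le> C * (1 / real (Suc n))"
  proof (rule eventually_mono[OF ev])
    fix n assume n: "1 / real (Suc n) < r"
    define u where "u = 1 / real (Suc n)"
    have u: "0 < u" "u < r" using n by (auto simp: u_def)
    have m: "?m n = mixed_diff f (map ((*\<^sub>R) u) hs) y / u ^ length hs" by (simp add: u_def power_divide)
    have "?m n - L = (mixed_diff f (map ((*\<^sub>R) u) hs) y - u ^ length hs * L) / u ^ length hs"
      unfolding m using u by (simp add: field_simps)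
    then have "\<bar>?m n - L\<bar> = \<bar>mixed_diff f (map ((*\<^sub>R) u) hs) y - u ^ length hs * L\<bar> / u ^ length hs"
      using u by (simp add: abs_divide del: of_nat_Suc)
    also have "\<dots> \<le> C * u ^ Suc (length hs) / u ^ length hs"
      using u by (intro divide_right_mono L) auto
    also have "\<dots> = C * u" using u by simp
    finally show "norm (?m n - L) \<le> C * (1 / real (Suc n))" by (simp add: u_def)
  qed
  moreover have "(\<lambda>n. C * (1 / real (Suc n))) \<longlonglongrightarrow> 0" using tendsto_mult[OF tendsto_const[of C] lim0] by simp
  ultimately have "(\<lambda>n. ?m n - L) \<longlonglongrightarrow> 0" by (rule Lim_null_comparison)
  then have "?m \<longlonglongrightarrow> L" by (simp add: LIM_zero_iff)
  then show ?thesis unfolding partial_lim_def by (rule limI)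
qed

text \<open>The error is one order smaller than the main term, and locally uniform in the base
  point. This stands in for differentiability of f, which is derived from it.\<close>

definition expands_on :: "'a::euclidean_space set \<Rightarrow> ('a \<Rightarrow> real) \<Rightarrow> ('a list \<Rightarrow> 'a \<Rightarrow> real) \<Rightarrow> bool" where
  "expands_on U f G \<longleftrightarrow> (\<forall>x\<in>U. \<forall>k. \<exists>r C. 0 < r \<and> (\<forall>y hs. norm (y - x) < r \<longrightarrow> length hs = k \<longrightarrow> set hs \<subseteq> Basis \<longrightarrow>
    (\<forall>u. 0 < u \<longrightarrow> u < r \<longrightarrow> \<bar>mixed_diff f (map ((*\<^sub>R) u) hs) y - u ^ k * G hs y\<bar> \<le> C * u ^ Suc k)))"

lemma expands_onD:
  fixes x :: "'a::euclidean_space"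
  assumes "expands_on U f G" "x \<in> U"
  obtains r C where "0 < r" "0 < C" "\<And>y hs u. norm (y - x) < r \<Longrightarrow> length hs = k \<Longrightarrow> set hs \<subseteq> Basis \<Longrightarrow>
    0 < u \<Longrightarrow> u < r \<Longrightarrow> \<bar>mixed_diff f (map ((*\<^sub>R) u) hs) y - u ^ k * G hs y\<bar> \<le> C * u ^ Suc k"
proof -
  obtain r C where rC: "0 < r" "\<And>y hs u. norm (y - x) < r \<Longrightarrow> length hs = k \<Longrightarrow> set hs \<subseteq> Basis \<Longrightarrow>
    0 < u \<Longrightarrow> u < r \<Longrightarrow> \<bar>mixed_diff f (map ((*\<^sub>R) u) hs) y - u ^ k * G hs y\<bar> \<le> C * u ^ Suc k"
    using assms(1)[unfolded expands_on_def, rule_format, OF assms(2), of k] by metis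
  show thesis
  proof (rule that[of r "\<bar>C\<bar> + 1"])
    fix y and hs :: "'a list" and u assume a: "norm (y - x) < r" "length hs = k" "set hs \<subseteq> Basis" "0 < u" "u < r"
    have "C * u ^ Suc k \<le> (\<bar>C\<bar> + 1) * u ^ Suc k" using a by (intro mult_right_mono) auto
    then show "\<bar>mixed_diff f (map ((*\<^sub>R) u) hs) y - u ^ k * G hs y\<bar> \<le> (\<bar>C\<bar> + 1) * u ^ Suc k"
      using rC(2)[OF a] by linarith
  qed (use rC in auto)
qed

lemma expands_on_partial_lim:
  fixes f :: "'a::euclidean_space \<Rightarrow> real"
  assumes "\<And>x N. x \<in> U \<Longrightarrow> \<exists>B r. 0 < r \<and> (\<forall>y w. norm (y - x) < r \<longrightarrow> norm w \<le> 1/2 \<longrightarrow>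
      (\<exists>D. derivs_on {-r<..<r} (\<lambda>u. f (y + u *\<^sub>R w)) D \<and> (\<forall>u. \<bar>u\<bar> < r \<longrightarrow> \<bar>D N u\<bar> \<le> B)))"
  shows "expands_on U f (partial_lim f)"
  unfolding expands_on_def
proof (intro ballI allI)
  fix x k assume "x \<in> U"
  from mixed_diff_expansion[OF assms[OF this], of k] obtain r C where r: "0 < r" and
    L: "\<And>y hs. norm (y - x) < r \<Longrightarrow> length hs = k \<Longrightarrow> set hs \<subseteq> Basis \<Longrightarrow>
      \<exists>L. \<forall>u. 0 < u \<longrightarrow> u < r \<longrightarrow> \<bar>mixed_diff f (map ((*\<^sub>R) u) hs) y - u ^ k * L\<bar> \<le> C * u ^ Suc k" by blast
  have "\<bar>mixed_diff f (map ((*\<^sub>R) u) hs) y - u ^ k * partial_lim f hs y\<bar> \<le> C * u ^ Suc k"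
    if "norm (y - x) < r" "length hs = k" "set hs \<subseteq> Basis" "0 < u" "u < r" for y hs u
  proof -
    from L[OF that(1-3)] obtain L where
      L: "\<And>u. 0 < u \<Longrightarrow> u < r \<Longrightarrow> \<bar>mixed_diff f (map ((*\<^sub>R) u) hs) y - u ^ k * L\<bar> \<le> C * u ^ Suc k" by blast
    have "partial_lim f hs y = L"
      by (rule partial_lim_eqI[OF _ r]) (use L that(2) in auto)
    then show ?thesis using L that by simp
  qed
  then show "\<exists>r C. 0 < r \<and> (\<forall>y hs. norm (y - x) < r \<longrightarrow> length hs = k \<longrightarrow> set hs \<subseteq> Basis \<longrightarrow>
    (\<forall>u. 0 < u \<longrightarrow> u < r \<longrightarrow> \<bar>mixed_diff f (map ((*\<^sub>R) u) hs) y - u ^ k * partial_lim f hs y\<bar> \<le> C * u ^ Suc k))"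
    using r by blast
qed

section \<open>Smoothness in the interior\<close>

definition partials_on :: "'a::euclidean_space set \<Rightarrow> ('a list \<Rightarrow> 'a \<Rightarrow> real) \<Rightarrow> bool" where
  "partials_on U D \<longleftrightarrow> (\<forall>bs. set bs \<subseteq> Basis \<longrightarrow> continuous_on U (D bs)) \<and>
    (\<forall>bs b x. set bs \<subseteq> Basis \<longrightarrow> b \<in> Basis \<longrightarrow> x \<in> U \<longrightarrow>
       ((\<lambda>t. D bs (x + t *\<^sub>R b)) has_real_derivative D (b # bs) x) (at 0))"

lemma smooth_on_iff_partials_on:
  "smooth_on U F \<longleftrightarrow> (\<exists>D. (\<forall>x\<in>U. D [] x = F x) \<and> partials_on U D)"
  by (simp add: smooth_on_def partials_on_def)

text \<open>Difference quotients with a fixed step are continuous, and the expansion makes them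
  converge uniformly near x.\<close>

lemma expands_on_continuous:
  fixes f :: "'a::euclidean_space \<Rightarrow> real"
  assumes E: "expands_on U f G" and U: "open U" and f: "continuous_on U f" and hs: "set hs \<subseteq> Basis"
  shows "continuous_on U (G hs)"
proof (rule continuous_at_imp_continuous_on, rule ballI)
  fix x assume x: "x \<in> U"
  let ?k = "length hs"
  obtain r C where r: "0 < r" "0 < C" and exp: "\<And>y hs u. norm (y - x) < r \<Longrightarrow> length hs = ?k \<Longrightarrow> set hs \<subseteq> Basis \<Longrightarrow>
    0 < u \<Longrightarrow> u < r \<Longrightarrow> \<bar>mixed_diff f (map ((*\<^sub>R) u) hs) y - u ^ ?k * G hs y\<bar> \<le> C * u ^ Suc ?k"
    by (rule expands_onD[OF E x, of ?k]) blast
  obtain \<epsilon> where \<epsilon>: "0 < \<epsilon>" "ball x \<epsilon> \<subseteq> U" using U x open_contains_ball by blast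
  define s where "s = min r (\<epsilon> / 2)"
  have s: "0 < s" "s \<le> r" "2 * s \<le> \<epsilon>" using r \<epsilon> by (auto simp: s_def)
  \<comment> \<open>Small enough that all points of the difference, at distance at most k u from the
    base point, stay in U.\<close>
  let ?u = "\<lambda>n. s / (real ?k + 2) * (1 / real (Suc n))"
  have u: "0 < ?u n" "?u n < s" "real ?k * ?u n < s" for n
  proof -
    have "real ?k + 2 < (real ?k + 2) * real (Suc n) + 1" by (simp add: algebra_simps add_pos_nonneg)
    then have *: "real ?k + 1 < (real ?k + 2) * real (Suc n)" by linarith
    show "0 < ?u n" using s by simp
    define q where "q = (real ?k + 2) * real (Suc n)"
    have q: "real ?k + 1 < q" using * by (simp add: q_def)
    then have q': "1 < q" by linarith
    have eq: "?u n = s / q" by (simp add: q_def)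
    show "?u n < s" unfolding eq using q' s by (simp add: pos_divide_less_eq)
    have "real ?k * s < q * s" using q s by (intro mult_strict_right_mono) auto
    then show "real ?k * ?u n < s" unfolding eq using q' by (simp add: pos_divide_less_eq mult.commute)
  qed
  have u_lim: "?u \<longlonglongrightarrow> 0"
    using tendsto_mult[OF tendsto_const[of "s / (real ?k + 2)"] LIMSEQ_inverse_real_of_nat] by (simp add: inverse_eq_divide)
  let ?g = "\<lambda>n y. mixed_diff f (map ((*\<^sub>R) (?u n)) hs) y / ?u n ^ ?k"
  have "continuous_on (ball x s) (G hs)"
  proof (rule uniform_limit_theorem)
    show "\<forall>\<^sub>F n in sequentially. continuous_on (ball x s) (?g n)"
    proof (intro always_eventually allI continuous_on_divide continuous_on_const mixed_diff_continuous_on[OF f])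
      fix n z and v :: 'a
      assume z: "z \<in> ball x s" and v: "norm v \<le> (\<Sum>h\<leftarrow>map ((*\<^sub>R) (?u n)) hs. norm h)"
      have "map norm (map ((*\<^sub>R) (?u n)) hs) = map (\<lambda>_. ?u n) hs"
        using hs s(1) by (auto simp: subset_iff)
      then have "norm v \<le> real ?k * ?u n" using v by (simp add: sum_list_triv del: map_map)
      then have "norm v < s" using u(3)[of n] by linarith
      moreover have "dist x (z + v) \<le> dist x z + norm v" using norm_triangle_ineq4[of "x - z" v] by (simp add: dist_norm algebra_simps)
      ultimately have "z + v \<in> ball x \<epsilon>" using z s by auto
      then show "z + v \<in> U" using \<epsilon> by blast
    qed (use u in \<open>auto simp: less_imp_neq\<close>)
    show "uniform_limit (ball x s) ?g (G hs) sequentially"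
    proof (rule uniform_limitI)
      fix e :: real assume e: "0 < e"
      then have "\<forall>\<^sub>F n in sequentially. ?u n < e / C" using order_tendstoD(2)[OF u_lim, of "e / C"] r by simp
      then show "\<forall>\<^sub>F n in sequentially. \<forall>y\<in>ball x s. dist (?g n y) (G hs y) < e"
      proof (rule eventually_mono, intro ballI)
        fix n y assume n: "?u n < e / C" and y: "y \<in> ball x s"
        define w where "w = ?u n"
        have w: "0 < w" "w < s" "w < e / C" using u n by (auto simp: w_def)
        have "\<bar>mixed_diff f (map ((*\<^sub>R) w) hs) y - w ^ ?k * G hs y\<bar> \<le> C * w ^ Suc ?k"
          by (rule exp) (use y s w hs in \<open>auto simp: dist_norm norm_minus_commute\<close>)
        then have "\<bar>mixed_diff f (map ((*\<^sub>R) w) hs) y - w ^ ?k * G hs y\<bar> / w ^ ?k \<le> C * w"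
          using w by (simp add: pos_divide_le_eq mult.assoc)
        also have "C * w < e" using w r by (simp add: field_simps)
        also have "\<bar>mixed_diff f (map ((*\<^sub>R) w) hs) y - w ^ ?k * G hs y\<bar> / w ^ ?k
            = \<bar>(mixed_diff f (map ((*\<^sub>R) w) hs) y - w ^ ?k * G hs y) / w ^ ?k\<bar>" using w by simp
        also have "(mixed_diff f (map ((*\<^sub>R) w) hs) y - w ^ ?k * G hs y) / w ^ ?k = ?g n y - G hs y"
          unfolding w_def[symmetric] using w(1) by (simp add: diff_divide_distrib)
        finally show "dist (?g n y) (G hs y) < e" by (simp add: dist_real_def)
      qed
    qed
  qed auto
  then show "isCont (G hs) x" using s by (simp add: continuous_on_eq_continuous_at)
qed

text \<open>Cut the segment into n + 1 pieces of length u. The increment of the difference in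
  directions hs telescopes into n + 1 differences in directions b # hs, whose total error, divided
  by u^k, is of order (n + 1) u^2 = \<delta> u. For n \<rightarrow> \<infinity> a mean value
  inequality for G hs remains.\<close>

lemma expands_on_increment:
  fixes f :: "'a::euclidean_space \<Rightarrow> real"
  assumes e1: "\<And>y u. norm (y - x) < r \<Longrightarrow> 0 < u \<Longrightarrow> u < r \<Longrightarrow>
      \<bar>mixed_diff f (map ((*\<^sub>R) u) hs) y - u ^ length hs * G hs y\<bar> \<le> C * u ^ Suc (length hs)"
    and e2: "\<And>y u. norm (y - x) < r \<Longrightarrow> 0 < u \<Longrightarrow> u < r \<Longrightarrow>
      \<bar>mixed_diff f (map ((*\<^sub>R) u) (b # hs)) y - u ^ Suc (length hs) * G (b # hs) y\<bar> \<le> C' * u ^ Suc (Suc (length hs))"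
    and seg: "\<And>s. 0 \<le> s \<Longrightarrow> s \<le> \<delta> \<Longrightarrow> norm (z + s *\<^sub>R b - x) < r \<and> \<bar>G (b # hs) (z + s *\<^sub>R b) - m\<bar> \<le> \<omega>"
    and \<delta>: "0 < \<delta>" and r: "0 < r"
  shows "\<bar>G hs (z + \<delta> *\<^sub>R b) - G hs z - \<delta> * m\<bar> \<le> \<delta> * \<omega>"
proof -
  let ?k = "length hs" and ?I = "G hs (z + \<delta> *\<^sub>R b) - G hs z - \<delta> * m"
  let ?u = "\<lambda>n. \<delta> * (1 / real (Suc n))"
  have u_lim: "?u \<longlonglongrightarrow> 0"
    using tendsto_mult[OF tendsto_const[of \<delta>] LIMSEQ_inverse_real_of_nat] by (simp add: inverse_eq_divide)
  have main: "\<bar>?I\<bar> \<le> (2 * C + \<delta> * C') * u + \<delta> * \<omega>" if n: "u = \<delta> * (1 / real (Suc n))" "u < r" for n u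
  proof -
    have u: "0 < u" "real (Suc n) * u = \<delta>" using \<delta> by (auto simp: n)
    let ?m = "\<lambda>y. mixed_diff f (map ((*\<^sub>R) u) hs) y" and ?m' = "\<lambda>y. mixed_diff f (map ((*\<^sub>R) u) (b # hs)) y"
    have end': "norm (z - x) < r" "norm (z + \<delta> *\<^sub>R b - x) < r" using seg[of 0] seg[of \<delta>] \<delta> by auto
    have tel: "?m (z + \<delta> *\<^sub>R b) - ?m z = (\<Sum>i<Suc n. ?m' (z + real i *\<^sub>R u *\<^sub>R b))"
      using mixed_diff_telescope[of f "map ((*\<^sub>R) u) hs" z "Suc n" "u *\<^sub>R b"] u(2) by (simp del: mixed_diff.simps of_nat_Suc sum.lessThan_Suc)
    have "\<bar>?m' (z + real i *\<^sub>R u *\<^sub>R b) - u ^ Suc ?k * m\<bar> \<le> u ^ Suc ?k * (C' * u + \<omega>)" if i: "i < Suc n" for i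
    proof -
      define y where "y = z + (real i * u) *\<^sub>R b"
      have iu: "0 \<le> real i * u" "real i * u \<le> \<delta>"
        using u i mult_right_mono[of "real i" "real (Suc n)" u] by auto
      have "\<bar>?m' y - u ^ Suc ?k * G (b # hs) y\<bar> \<le> C' * u ^ Suc (Suc ?k)"
        using seg[OF iu] u n by (intro e2) (auto simp: y_def)
      moreover have "\<bar>u ^ Suc ?k * G (b # hs) y - u ^ Suc ?k * m\<bar> \<le> u ^ Suc ?k * \<omega>"
        using seg[OF iu] u unfolding right_diff_distrib[symmetric] abs_mult by (auto simp: y_def intro!: mult_left_mono)
      ultimately have "\<bar>?m' y - u ^ Suc ?k * m\<bar> \<le> C' * u ^ Suc (Suc ?k) + u ^ Suc ?k * \<omega>" by linarith
      also have "\<dots> = u ^ Suc ?k * (C' * u + \<omega>)" by (simp add: algebra_simps)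
      finally show ?thesis by (simp add: y_def)
    qed
    then have "(\<Sum>i<Suc n. \<bar>?m' (z + real i *\<^sub>R u *\<^sub>R b) - u ^ Suc ?k * m\<bar>) \<le> (\<Sum>i<Suc n. u ^ Suc ?k * (C' * u + \<omega>))"
      by (intro sum_mono) auto
    then have "\<bar>\<Sum>i<Suc n. ?m' (z + real i *\<^sub>R u *\<^sub>R b) - u ^ Suc ?k * m\<bar> \<le> real (Suc n) * (u ^ Suc ?k * (C' * u + \<omega>))"
      using order_trans[OF sum_abs] by (simp del: mixed_diff.simps of_nat_Suc sum.lessThan_Suc add: sum_constant)
    moreover have "(\<Sum>i<Suc n. ?m' (z + real i *\<^sub>R u *\<^sub>R b) - u ^ Suc ?k * m) = (?m (z + \<delta> *\<^sub>R b) - ?m z) - real (Suc n) * (u ^ Suc ?k * m)"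
      unfolding tel by (simp del: mixed_diff.simps of_nat_Suc sum.lessThan_Suc add: sum_subtractf)
    moreover have "real (Suc n) * (u ^ Suc ?k * c) = u ^ ?k * (\<delta> * c)" for c
      unfolding u(2)[symmetric] by simp
    ultimately have 1: "\<bar>(?m (z + \<delta> *\<^sub>R b) - ?m z) - u ^ ?k * (\<delta> * m)\<bar> \<le> u ^ ?k * (\<delta> * (C' * u + \<omega>))" by (simp only:)
    have 2: "\<bar>?m (z + \<delta> *\<^sub>R b) - u ^ ?k * G hs (z + \<delta> *\<^sub>R b)\<bar> \<le> C * u ^ Suc ?k"
      by (rule e1) (use end' u n in auto)
    have 3: "\<bar>?m z - u ^ ?k * G hs z\<bar> \<le> C * u ^ Suc ?k"
      by (rule e1) (use end' u n in auto)
    have "\<bar>u ^ ?k * ?I\<bar> = \<bar>u ^ ?k * G hs (z + \<delta> *\<^sub>R b) - u ^ ?k * G hs z - u ^ ?k * (\<delta> * m)\<bar>"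
      by (simp add: algebra_simps)
    also have "\<dots> \<le> u ^ ?k * (\<delta> * (C' * u + \<omega>)) + 2 * (C * u ^ Suc ?k)" using 1 2 3 by linarith
    also have "\<dots> = u ^ ?k * ((2 * C + \<delta> * C') * u + \<delta> * \<omega>)" by (simp add: algebra_simps)
    finally show ?thesis using u by (simp add: abs_mult)
  qed
  have "(\<lambda>n. (2 * C + \<delta> * C') * ?u n + \<delta> * \<omega>) \<longlonglongrightarrow> (2 * C + \<delta> * C') * 0 + \<delta> * \<omega>"
    by (intro tendsto_intros u_lim)
  moreover have "\<forall>\<^sub>F n in sequentially. ?u n < r" using order_tendstoD(2)[OF u_lim r] .
  then have "\<forall>\<^sub>F n in sequentially. \<bar>?I\<bar> \<le> (2 * C + \<delta> * C') * ?u n + \<delta> * \<omega>"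
    by (rule eventually_mono) (rule main[OF refl])
  ultimately have "\<bar>?I\<bar> \<le> (2 * C + \<delta> * C') * 0 + \<delta> * \<omega>"
    using tendsto_lowerbound sequentially_bot by blast
  then show ?thesis by simp
qed

lemma expands_on_partials_on:
  fixes f :: "'a::euclidean_space \<Rightarrow> real"
  assumes E: "expands_on U f G" and U: "open U" and f: "continuous_on U f"
  shows "partials_on U G" and "x \<in> U \<Longrightarrow> G [] x = f x"
proof -
  note cont = expands_on_continuous[OF E U f]
  have der: "((\<lambda>t. G hs (x + t *\<^sub>R b)) has_real_derivative G (b # hs) x) (at 0)"
    if hs: "set hs \<subseteq> Basis" and b: "b \<in> Basis" and x: "x \<in> U" for hs b x
  proof -
    let ?k = "length hs"
    obtain r1 C1 where 1: "0 < r1" "0 < C1" "\<And>y hs u. norm (y - x) < r1 \<Longrightarrow> length hs = ?k \<Longrightarrow> set hs \<subseteq> Basis \<Longrightarrow>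
      0 < u \<Longrightarrow> u < r1 \<Longrightarrow> \<bar>mixed_diff f (map ((*\<^sub>R) u) hs) y - u ^ ?k * G hs y\<bar> \<le> C1 * u ^ Suc ?k"
      by (rule expands_onD[OF E x, of ?k]) blast
    obtain r2 C2 where 2: "0 < r2" "0 < C2" "\<And>y hs u. norm (y - x) < r2 \<Longrightarrow> length hs = Suc ?k \<Longrightarrow> set hs \<subseteq> Basis \<Longrightarrow>
      0 < u \<Longrightarrow> u < r2 \<Longrightarrow> \<bar>mixed_diff f (map ((*\<^sub>R) u) hs) y - u ^ Suc ?k * G hs y\<bar> \<le> C2 * u ^ Suc (Suc ?k)"
      by (rule expands_onD[OF E x, of "Suc ?k"]) blast
    define r where "r = min r1 r2"
    have r: "0 < r" "r \<le> r1" "r \<le> r2" using 1 2 by (auto simp: r_def)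
    have bh: "set (b # hs) \<subseteq> Basis" using hs b by simp
    have "isCont (G (b # hs)) x" using cont[OF bh] U x by (simp add: continuous_on_eq_continuous_at)
    show ?thesis
      unfolding has_field_derivative_def has_derivative_at_alt
    proof (intro conjI allI impI bounded_linear_mult_right)
      fix e :: real assume e: "0 < e"
      with \<open>isCont (G (b # hs)) x\<close> have "\<exists>d>0. \<forall>y. 0 < dist y x \<and> dist y x < d \<longrightarrow> dist (G (b # hs) y) (G (b # hs) x) < e"
        by (simp add: continuous_within Lim_at)
      then obtain d where d0: "0 < d" "\<And>y. 0 < dist y x \<Longrightarrow> dist y x < d \<Longrightarrow> dist (G (b # hs) y) (G (b # hs) x) < e"
        by blast
      have d: "\<bar>G (b # hs) y - G (b # hs) x\<bar> < e" if "dist y x < d" for y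
        using d0(2)[OF _ that] e d0(1) by (cases "y = x") (auto simp: dist_real_def)
      have nb: "norm b = 1" using b by simp
      have inc: "\<bar>G hs (z + \<delta> *\<^sub>R b) - G hs z - \<delta> * G (b # hs) x\<bar> \<le> \<delta> * e"
        if \<delta>: "0 < \<delta>" and z: "\<And>s. 0 \<le> s \<Longrightarrow> s \<le> \<delta> \<Longrightarrow> norm (z + s *\<^sub>R b - x) < min d r" for z \<delta>
      proof (rule expands_on_increment[where x=x and r=r and C=C1 and C'=C2])
        fix y u assume "norm (y - x) < r" "0 < u" "u < r"
        then show "\<bar>mixed_diff f (map ((*\<^sub>R) u) hs) y - u ^ ?k * G hs y\<bar> \<le> C1 * u ^ Suc ?k"
          "\<bar>mixed_diff f (map ((*\<^sub>R) u) (b # hs)) y - u ^ Suc ?k * G (b # hs) y\<bar> \<le> C2 * u ^ Suc (Suc ?k)"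
          using 1(3)[of y hs u] 2(3)[of y "b # hs" u] r hs bh by auto
      next
        fix s assume "0 \<le> s" "s \<le> \<delta>"
        then have "norm (z + s *\<^sub>R b - x) < min d r" by (rule z)
        then show "norm (z + s *\<^sub>R b - x) < r \<and> \<bar>G (b # hs) (z + s *\<^sub>R b) - G (b # hs) x\<bar> \<le> e"
          using d[of "z + s *\<^sub>R b"] by (auto simp: dist_norm less_imp_le)
      qed (use \<delta> r in auto)
      have "norm (G hs (x + t *\<^sub>R b) - G hs (x + 0 *\<^sub>R b) - G (b # hs) x * (t - 0)) \<le> e * norm (t - 0)"
        if t: "norm (t - 0) < min d r" for t
      proof -
        consider "t = 0" | "0 < t" | "t < 0" by linarith
        then show ?thesis
        proof cases
          case 2
          have "norm (x + s *\<^sub>R b - x) < min d r" if "0 \<le> s" "s \<le> t" for s using that t nb by auto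
          then have "\<bar>G hs (x + t *\<^sub>R b) - G hs x - t * G (b # hs) x\<bar> \<le> t * e" by (intro inc[OF 2])
          then show ?thesis using 2 by (simp add: mult.commute)
        next
          \<comment> \<open>For t < 0 the increment is taken forwards, from x + t b to x.\<close>
          case 3
          have "norm ((x + t *\<^sub>R b) + s *\<^sub>R b - x) < min d r" if "0 \<le> s" "s \<le> - t" for s
          proof -
            have "(x + t *\<^sub>R b) + s *\<^sub>R b - x = (t + s) *\<^sub>R b" by (simp add: algebra_simps)
            then show ?thesis using that t nb 3 by auto
          qed
          then have *: "\<bar>G hs ((x + t *\<^sub>R b) + (- t) *\<^sub>R b) - G hs (x + t *\<^sub>R b) - (- t) * G (b # hs) x\<bar> \<le> (- t) * e"
            using 3 by (intro inc) auto
          have "(x + t *\<^sub>R b) + (- t) *\<^sub>R b = x" by simp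
          with * have "\<bar>G hs x - G hs (x + t *\<^sub>R b) - (- t) * G (b # hs) x\<bar> \<le> (- t) * e" by (simp only:)
          then have "\<bar>G hs (x + t *\<^sub>R b) - G hs x - G (b # hs) x * t\<bar> \<le> e * \<bar>t\<bar>"
            using 3 by (simp add: abs_le_iff algebra_simps)
          then show ?thesis by simp
        qed simp
      qed
      then show "\<exists>d>0. \<forall>y. norm (y - 0) < d \<longrightarrow>
          norm (G hs (x + y *\<^sub>R b) - G hs (x + 0 *\<^sub>R b) - G (b # hs) x * (y - 0)) \<le> e * norm (y - 0)"
        using d0(1) r(1) by (intro exI[of _ "min d r"]) auto
    qed
  qed
  show "partials_on U G" using cont der by (simp add: partials_on_def)
  show "G [] x = f x" if x: "x \<in> U"
  proof -
    obtain r C where r: "0 < r" "0 < C" "\<And>y hs u. norm (y - x) < r \<Longrightarrow> length hs = 0 \<Longrightarrow> set hs \<subseteq> Basis \<Longrightarrow>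
      0 < u \<Longrightarrow> u < r \<Longrightarrow> \<bar>mixed_diff f (map ((*\<^sub>R) u) hs) y - u ^ 0 * G hs y\<bar> \<le> C * u ^ Suc 0"
      by (rule expands_onD[OF E x, of 0]) blast
    have "\<bar>f x - G [] x\<bar> \<le> C * u" if "0 < u" "u < r" for u using r(3)[of x "[]" u] that r by simp
    then have "\<forall>\<^sub>F u in at_right 0. \<bar>f x - G [] x\<bar> \<le> C * u"
      unfolding eventually_at_right_field using r(1) by blast
    moreover have "((\<lambda>u. C * u) \<longlongrightarrow> C * 0) (at_right 0)" by (intro tendsto_intros)
    ultimately have "\<bar>f x - G [] x\<bar> \<le> C * 0" using tendsto_lowerbound trivial_limit_at_right_real by blast
    then show ?thesis by simp
  qed
qed

lemma AinfM_interior_lines: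
  fixes X :: "'a::euclidean_space set" and f :: "'a \<Rightarrow> real"
  assumes f: "f \<in> AinfM M X" and M: "\<And>k. 0 < M k" and nq: "non_quasianalytic M" and x: "x \<in> interior X"
  shows "\<exists>B r. 0 < r \<and> (\<forall>y w. norm (y - x) < r \<longrightarrow> norm w \<le> 1/2 \<longrightarrow>
      (\<exists>D. derivs_on {-r<..<r} (\<lambda>u. f (y + u *\<^sub>R w)) D \<and> (\<forall>u. \<bar>u\<bar> < r \<longrightarrow> \<bar>D N u\<bar> \<le> B)))"
proof -
  obtain \<epsilon> where \<epsilon>: "0 < \<epsilon>" "ball x \<epsilon> \<subseteq> X" using x by (auto simp: mem_interior)
  have "\<exists>B r. 0 < r \<and> (\<forall>y w. y \<in> X \<longrightarrow> norm (y - x) < r \<longrightarrow> norm w \<le> 1 / 2 \<longrightarrow>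
    (\<exists>D. derivs_on {-r<..<r} (\<lambda>u. f (y + u\<^sup>2 *\<^sub>R 0 + u ^ 1 *\<^sub>R w)) D \<and> (\<forall>u. \<bar>u\<bar> < r \<longrightarrow> \<bar>D N u\<bar> \<le> B)))"
  proof (rule bounded_derivatives_along_cusps[OF f M nq])
    show "x \<in> X" using x interior_subset by blast
    fix y u assume y: "norm (y - x) < \<epsilon> / 2" and u: "\<bar>u\<bar> < \<epsilon> / 2"
    have "ball y \<bar>u\<bar> \<subseteq> ball x \<epsilon>"
    proof
      fix z assume "z \<in> ball y \<bar>u\<bar>"
      then show "z \<in> ball x \<epsilon>" using y u dist_triangle[of x z y] by (simp add: dist_norm norm_minus_commute)
    qed
    then show "ball (y + u\<^sup>2 *\<^sub>R 0) (1 * \<bar>u\<bar> ^ 1) \<subseteq> X" using \<epsilon> by auto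
  qed (use \<epsilon> in auto)
  then obtain B r where r: "0 < r" and B: "\<And>y w. y \<in> X \<Longrightarrow> norm (y - x) < r \<Longrightarrow> norm w \<le> 1 / 2 \<Longrightarrow>
    \<exists>D. derivs_on {-r<..<r} (\<lambda>u. f (y + u *\<^sub>R w)) D \<and> (\<forall>u. \<bar>u\<bar> < r \<longrightarrow> \<bar>D N u\<bar> \<le> B)"
    unfolding scaleR_zero_right add_0_right power_one_right by blast
  define s where "s = min r \<epsilon>"
  have s: "0 < s" "s \<le> r" "s \<le> \<epsilon>" using r \<epsilon> by (auto simp: s_def)
  have "\<exists>D. derivs_on {-s<..<s} (\<lambda>u. f (y + u *\<^sub>R w)) D \<and> (\<forall>u. \<bar>u\<bar> < s \<longrightarrow> \<bar>D N u\<bar> \<le> B)"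
    if y: "norm (y - x) < s" and w: "norm w \<le> 1/2" for y w
  proof -
    have "y \<in> X" using y s \<epsilon> by (auto simp: dist_norm norm_minus_commute subset_iff)
    from B[OF this _ w] y s obtain D where D: "derivs_on {-r<..<r} (\<lambda>u. f (y + u *\<^sub>R w)) D" "\<forall>u. \<bar>u\<bar> < r \<longrightarrow> \<bar>D N u\<bar> \<le> B"
      by auto
    have "derivs_on {-s<..<s} (\<lambda>u. f (y + u *\<^sub>R w)) D" using D(1) by (rule derivs_on_mono) (use s in auto)
    then show ?thesis using D(2) s by (intro exI[of _ D]) auto
  qed
  then show ?thesis using s by blast
qed

text \<open>The first derivatives along the lines through x are bounded by one constant for all
  directions, which gives a Lipschitz estimate at x.\<close>

lemma AinfM_continuous_on_interior:
  fixes X :: "'a::euclidean_space set" and f :: "'a \<Rightarrow> real"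
  assumes f: "f \<in> AinfM M X" and M: "\<And>k. 0 < M k" and nq: "non_quasianalytic M"
  shows "continuous_on (interior X) f"
proof (rule continuous_at_imp_continuous_on, rule ballI)
  fix x assume x: "x \<in> interior X"
  obtain B r where r: "0 < r" and B: "\<And>y w. norm (y - x) < r \<Longrightarrow> norm w \<le> 1/2 \<Longrightarrow>
      \<exists>D. derivs_on {-r<..<r} (\<lambda>u. f (y + u *\<^sub>R w)) D \<and> (\<forall>u. \<bar>u\<bar> < r \<longrightarrow> \<bar>D 1 u\<bar> \<le> B)"
    using AinfM_interior_lines[OF assms x, of 1] by blast
  have lip: "\<bar>f z - f x\<bar> \<le> B * (2 * norm (z - x))" if z: "z \<noteq> x" "norm (z - x) < r / 2" for z
  proof -
    define u where "u = 2 * norm (z - x)"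
    define w where "w = (1 / u) *\<^sub>R (z - x)"
    have u: "0 < u" "u < r" using z by (auto simp: u_def)
    have "norm w \<le> 1/2" using z by (simp add: w_def u_def)
    then obtain D where D: "derivs_on {-r<..<r} (\<lambda>u. f (x + u *\<^sub>R w)) D" "\<And>u. \<bar>u\<bar> < r \<Longrightarrow> \<bar>D 1 u\<bar> \<le> B"
      using B[of x w] r by auto
    have eq: "x + u *\<^sub>R w = z" using u by (simp add: w_def)
    obtain t where t: "\<bar>t\<bar> \<le> \<bar>u\<bar>" "f z = D 0 0 + D 1 t * u"
      using derivs_on_taylor[OF D(1), of u 1] u eq by auto
    have "D 0 0 = f x" using derivs_onD(1)[OF D(1), of 0] r by simp
    then have "\<bar>f z - f x\<bar> = \<bar>D 1 t\<bar> * u" using t u by (simp add: abs_mult)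
    also have "\<dots> \<le> B * u" using D(2)[of t] t u by (intro mult_right_mono) auto
    finally show ?thesis by (simp add: u_def)
  qed
  have "((\<lambda>z. f z - f x) \<longlongrightarrow> 0) (at x)"
  proof (rule Lim_null_comparison)
    show "\<forall>\<^sub>F z in at x. norm (f z - f x) \<le> B * (2 * norm (z - x))"
      unfolding eventually_at using r lip by (intro exI[of _ "r / 2"]) (auto simp: dist_norm)
    show "((\<lambda>z. B * (2 * norm (z - x))) \<longlongrightarrow> 0) (at x)"
      by (auto intro!: tendsto_eq_intros)
  qed
  then show "isCont f x" unfolding isCont_def by (rule LIM_zero_cancel)
qed

section \<open>Bounds for the partial derivatives near the boundary\<close>

text \<open>The mixed difference with steps \<kappa> u^q based at y + u^2 e is, up to higher order,
  \<open>\<kappa> ^ k * u ^ (q * k)\<close> times G hs y. The radius \<open>r1\<close> and the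
  constant \<open>C1\<close> of the expansion at y may degenerate as y approaches the boundary, but
  they enter only through the limit u \<rightarrow> 0; the bound for the derivative of order q k is
  uniform in y.\<close>

lemma partials_bounded_near_cusp:
  fixes X :: "'a::euclidean_space set" and f :: "'a \<Rightarrow> real"
  assumes f: "f \<in> AinfM M X" and M: "\<And>k. 0 < M k" and nq: "non_quasianalytic M"
    and E: "expands_on (interior X) f G"
    and x: "x \<in> X" and pos: "0 < c" "0 < h" "0 < \<epsilon>" "0 < q"
    and P: "\<And>y u. y \<in> X \<Longrightarrow> norm (y - x) < \<epsilon> \<Longrightarrow> u \<noteq> 0 \<Longrightarrow> \<bar>u\<bar> < h \<Longrightarrow>
      ball (y + u\<^sup>2 *\<^sub>R e) (c * \<bar>u\<bar> ^ q) \<subseteq> X"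
  shows "\<exists>B r. 0 < r \<and> (\<forall>y hs. y \<in> interior X \<longrightarrow> norm (y - x) < r \<longrightarrow> length hs = k \<longrightarrow> set hs \<subseteq> Basis \<longrightarrow> \<bar>G hs y\<bar> \<le> B)"
proof -
  have "\<exists>B r. 0 < r \<and> (\<forall>y w. y \<in> X \<longrightarrow> norm (y - x) < r \<longrightarrow> norm w \<le> c / 2 \<longrightarrow>
    (\<exists>D. derivs_on {-r<..<r} (\<lambda>u. f (y + u\<^sup>2 *\<^sub>R e + u ^ q *\<^sub>R w)) D \<and> (\<forall>u. \<bar>u\<bar> < r \<longrightarrow> \<bar>D (q * k) u\<bar> \<le> B)))"
    by (rule bounded_derivatives_along_cusps[OF f M nq x pos]) (rule P)
  then obtain B r where r: "0 < r" and B: "\<And>y w. y \<in> X \<Longrightarrow> norm (y - x) < r \<Longrightarrow> norm w \<le> c / 2 \<Longrightarrow>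
    \<exists>D. derivs_on {-r<..<r} (\<lambda>u. f (y + u\<^sup>2 *\<^sub>R e + u ^ q *\<^sub>R w)) D \<and> (\<forall>u. \<bar>u\<bar> < r \<longrightarrow> \<bar>D (q * k) u\<bar> \<le> B)"
    by blast
  \<comment> \<open>k steps of length \<kappa> have to fit into the admissible radius c / 2 of
    w.\<close>
  define \<kappa> where "\<kappa> = c / (2 * (real k + 1))"
  have \<kappa>: "0 < \<kappa>" "real k * \<kappa> \<le> c / 2" using pos by (auto simp: \<kappa>_def field_simps)
  have "\<bar>G hs y\<bar> \<le> 2 ^ k * B / \<kappa> ^ k"
    if y: "y \<in> interior X" "norm (y - x) < r" and hs: "length hs = k" "set hs \<subseteq> Basis" for y hs
  proof -
    have yX: "y \<in> X" using y interior_subset by blast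
    let ?hs = "map ((*\<^sub>R) \<kappa>) hs"
    have "map norm ?hs = map (\<lambda>_. \<kappa>) hs" using hs \<kappa> by (auto simp: subset_iff)
    then have sum: "(\<Sum>h\<leftarrow>?hs. norm h) = real k * \<kappa>" using hs by (simp add: sum_list_triv del: map_map)
    have "\<exists>D. derivs_on {-r<..<r} (\<lambda>u. mixed_diff f (map (\<lambda>h. u ^ q *\<^sub>R h) ?hs) (y + u\<^sup>2 *\<^sub>R e + u ^ q *\<^sub>R 0)) D \<and>
        (\<forall>u\<in>{-r<..<r}. \<bar>D (q * k) u\<bar> \<le> 2 ^ length ?hs * B)"
    proof (rule derivs_on_mixed_diff[where R="c / 2" and \<gamma>="\<lambda>u. y + u\<^sup>2 *\<^sub>R e"])
      fix w :: 'a assume "norm w \<le> c / 2"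
      from B[OF yX y(2) this] obtain D where D: "derivs_on {-r<..<r} (\<lambda>u. f (y + u\<^sup>2 *\<^sub>R e + u ^ q *\<^sub>R w)) D"
        "\<forall>u. \<bar>u\<bar> < r \<longrightarrow> \<bar>D (q * k) u\<bar> \<le> B" by blast
      have "\<bar>D (q * k) u\<bar> \<le> B" if "u \<in> {-r<..<r}" for u using D(2) that by (simp add: abs_less_iff)
      with D(1) show "\<exists>D. derivs_on {-r<..<r} (\<lambda>u. f (y + u\<^sup>2 *\<^sub>R e + u ^ q *\<^sub>R w)) D \<and>
          (\<forall>u\<in>{-r<..<r}. \<bar>D (q * k) u\<bar> \<le> B)" by blast
    qed (use sum \<kappa> in simp)
    then obtain D where D: "derivs_on {-r<..<r} (\<lambda>u. mixed_diff f (map (\<lambda>h. u ^ q *\<^sub>R h) ?hs) (y + u\<^sup>2 *\<^sub>R e)) D"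
      and D2: "\<forall>u\<in>{-r<..<r}. \<bar>D (q * k) u\<bar> \<le> 2 ^ k * B" using hs by (auto simp del: map_map)
    let ?\<psi> = "\<lambda>u. mixed_diff f (map (\<lambda>h. u ^ q *\<^sub>R h) ?hs) (y + u\<^sup>2 *\<^sub>R e)"
    obtain r1 C1 where r1: "0 < r1" "0 < C1" and exp: "\<And>z hs v. norm (z - y) < r1 \<Longrightarrow> length hs = k \<Longrightarrow> set hs \<subseteq> Basis \<Longrightarrow>
        0 < v \<Longrightarrow> v < r1 \<Longrightarrow> \<bar>mixed_diff f (map ((*\<^sub>R) v) hs) z - v ^ k * G hs z\<bar> \<le> C1 * v ^ Suc k"
      by (rule expands_onD[OF E y(1), of k]) blast
    have z_lim: "((\<lambda>u. y + u\<^sup>2 *\<^sub>R e) \<longlongrightarrow> y) (at_right (0::real))" by (auto intro!: tendsto_eq_intros)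
    have v_lim: "((\<lambda>u. \<kappa> * u ^ q) \<longlongrightarrow> 0) (at_right (0::real))" using pos by (auto intro!: tendsto_eq_intros)
    have cG: "isCont (G hs) y"
      using expands_on_continuous[OF E open_interior AinfM_continuous_on_interior[OF f M nq] hs(2)] y(1)
      by (simp add: continuous_on_eq_continuous_at)
    have "((\<lambda>u. ?\<psi> u / u ^ (q * k) - \<kappa> ^ k * G hs (y + u\<^sup>2 *\<^sub>R e)) \<longlongrightarrow> 0) (at_right 0)"
    proof (rule Lim_null_comparison)
      have ev1: "\<forall>\<^sub>F u in at_right (0::real). 0 < u" by (simp add: eventually_at_right_less)
      have ev2: "\<forall>\<^sub>F u in at_right (0::real). \<kappa> * u ^ q < r1" using order_tendstoD(2)[OF v_lim r1(1)] .
      have ev3: "\<forall>\<^sub>F u in at_right (0::real). norm (y + u\<^sup>2 *\<^sub>R e - y) < r1"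
        using tendstoD[OF z_lim r1(1)] by (simp add: dist_norm)
      show "\<forall>\<^sub>F u in at_right 0. norm (?\<psi> u / u ^ (q * k) - \<kappa> ^ k * G hs (y + u\<^sup>2 *\<^sub>R e)) \<le> \<kappa> ^ k * (C1 * (\<kappa> * u ^ q))"
        using ev1 ev2 ev3
      proof eventually_elim
        case (elim u)
        define v where "v = \<kappa> * u ^ q"
        have v: "0 < v" "v < r1" "v ^ k = \<kappa> ^ k * u ^ (q * k)" using elim \<kappa> by (auto simp: v_def power_mult_distrib power_mult)
        have maps: "map (\<lambda>h. u ^ q *\<^sub>R h) ?hs = map ((*\<^sub>R) v) hs" by (simp add: v_def mult.commute)
        let ?m = "mixed_diff f (map ((*\<^sub>R) v) hs) (y + u\<^sup>2 *\<^sub>R e)" and ?g = "G hs (y + u\<^sup>2 *\<^sub>R e)"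
        have "\<bar>?m - v ^ k * ?g\<bar> \<le> C1 * v ^ Suc k"
          by (rule exp[OF elim(3) hs v(1,2)])
        also have "C1 * v ^ Suc k = (\<kappa> ^ k * (C1 * v)) * u ^ (q * k)" by (simp add: v(3))
        finally have "\<bar>?m - v ^ k * ?g\<bar> / u ^ (q * k) \<le> \<kappa> ^ k * (C1 * v)"
          using elim(1) by (simp add: pos_divide_le_eq)
        moreover have "?m / u ^ (q * k) - \<kappa> ^ k * ?g = (?m - v ^ k * ?g) / u ^ (q * k)"
          using elim(1) by (simp add: v(3) diff_divide_distrib)
        ultimately show ?case unfolding maps using elim(1) by (simp add: v_def)
      qed
      have "((\<lambda>u. \<kappa> ^ k * (C1 * (\<kappa> * u ^ q))) \<longlongrightarrow> \<kappa> ^ k * (C1 * 0)) (at_right (0::real))"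
        by (intro tendsto_intros v_lim)
      then show "((\<lambda>u. \<kappa> ^ k * (C1 * (\<kappa> * u ^ q))) \<longlongrightarrow> 0) (at_right (0::real))" by simp
    qed
    moreover have "((\<lambda>u. \<kappa> ^ k * G hs (y + u\<^sup>2 *\<^sub>R e)) \<longlongrightarrow> \<kappa> ^ k * G hs y) (at_right 0)"
      by (intro tendsto_intros isCont_tendsto_compose[OF cG z_lim])
    ultimately have "((\<lambda>u. (?\<psi> u / u ^ (q * k) - \<kappa> ^ k * G hs (y + u\<^sup>2 *\<^sub>R e)) + \<kappa> ^ k * G hs (y + u\<^sup>2 *\<^sub>R e))
        \<longlongrightarrow> 0 + \<kappa> ^ k * G hs y) (at_right 0)" by (rule tendsto_add)
    then have lim: "((\<lambda>u. ?\<psi> u / u ^ (q * k)) \<longlongrightarrow> \<kappa> ^ k * G hs y) (at_right 0)" by simp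
    have "\<bar>\<kappa> ^ k * G hs y\<bar> \<le> 2 ^ k * B"
      by (rule leading_coeff_bound[OF D r _ lim]) (use D2 in \<open>simp add: abs_less_iff\<close>)
    then show ?thesis using \<kappa>(1) by (simp add: abs_mult pos_le_divide_eq mult.commute)
  qed
  then show ?thesis using r by blast
qed

section \<open>Uniformity on compact sets, and cusps as unions of balls along a ray\<close>

lemma bounded_on_compact_of_local:
  fixes X :: "'a::euclidean_space set"
  assumes loc: "\<And>x. x \<in> X \<Longrightarrow> \<exists>B r. 0 < r \<and> (\<forall>y hs. y \<in> U \<longrightarrow> norm (y - x) < r \<longrightarrow> Q hs \<longrightarrow> \<bar>G hs y\<bar> \<le> B)"
    and X: "closed X" and U: "U \<subseteq> X"
  shows "\<exists>B. \<forall>y hs. y \<in> U \<longrightarrow> norm (y - x0) \<le> R \<longrightarrow> Q hs \<longrightarrow> \<bar>G hs y\<bar> \<le> (B::real)"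
proof -
  obtain B r where r: "\<And>x. x \<in> X \<Longrightarrow> 0 < r x"
    and B: "\<And>x y hs. x \<in> X \<Longrightarrow> y \<in> U \<Longrightarrow> norm (y - x) < r x \<Longrightarrow> Q hs \<Longrightarrow> \<bar>G hs y\<bar> \<le> B x"
    using loc by metis
  have comp: "compact (X \<inter> cball x0 R)" using X by (intro closed_Int_compact compact_cball)
  have cover: "X \<inter> cball x0 R \<subseteq> (\<Union>x\<in>X \<inter> cball x0 R. ball x (r x))" using r by auto
  obtain D where D: "D \<subseteq> X \<inter> cball x0 R" "finite D" "X \<inter> cball x0 R \<subseteq> (\<Union>x\<in>D. ball x (r x))"
    by (rule compactE_image[OF comp _ cover]) auto
  have "\<bar>G hs y\<bar> \<le> (\<Sum>x\<in>D. \<bar>B x\<bar>)" if y: "y \<in> U" "norm (y - x0) \<le> R" "Q hs" for y hs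
  proof -
    have "y \<in> X \<inter> cball x0 R" using y U by (auto simp: dist_norm norm_minus_commute)
    then obtain x where x: "x \<in> D" "y \<in> ball x (r x)" using D(3) by blast
    then have "\<bar>G hs y\<bar> \<le> B x" using D(1) y by (intro B) (auto simp: dist_norm norm_minus_commute)
    also have "\<dots> \<le> \<bar>B x\<bar>" by simp
    also have "\<dots> \<le> (\<Sum>x\<in>D. \<bar>B x\<bar>)" using x D(2) by (intro member_le_sum) auto
    finally show ?thesis .
  qed
  then show ?thesis by blast
qed

text \<open>The cusp has width of order s^(1/\<alpha>) at height s, so it contains balls of radius c
  s^p about the points of its axis when p \<alpha> \<ge> 1 and s is small. Rounding 1/\<alpha> up to
  an integer makes the arcs polynomial in u.\<close>

lemma hoelder_set_cusp:
  fixes X :: "'a::euclidean_space set"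
  assumes X: "hoelder_set X" and x: "x \<in> X" "x \<notin> interior X"
  obtains e p c h \<epsilon> where "0 < c" "0 < h" "0 < \<epsilon>" "0 < (p::nat)"
    "\<And>y s. y \<in> X \<Longrightarrow> norm (y - x) < \<epsilon> \<Longrightarrow> 0 < s \<Longrightarrow> s < h \<Longrightarrow> ball (y + s *\<^sub>R e) (c * s ^ p) \<subseteq> X"
proof -
  obtain \<alpha> where \<alpha>: "0 < \<alpha>" "\<alpha> \<le> 1" "alpha_set \<alpha> X" using X by (auto simp: hoelder_set_def)
  have cl: "X = closure (interior X)" using \<alpha>(3) unfolding alpha_set_def fat_def by (elim conjE)
  have u: "uniform_cusp_property \<alpha> (interior X)" using \<alpha>(3) unfolding alpha_set_def by (elim conjE)
  have clD: "y \<in> closure (interior X)" if "y \<in> X" for y using that cl by blast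
  have "x \<in> frontier (interior X)" using clD[OF x(1)] x(2) by (simp add: frontier_def)
  then obtain \<epsilon> r h and A :: "'a \<Rightarrow> 'a" where pos: "0 < \<epsilon>" "0 < r" "0 < h" and A: "orthogonal_transformation A"
    and sub: "\<And>y. y \<in> closure (interior X) \<inter> ball x \<epsilon> \<Longrightarrow> (\<lambda>z. y + A z) ` (cusp \<alpha> r h :: 'a set) \<subseteq> interior X"
    using u[unfolded uniform_cusp_property_def, rule_format] by metis
  define p where "p = nat \<lceil>1 / \<alpha>\<rceil>"
  have p: "1 \<le> real p * \<alpha>" "0 < p"
  proof -
    have "1 / \<alpha> \<le> real p" unfolding p_def by linarith
    then show "1 \<le> real p * \<alpha>" using \<alpha>(1) by (simp add: pos_divide_le_eq)
    then show "0 < p" by (cases p) auto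
  qed
  \<comment> \<open>c \<le> r keeps the ball within the width of the cusp, c \<le> 1/2 keeps its
    heights above s / 2, and the power of 1 / (2 h) keeps the profile of the cusp at most s / 2
    there.\<close>
  define c where "c = min (1/2) (r * min 1 ((1 / (2 * h)) powr (1 / \<alpha>)))"
  have c: "0 < c" "c \<le> 1/2" "c \<le> r"
  proof -
    have m: "0 < min 1 ((1 / (2 * h)) powr (1 / \<alpha>))" "min 1 ((1 / (2 * h)) powr (1 / \<alpha>)) \<le> 1" using pos by auto
    then have "r * min 1 ((1 / (2 * h)) powr (1 / \<alpha>)) \<le> r * 1" using pos by (intro mult_left_mono) auto
    then show "c \<le> r" unfolding c_def by linarith
    show "0 < c" "c \<le> 1/2" using m pos by (simp_all add: c_def)
  qed
  have c4: "h * (c / r) powr \<alpha> \<le> 1/2"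
  proof -
    have "c \<le> r * ((1 / (2 * h)) powr (1 / \<alpha>))"
    proof -
      have "c \<le> r * min 1 ((1 / (2 * h)) powr (1 / \<alpha>))" by (simp add: c_def)
      also have "\<dots> \<le> r * ((1 / (2 * h)) powr (1 / \<alpha>))" using pos by (intro mult_left_mono) auto
      finally show ?thesis .
    qed
    then have "c / r \<le> (1 / (2 * h)) powr (1 / \<alpha>)" using pos by (simp add: field_simps)
    then have "(c / r) powr \<alpha> \<le> ((1 / (2 * h)) powr (1 / \<alpha>)) powr \<alpha>" using pos c \<alpha> by (intro powr_mono2) auto
    also have "\<dots> = 1 / (2 * h)" using \<alpha> pos by (simp add: powr_powr)
    finally show ?thesis using pos by (simp add: field_simps)
  qed
  define e where "e = A e_last"
  have en: "norm (e_last :: 'a) = 1"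
    using some_in_eq[of "Basis :: 'a set"] by (simp add: e_last_def)
  have "ball (y + s *\<^sub>R e) (c * s ^ p) \<subseteq> X"
    if y: "y \<in> X" "norm (y - x) < \<epsilon>" and s: "0 < s" "s < min 1 (h / 2)" for y s
  proof
    fix w assume "w \<in> ball (y + s *\<^sub>R e) (c * s ^ p)"
    then have w: "norm (w - (y + s *\<^sub>R e)) < c * s ^ p" by (simp add: dist_norm norm_minus_commute)
    define \<rho> where "\<rho> = c * s ^ p"
    have \<rho>: "0 < \<rho>" "\<rho> \<le> c" "\<rho> \<le> s / 2"
    proof -
      show "0 < \<rho>" using c s by (simp add: \<rho>_def)
      have "s ^ p \<le> 1" "s ^ p \<le> s" using s p(2) power_decreasing[of 1 p s] by (auto intro: power_le_one)
      then show "\<rho> \<le> c" "\<rho> \<le> s / 2" using c s mult_left_mono[of "s ^ p" 1 c] mult_mono[of c "1/2" "s ^ p" s]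
        by (auto simp: \<rho>_def)
    qed
    have surjA: "\<exists>v. A v = w - (y + s *\<^sub>R e)" using orthogonal_transformation_surj[OF A] by (metis surjD)
    then obtain v where v: "A v = w - (y + s *\<^sub>R e)" by blast
    have nv: "norm v < \<rho>" using w v orthogonal_transformation_norm[OF A, of v] by (simp add: \<rho>_def)
    define z where "z = s *\<^sub>R e_last + v"
    have "A z = s *\<^sub>R e + A v"
      using A by (simp add: z_def e_def orthogonal_transformation_def linear_add linear_scale)
    then have wz: "w = y + A z" using v by simp
    let ?t = "v \<bullet> e_last"
    have t: "\<bar>?t\<bar> \<le> norm v" using Cauchy_Schwarz_ineq2[of v "e_last :: 'a"] en by simp
    have ze: "z \<bullet> e_last = s + ?t"
      using en by (simp add: z_def inner_add_left dot_square_norm)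
    have z': "z - (z \<bullet> e_last) *\<^sub>R e_last = v - ?t *\<^sub>R e_last" by (simp add: ze) (simp add: z_def algebra_simps)
    have ee: "(e_last :: 'a) \<bullet> e_last = 1" using en by (simp add: dot_square_norm)
    have "(v - ?t *\<^sub>R e_last) \<bullet> (v - ?t *\<^sub>R e_last) = v \<bullet> v - ?t * ?t"
      using ee by (simp add: inner_diff_left inner_diff_right inner_commute[of "e_last :: 'a" v])
    then have "(norm (v - ?t *\<^sub>R e_last))\<^sup>2 \<le> (norm v)\<^sup>2" by (simp add: power2_norm_eq_inner)
    then have "norm (v - ?t *\<^sub>R e_last) \<le> norm v" by (rule power2_le_imp_le) simp
    then have nz: "norm (z - (z \<bullet> e_last) *\<^sub>R e_last) < \<rho>" using nv z' by simp
    have "h * (norm (z - (z \<bullet> e_last) *\<^sub>R e_last) / r) powr \<alpha> \<le> h * (\<rho> / r) powr \<alpha>"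
      using nz pos \<alpha> by (intro mult_left_mono powr_mono2 divide_right_mono) auto
    also have "\<dots> = h * (c / r) powr \<alpha> * s powr (real p * \<alpha>)"
    proof -
      have "\<rho> / r = (c / r) * s ^ p" by (simp add: \<rho>_def)
      then have "(\<rho> / r) powr \<alpha> = (c / r) powr \<alpha> * (s ^ p) powr \<alpha>"
        using c s pos by (simp only: powr_mult)
      also have "(s ^ p) powr \<alpha> = s powr (real p * \<alpha>)"
        using s by (simp only: powr_realpow[symmetric] powr_powr)
      finally show ?thesis by simp
    qed
    also have "\<dots> \<le> 1/2 * s powr 1"
      using c4 p s pos by (intro mult_mono powr_mono') auto
    also have "\<dots> < z \<bullet> e_last" using t nv \<rho> s ze by simp
    finally have 1: "h * (norm (z - (z \<bullet> e_last) *\<^sub>R e_last) / r) powr \<alpha> < z \<bullet> e_last" .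
    have "s < h / 2" using s by simp
    then have 2: "z \<bullet> e_last < h" unfolding ze using t nv \<rho> by linarith
    have "z \<in> cusp \<alpha> r h" using nz \<rho> c 1 2 by (simp add: cusp_def)
    moreover have "y \<in> closure (interior X) \<inter> ball x \<epsilon>" using y clD by (simp add: dist_norm norm_minus_commute)
    ultimately show "w \<in> X" using sub[of y] wz interior_subset by blast
  qed
  then show thesis using that[of c "min 1 (h / 2)" \<epsilon> p e] c pos p by auto
qed

section \<open>Families of partial derivatives\<close>

lemma partials_onI:
  assumes "\<And>bs. set bs \<subseteq> Basis \<Longrightarrow> continuous_on U (D bs)"
    and "\<And>bs b x. set bs \<subseteq> Basis \<Longrightarrow> b \<in> Basis \<Longrightarrow> x \<in> U \<Longrightarrow>
      ((\<lambda>t. D bs (x + t *\<^sub>R b)) has_real_derivative D (b # bs) x) (at 0)"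
  shows "partials_on U D"
  using assms by (simp add: partials_on_def)

lemma partials_onD:
  assumes "partials_on U D" "set bs \<subseteq> Basis"
  shows "continuous_on U (D bs)"
    and "b \<in> Basis \<Longrightarrow> x \<in> U \<Longrightarrow> ((\<lambda>t. D bs (x + t *\<^sub>R b)) has_real_derivative D (b # bs) x) (at 0)"
    and "b \<in> Basis \<Longrightarrow> x + s *\<^sub>R b \<in> U \<Longrightarrow> ((\<lambda>t. D bs (x + t *\<^sub>R b)) has_real_derivative D (b # bs) (x + s *\<^sub>R b)) (at s)"
proof -
  show "continuous_on U (D bs)" using assms by (simp add: partials_on_def)
  show *: "((\<lambda>t. D bs (x + t *\<^sub>R b)) has_real_derivative D (b # bs) x) (at 0)" if "b \<in> Basis" "x \<in> U" for b x
    using assms that by (simp add: partials_on_def)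
  show "((\<lambda>t. D bs (x + t *\<^sub>R b)) has_real_derivative D (b # bs) (x + s *\<^sub>R b)) (at s)"
    if "b \<in> Basis" "x + s *\<^sub>R b \<in> U"
  proof -
    have "((\<lambda>t. D bs (x + s *\<^sub>R b + t *\<^sub>R b)) has_real_derivative D (b # bs) (x + s *\<^sub>R b)) (at 0)"
      using that by (rule *)
    moreover have "(\<lambda>t. D bs (x + s *\<^sub>R b + t *\<^sub>R b)) = (\<lambda>t. (\<lambda>t. D bs (x + t *\<^sub>R b)) (t + s))"
      by (simp add: algebra_simps)
    ultimately show ?thesis using DERIV_shift[of "\<lambda>t. D bs (x + t *\<^sub>R b)" _ 0 s] by simp
  qed
qed

lemma partials_on_subset: "partials_on U D \<Longrightarrow> V \<subseteq> U \<Longrightarrow> partials_on V D"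
  unfolding partials_on_def using continuous_on_subset by blast

lemma partials_on_translate:
  assumes "partials_on V D" "\<And>x. x \<in> U \<Longrightarrow> x + v \<in> V"
  shows "partials_on U (\<lambda>bs x. D bs (x + v))"
proof (rule partials_onI)
  fix bs :: "'a list" assume bs: "set bs \<subseteq> Basis"
  show "continuous_on U (\<lambda>x. D bs (x + v))"
    by (rule continuous_on_compose2[OF partials_onD(1)[OF assms(1) bs]]) (use assms(2) in \<open>auto intro!: continuous_intros\<close>)
  fix b x :: 'a assume "b \<in> Basis" "x \<in> U"
  then show "((\<lambda>t. D bs (x + t *\<^sub>R b + v)) has_real_derivative D (b # bs) (x + v)) (at 0)"
    using partials_onD(2)[OF assms(1) bs, of b "x + v"] assms(2)[of x] by (simp add: add_ac)
qed

lemma partials_on_lincomb: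
  assumes "\<And>i. i \<in> I \<Longrightarrow> partials_on U (D i)"
  shows "partials_on U (\<lambda>bs x. \<Sum>i\<in>I. c i * D i bs x)"
  by (intro partials_onI continuous_on_sum continuous_on_mult continuous_on_const partials_onD(1)[OF assms] DERIV_sum DERIV_cmult partials_onD(2)[OF assms])

lemma partials_on_diff:
  assumes "partials_on U D" "partials_on U E"
  shows "partials_on U (\<lambda>bs x. D bs x - E bs x)"
  by (intro partials_onI continuous_on_diff partials_onD(1)[OF assms(1)] partials_onD(1)[OF assms(2)] DERIV_diff
      partials_onD(2)[OF assms(1)] partials_onD(2)[OF assms(2)])

text \<open>All distributions of the directions over two factors. The order is kept within each
  factor because derivatives are indexed by lists.\<close>

fun splits :: "'b list \<Rightarrow> ('b list \<times> 'b list) list" where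
  "splits [] = [([], [])]"
| "splits (b # bs) = map (\<lambda>s. (b # fst s, snd s)) (splits bs) @ map (\<lambda>s. (fst s, b # snd s)) (splits bs)"

lemma splits_props:
  "s \<in> set (splits bs) \<Longrightarrow> set (fst s) \<subseteq> set bs \<and> set (snd s) \<subseteq> set bs \<and> length (fst s) + length (snd s) = length bs"
proof (induction bs arbitrary: s)
  case (Cons b bs)
  then obtain s' where "s' \<in> set (splits bs)" "s = (b # fst s', snd s') \<or> s = (fst s', b # snd s')" by auto
  with Cons.IH[of s'] show ?case by auto
qed simp

lemma length_splits: "length (splits bs) = 2 ^ length bs"
  by (induction bs) auto

definition leibniz :: "('a list \<Rightarrow> 'a \<Rightarrow> real) \<Rightarrow> ('a list \<Rightarrow> 'a \<Rightarrow> real) \<Rightarrow> 'a list \<Rightarrow> 'a \<Rightarrow> real" where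
  "leibniz D E bs x = (\<Sum>s\<leftarrow>splits bs. D (fst s) x * E (snd s) x)"

lemma leibniz_Nil: "leibniz D E [] x = D [] x * E [] x"
  by (simp add: leibniz_def)

lemma DERIV_sum_list:
  "(\<And>a. a \<in> set L \<Longrightarrow> (f a has_real_derivative f' a) (at x)) \<Longrightarrow>
    ((\<lambda>t. \<Sum>a\<leftarrow>L. f a t) has_real_derivative (\<Sum>a\<leftarrow>L. f' a)) (at x)"
  by (induction L) (auto intro!: derivative_eq_intros)

lemma continuous_on_sum_list:
  fixes f :: "'b \<Rightarrow> 'a::topological_space \<Rightarrow> real"
  shows "(\<And>a. a \<in> set L \<Longrightarrow> continuous_on U (f a)) \<Longrightarrow> continuous_on U (\<lambda>t. \<Sum>a\<leftarrow>L. f a t)"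
  by (induction L) (auto intro!: continuous_intros)

lemma partials_on_leibniz:
  assumes D: "partials_on U D" and E: "partials_on U E"
  shows "partials_on U (leibniz D E)"
proof (rule partials_onI)
  fix bs :: "'a list" assume bs: "set bs \<subseteq> Basis"
  have sub: "set (fst s) \<subseteq> Basis" "set (snd s) \<subseteq> Basis" if "s \<in> set (splits bs)" for s
    using splits_props[OF that] bs by auto
  show "continuous_on U (leibniz D E bs)"
    unfolding leibniz_def[abs_def]
    by (intro continuous_on_sum_list continuous_on_mult partials_onD(1)[OF D] partials_onD(1)[OF E] sub)
  fix b x :: 'a assume b: "b \<in> Basis" and x: "x \<in> U"
  have eq: "leibniz D E (b # bs) x = (\<Sum>s\<leftarrow>splits bs. D (b # fst s) x * E (snd s) x + E (b # snd s) x * D (fst s) x)"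
    by (simp add: leibniz_def comp_def sum_list_addf mult.commute)
  show "((\<lambda>t. leibniz D E bs (x + t *\<^sub>R b)) has_real_derivative leibniz D E (b # bs) x) (at 0)"
    unfolding eq unfolding leibniz_def
  proof (rule DERIV_sum_list)
    fix s assume "s \<in> set (splits bs)"
    note s = sub[OF this]
    show "((\<lambda>t. D (fst s) (x + t *\<^sub>R b) * E (snd s) (x + t *\<^sub>R b)) has_real_derivative
        D (b # fst s) x * E (snd s) x + E (b # snd s) x * D (fst s) x) (at 0)"
      using DERIV_mult'[OF partials_onD(2)[OF D s(1) b x] partials_onD(2)[OF E s(2) b x]] by (simp add: algebra_simps)
  qed
qed

lemma leibniz_bound:
  assumes "\<And>s. s \<in> set (splits bs) \<Longrightarrow> \<bar>D (fst s) x * E (snd s) x\<bar> \<le> A"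
  shows "\<bar>leibniz D E bs x\<bar> \<le> 2 ^ length bs * A"
proof -
  have "\<bar>\<Sum>s\<leftarrow>L. f s\<bar> \<le> real (length L) * A" if "\<And>s. s \<in> set L \<Longrightarrow> \<bar>f s\<bar> \<le> A" for L :: "('a list \<times> 'a list) list" and f
    using that
  proof (induction L)
    case (Cons a L)
    then have "\<bar>f a\<bar> \<le> A" "\<bar>\<Sum>s\<leftarrow>L. f s\<bar> \<le> real (length L) * A" by auto
    then show ?case by (simp add: algebra_simps)
  qed simp
  from this[of "splits bs" "\<lambda>s. D (fst s) x * E (snd s) x"] show ?thesis
    using assms by (simp add: leibniz_def length_splits)
qed

text \<open>The bounds are asked for large k, from an index that may depend on bs: in the extension
  the k-th term is small in its derivatives of order l once the orders \<open>m k\<close> have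
  outgrown p l.\<close>

lemma partials_on_series:
  fixes T :: "nat \<Rightarrow> 'a::euclidean_space list \<Rightarrow> 'a \<Rightarrow> real"
  assumes U: "open U" and T: "\<And>k. partials_on U (T k)"
    and b: "\<And>bs. set bs \<subseteq> Basis \<Longrightarrow> \<exists>a. summable a \<and> (\<forall>\<^sub>F k in sequentially. \<forall>x\<in>U. \<bar>T k bs x\<bar> \<le> a k)"
  shows "partials_on U (\<lambda>bs x. \<Sum>k. T k bs x)"
proof (rule partials_onI)
  fix bs :: "'a list" assume bs: "set bs \<subseteq> Basis"
  obtain a where a: "summable a" "\<forall>\<^sub>F k in sequentially. \<forall>x\<in>U. \<bar>T k bs x\<bar> \<le> a k" using b[OF bs] by blast
  have "uniform_limit U (\<lambda>n x. \<Sum>i<n. T i bs x) (\<lambda>x. \<Sum>i. T i bs x) sequentially"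
    by (rule Weierstrass_m_test_ev) (use a in auto)
  then show "continuous_on U (\<lambda>x. \<Sum>k. T k bs x)"
    by (rule uniform_limit_theorem[rotated]) (auto intro!: always_eventually continuous_on_sum partials_onD(1)[OF T bs])
  fix d x :: 'a assume d: "d \<in> Basis" and x: "x \<in> U"
  obtain \<delta> where \<delta>: "0 < \<delta>" "ball x \<delta> \<subseteq> U" using U x open_contains_ball by blast
  have inU: "x + t *\<^sub>R d \<in> U" if "t \<in> ball 0 \<delta>" for t :: real
  proof -
    have "norm (t *\<^sub>R d) < \<delta>" using that d by (simp add: dist_norm)
    then show ?thesis using \<delta>(2) by (auto simp: dist_norm subset_iff)
  qed
  have dbs: "set (d # bs) \<subseteq> Basis" using d bs by simp
  obtain a' where a': "summable a'" "\<forall>\<^sub>F k in sequentially. \<forall>x\<in>U. \<bar>T k (d # bs) x\<bar> \<le> a' k" using b[OF dbs] by blast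
  have "((\<lambda>t. \<Sum>k. T k bs (x + t *\<^sub>R d)) has_real_derivative (\<Sum>k. T k (d # bs) (x + 0 *\<^sub>R d))) (at 0)"
  proof (rule has_field_derivative_series'(2)[where S="ball 0 \<delta>" and ?x0.0=0])
    show "((\<lambda>t. T n bs (x + t *\<^sub>R d)) has_real_derivative T n (d # bs) (x + t *\<^sub>R d)) (at t within ball 0 \<delta>)"
      if "t \<in> ball 0 \<delta>" for n t
      using partials_onD(3)[OF T bs d inU[OF that]] by (rule has_field_derivative_at_within)
    show "uniformly_convergent_on (ball 0 \<delta>) (\<lambda>n t. \<Sum>i<n. T i (d # bs) (x + t *\<^sub>R d))"
      by (rule Weierstrass_m_test'_ev[OF _ a'(1)]) (use a'(2) inU in \<open>auto elim!: eventually_mono\<close>)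
    show "summable (\<lambda>n. T n bs (x + 0 *\<^sub>R d))"
      by (rule summable_comparison_test_ev[OF _ a(1)]) (use a(2) x in \<open>auto elim!: eventually_mono\<close>)
  qed (use \<delta> in auto)
  then show "((\<lambda>t. \<Sum>k. T k bs (x + t *\<^sub>R d)) has_real_derivative (\<Sum>k. T k (d # bs) x)) (at 0)" by simp
qed

section \<open>Total derivative and derivatives along a ray\<close>

lemma partials_on_has_derivative:
  fixes x :: "'a::euclidean_space"
  assumes U: "open U" and D: "partials_on U D" and bs: "set bs \<subseteq> Basis" and x: "x \<in> U"
  shows "(D bs has_derivative (\<lambda>v. \<Sum>b\<in>Basis. (v \<bullet> b) * D (b # bs) x)) (at x)"
  unfolding has_derivative_at_alt
proof (intro conjI allI impI)
  show "bounded_linear (\<lambda>v. \<Sum>b\<in>Basis. (v \<bullet> b) * D (b # bs) x)"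
    by (rule bounded_linear_sum, rule bounded_linear_compose[OF bounded_linear_mult_left bounded_linear_inner_left])
  fix e :: real assume e: "0 < e"
  define \<omega> where "\<omega> = e / real DIM('a)"
  have \<omega>: "0 < \<omega>" using e by (simp add: \<omega>_def)
  have "\<forall>\<^sub>F z in nhds x. \<forall>b\<in>Basis. z \<in> U \<and> dist (D (b # bs) z) (D (b # bs) x) < \<omega>"
  proof (rule eventually_ball_finite, simp, intro ballI eventually_conj)
    fix b :: 'a assume "b \<in> Basis"
    then have "isCont (D (b # bs)) x"
      using partials_onD(1)[OF D, of "b # bs"] bs U x by (simp add: continuous_on_eq_continuous_at)
    then have "(D (b # bs) \<longlongrightarrow> D (b # bs) x) (nhds x)" by (simp add: isCont_def tendsto_nhds_iff)
    then show "\<forall>\<^sub>F z in nhds x. dist (D (b # bs) z) (D (b # bs) x) < \<omega>" using tendstoD \<omega> by blast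
    show "\<forall>\<^sub>F z in nhds x. z \<in> U" using U x eventually_nhds_in_open by blast
  qed
  then obtain d where d: "0 < d"
    and d': "\<forall>z. dist z x < d \<longrightarrow> (\<forall>b\<in>Basis. z \<in> U \<and> dist (D (b # bs) z) (D (b # bs) x) < \<omega>)"
    unfolding eventually_nhds_metric by blast
  have dU: "z \<in> U" "\<bar>D (b # bs) z - D (b # bs) x\<bar> \<le> \<omega>" if "dist z x < d" "b \<in> Basis" for z b
    using d' that by (auto simp: dist_real_def less_imp_le)
  have step: "\<bar>D bs (x + (\<Sum>b\<in>S. (v \<bullet> b) *\<^sub>R b)) - D bs x - (\<Sum>b\<in>S. (v \<bullet> b) * D (b # bs) x)\<bar> \<le> \<omega> * (\<Sum>b\<in>S. \<bar>v \<bullet> b\<bar>)"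
    if v: "norm v < d" and S: "S \<subseteq> Basis" for v S
    using finite_subset[OF S finite_Basis] S
  proof (induction S rule: finite_induct)
    case (insert b S)
    let ?w = "\<Sum>b\<in>S. (v \<bullet> b) *\<^sub>R b"
    define a where "a = v \<bullet> b"
    have b: "b \<in> Basis" using insert.prems by simp
    have near: "dist (x + ?w + t *\<^sub>R b) x < d" if "t \<in> closed_segment 0 a" for t
    proof -
      have "\<bar>t\<bar> \<le> \<bar>a\<bar>" using that by (auto simp: closed_segment_eq_real_ivl split: if_splits)
      \<comment> \<open>Every coordinate stays at most that of v in absolute value, so the whole
        path from x to x + v parallel to the axes remains close to x.\<close>
      have "norm (?w + t *\<^sub>R b) \<le> norm v"
      proof (rule norm_le_componentwise)
        fix i :: 'a assume i: "i \<in> Basis"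
        have "?w \<bullet> i = (\<Sum>c\<in>S. if c = i then v \<bullet> i else 0)"
          unfolding inner_sum_left using i insert.prems by (intro sum.cong) (auto simp: inner_Basis subset_iff)
        also have "\<dots> = (if i \<in> S then v \<bullet> i else 0)" using insert.hyps by simp
        finally show "\<bar>(?w + t *\<^sub>R b) \<bullet> i\<bar> \<le> \<bar>v \<bullet> i\<bar>"
          using insert.hyps i b \<open>\<bar>t\<bar> \<le> \<bar>a\<bar>\<close> by (auto simp: inner_add_left inner_Basis a_def)
      qed
      then show ?thesis using v by (simp add: dist_norm add.assoc)
    qed
    have "norm ((D bs (x + ?w + a *\<^sub>R b) - a * D (b # bs) x) - (D bs (x + ?w + 0 *\<^sub>R b) - 0 * D (b # bs) x)) \<le> \<omega> * norm (a - 0)"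
    proof (rule field_differentiable_bound[where S="closed_segment 0 a"])
      fix t assume t: "t \<in> closed_segment 0 a"
      have m: "((\<lambda>t. t * D (b # bs) x) has_real_derivative D (b # bs) x) (at t)" by (auto intro!: derivative_eq_intros)
      have "((\<lambda>t. D bs (x + ?w + t *\<^sub>R b)) has_real_derivative D (b # bs) (x + ?w + t *\<^sub>R b)) (at t)"
        by (rule partials_onD(3)[OF D bs b dU(1)[OF near[OF t] b]])
      from DERIV_diff[OF this m] show "((\<lambda>t. D bs (x + ?w + t *\<^sub>R b) - t * D (b # bs) x) has_real_derivative
          D (b # bs) (x + ?w + t *\<^sub>R b) - D (b # bs) x) (at t within closed_segment 0 a)"
        by (rule has_field_derivative_at_within)
      show "norm (D (b # bs) (x + ?w + t *\<^sub>R b) - D (b # bs) x) \<le> \<omega>"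
        using dU(2)[OF near[OF t] b] by simp
    qed (use convex_closed_segment ends_in_segment in auto)
    then have "\<bar>D bs (x + ?w + a *\<^sub>R b) - D bs (x + ?w) - a * D (b # bs) x\<bar> \<le> \<omega> * \<bar>a\<bar>"
      by (simp add: algebra_simps)
    moreover have "\<bar>D bs (x + ?w) - D bs x - (\<Sum>b\<in>S. (v \<bullet> b) * D (b # bs) x)\<bar> \<le> \<omega> * (\<Sum>b\<in>S. \<bar>v \<bullet> b\<bar>)"
      using insert by simp
    moreover have "x + (\<Sum>b\<in>insert b S. (v \<bullet> b) *\<^sub>R b) = x + ?w + a *\<^sub>R b"
      using insert.hyps by (simp add: a_def algebra_simps)
    moreover have "(\<Sum>b\<in>insert b S. (v \<bullet> b) * D (b # bs) x) = a * D (b # bs) x + (\<Sum>b\<in>S. (v \<bullet> b) * D (b # bs) x)"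
      "(\<Sum>b\<in>insert b S. \<bar>v \<bullet> b\<bar>) = \<bar>a\<bar> + (\<Sum>b\<in>S. \<bar>v \<bullet> b\<bar>)" using insert.hyps by (simp_all add: a_def)
    ultimately show ?case by (simp only: distrib_left)
  qed simp
  show "\<exists>d>0. \<forall>y. norm (y - x) < d \<longrightarrow> norm (D bs y - D bs x - (\<Sum>b\<in>Basis. ((y - x) \<bullet> b) * D (b # bs) x)) \<le> e * norm (y - x)"
  proof (intro exI[of _ d] conjI allI impI d)
    fix y assume y: "norm (y - x) < d"
    have "\<bar>D bs (x + (\<Sum>b\<in>Basis. ((y - x) \<bullet> b) *\<^sub>R b)) - D bs x - (\<Sum>b\<in>Basis. ((y - x) \<bullet> b) * D (b # bs) x)\<bar>
        \<le> \<omega> * (\<Sum>b\<in>Basis. \<bar>(y - x) \<bullet> b\<bar>)"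
      using step[OF y] by blast
    also have "\<dots> \<le> \<omega> * (\<Sum>b\<in>(Basis::'a set). norm (y - x))"
      using \<omega> by (intro mult_left_mono sum_mono Basis_le_norm) auto
    also have "\<dots> = e * norm (y - x)" by (simp add: \<omega>_def)
    finally show "norm (D bs y - D bs x - (\<Sum>b\<in>Basis. ((y - x) \<bullet> b) * D (b # bs) x)) \<le> e * norm (y - x)"
      by (simp add: euclidean_representation)
  qed
qed

text \<open>e is in general no basis vector, so iterated derivatives along e are combined from
  partial ones; bs records the partial derivative that is differentiated.\<close>

fun line_deriv :: "'a::euclidean_space \<Rightarrow> ('a list \<Rightarrow> 'a \<Rightarrow> real) \<Rightarrow> nat \<Rightarrow> 'a list \<Rightarrow> 'a \<Rightarrow> real" where
  "line_deriv e D 0 bs x = D bs x"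
| "line_deriv e D (Suc j) bs x = (\<Sum>b\<in>Basis. (e \<bullet> b) * line_deriv e D j (b # bs) x)"

lemma line_deriv_DERIV:
  assumes U: "open U" and D: "partials_on U D"
  shows "set bs \<subseteq> Basis \<Longrightarrow> x + s *\<^sub>R e \<in> U \<Longrightarrow>
    ((\<lambda>s. line_deriv e D j bs (x + s *\<^sub>R e)) has_real_derivative line_deriv e D (Suc j) bs (x + s *\<^sub>R e)) (at s)"
proof (induction j arbitrary: bs)
  case 0
  have "((\<lambda>s. x + s *\<^sub>R e) has_derivative (\<lambda>h. h *\<^sub>R e)) (at s)" by (auto intro!: derivative_eq_intros)
  from has_derivative_compose[OF this partials_on_has_derivative[OF U D 0]]
  have "((\<lambda>s. D bs (x + s *\<^sub>R e)) has_derivative (\<lambda>h. \<Sum>b\<in>Basis. (h *\<^sub>R e) \<bullet> b * D (b # bs) (x + s *\<^sub>R e))) (at s)" .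
  moreover have "(\<lambda>h. \<Sum>b\<in>Basis. (h *\<^sub>R e) \<bullet> b * D (b # bs) (x + s *\<^sub>R e)) = (*) (\<Sum>b\<in>Basis. (e \<bullet> b) * D (b # bs) (x + s *\<^sub>R e))"
    by (auto simp: sum_distrib_left sum_distrib_right mult_ac)
  ultimately show ?case by (simp add: has_field_derivative_def)
next
  case (Suc j)
  show ?case
    unfolding line_deriv.simps(2)[of e D "Suc j" bs]
    unfolding line_deriv.simps(2)[of e D j bs]
    by (intro DERIV_sum DERIV_cmult Suc.IH) (use Suc.prems in auto)
qed

lemma line_deriv_bound:
  assumes "\<And>bs. set bs \<subseteq> Basis \<Longrightarrow> length bs \<le> n \<Longrightarrow> \<bar>D bs x\<bar> \<le> A"
  shows "set bs \<subseteq> Basis \<Longrightarrow> length bs + j \<le> n \<Longrightarrow> \<bar>line_deriv e D j bs x\<bar> \<le> (\<Sum>b\<in>Basis. \<bar>e \<bullet> b\<bar>) ^ j * A"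
proof (induction j arbitrary: bs)
  case 0
  then show ?case using assms by simp
next
  case (Suc j)
  have "\<bar>line_deriv e D (Suc j) bs x\<bar> \<le> (\<Sum>b\<in>Basis. \<bar>e \<bullet> b\<bar> * ((\<Sum>b\<in>Basis. \<bar>e \<bullet> b\<bar>) ^ j * A))"
    unfolding line_deriv.simps
    by (intro order_trans[OF sum_abs] sum_mono) (use Suc in \<open>auto simp: abs_mult intro!: mult_left_mono\<close>)
  also have "\<dots> = (\<Sum>b\<in>Basis. \<bar>e \<bullet> b\<bar>) ^ Suc j * A" by (simp add: sum_distrib_right mult.assoc)
  finally show ?case .
qed

section \<open>Cutoff functions\<close>

lemma sum_unit_translates_bound:
  fixes \<phi> :: "real \<Rightarrow> real"
  assumes "\<And>s. 1 < \<bar>s\<bar> \<Longrightarrow> \<phi> s = 0" "\<And>s. \<bar>\<phi> s\<bar> \<le> A"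
  shows "(\<Sum>m\<in>{-int K..int K}. \<bar>\<phi> (s - of_int m)\<bar>) \<le> 3 * A"
proof -
  have A: "0 \<le> A" using assms(2)[of 0] by linarith
  have "(\<Sum>m\<in>{-int K..int K}. \<bar>\<phi> (s - of_int m)\<bar>) = (\<Sum>m\<in>{-int K..int K} \<inter> {\<lfloor>s\<rfloor> - 1..\<lfloor>s\<rfloor> + 1}. \<bar>\<phi> (s - of_int m)\<bar>)"
  proof (rule sum.mono_neutral_right)
    show "\<forall>m\<in>{-int K..int K} - {-int K..int K} \<inter> {\<lfloor>s\<rfloor> - 1..\<lfloor>s\<rfloor> + 1}. \<bar>\<phi> (s - of_int m)\<bar> = 0"
    proof
      fix m assume "m \<in> {-int K..int K} - {-int K..int K} \<inter> {\<lfloor>s\<rfloor> - 1..\<lfloor>s\<rfloor> + 1}"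
      then have "m < \<lfloor>s\<rfloor> - 1 \<or> \<lfloor>s\<rfloor> + 1 < m" by auto
      then have "1 < \<bar>s - of_int m\<bar>" by linarith
      then show "\<bar>\<phi> (s - of_int m)\<bar> = 0" using assms(1) by simp
    qed
  qed auto
  also have "\<dots> \<le> (\<Sum>m\<in>{\<lfloor>s\<rfloor> - 1..\<lfloor>s\<rfloor> + 1}. \<bar>\<phi> (s - of_int m)\<bar>)" by (rule sum_mono2) auto
  also have "\<dots> \<le> (\<Sum>m\<in>{\<lfloor>s\<rfloor> - 1..\<lfloor>s\<rfloor> + 1}. A)" using assms(2) by (intro sum_mono)
  also have "\<dots> = 3 * A" by simp
  finally show ?thesis .
qed

text \<open>\<open>cell \<delta> D g bs\<close> is the partial derivative in the directions \<open>bs\<close> of the bump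
  \<open>z \<mapsto> (\<Prod>b\<in>Basis. \<theta> (z \<bullet> b / \<delta> - g b))\<close> of the lattice partition of unity, where \<open>D n\<close> is the \<open>n\<close>-th derivative of \<open>\<theta>\<close>.\<close>

definition cell :: "real \<Rightarrow> (nat \<Rightarrow> real \<Rightarrow> real) \<Rightarrow> ('a::euclidean_space \<Rightarrow> int) \<Rightarrow> 'a list \<Rightarrow> 'a \<Rightarrow> real" where
  "cell \<delta> D g bs z = (1 / \<delta>) ^ length bs * (\<Prod>b\<in>Basis. D (count_list bs b) (z \<bullet> b / \<delta> - of_int (g b)))"

lemma partials_on_cell:
  assumes D: "derivs_on UNIV \<theta> D"
  shows "partials_on UNIV (cell \<delta> D g)"
proof (rule partials_onI)
  have der: "(D n has_real_derivative D (Suc n) s) (at s)" for n s using derivs_onD(2)[OF D] by simp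
  have cont: "continuous_on UNIV (D n)" for n
    by (rule DERIV_continuous_on[OF has_field_derivative_at_within[OF der]])
  fix bs :: "'a list" assume "set bs \<subseteq> Basis"
  show "continuous_on UNIV (cell \<delta> D g bs)"
    unfolding cell_def[abs_def] divide_inverse
    by (intro continuous_on_mult continuous_on_const continuous_on_prod continuous_on_compose2[OF cont]
        continuous_on_diff continuous_on_inner continuous_on_id) auto
  fix b x :: 'a assume b: "b \<in> Basis"
  let ?P = "\<lambda>z bs. \<Prod>c\<in>Basis - {b}. D (count_list bs c) (z \<bullet> c / \<delta> - of_int (g c))"
  have split: "cell \<delta> D g bs z = (1 / \<delta>) ^ length bs * (D (count_list bs b) (z \<bullet> b / \<delta> - of_int (g b)) * ?P z bs)" for bs z
    unfolding cell_def by (subst prod.remove[OF finite_Basis b]) simp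
  have P1: "?P (x + t *\<^sub>R b) bs = ?P x bs" for t
    by (intro prod.cong refl) (use b in \<open>auto simp: inner_add_left inner_Basis\<close>)
  have P2: "?P x (b # bs) = ?P x bs" by (intro prod.cong refl) auto
  have "((\<lambda>t. D (count_list bs b) ((x + t *\<^sub>R b) \<bullet> b / \<delta> - of_int (g b))) has_real_derivative
      D (Suc (count_list bs b)) ((x + 0 *\<^sub>R b) \<bullet> b / \<delta> - of_int (g b)) * (1 / \<delta>)) (at 0)"
    by (rule DERIV_chain2[OF der]) (use b in \<open>auto simp: inner_add_left divide_inverse intro!: derivative_eq_intros\<close>)
  then have "((\<lambda>t. (1 / \<delta>) ^ length bs * (D (count_list bs b) ((x + t *\<^sub>R b) \<bullet> b / \<delta> - of_int (g b)) * ?P x bs)) has_real_derivative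
      (1 / \<delta>) ^ length bs * (D (Suc (count_list bs b)) ((x + 0 *\<^sub>R b) \<bullet> b / \<delta> - of_int (g b)) * (1 / \<delta>) * ?P x bs)) (at 0)"
    by (intro DERIV_cmult DERIV_cmult_right)
  then show "((\<lambda>t. cell \<delta> D g bs (x + t *\<^sub>R b)) has_real_derivative cell \<delta> D g (b # bs) x) (at 0)"
    unfolding split P1 P2 by (simp add: mult_ac)
qed

text \<open>The cutoff is the sum of those lattice cells whose cube meets X. C depends on the order
  and the dimension alone: at each point at most 3 translates per coordinate are nonzero, however
  many cells are taken, and each derivative costs 1 / \<delta>. The bound R keeps the lattice
  finite.\<close>

lemma smooth_cutoff:
  obtains C :: "nat \<Rightarrow> real" where "\<And>l. 0 < C l"
    "\<And>r R (X :: 'a::euclidean_space set). 0 < r \<Longrightarrow> \<exists>\<eta>. partials_on UNIV \<eta> \<and>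
      (\<forall>z\<in>X. norm z \<le> R \<longrightarrow> \<eta> [] z = 1) \<and> (\<forall>bs z. (\<forall>y\<in>X. r \<le> norm (z - y)) \<longrightarrow> \<eta> bs z = 0) \<and>
      (\<forall>bs z. \<bar>\<eta> bs z\<bar> \<le> C (length bs) * (1 / r) ^ length bs)"
proof -
  obtain \<theta> D A where D: "derivs_on UNIV \<theta> D" and D0: "\<And>k x. 1 < \<bar>x\<bar> \<Longrightarrow> D k x = 0" and DA: "\<And>k x. \<bar>D k x\<bar> \<le> A k"
    and part: "\<And>x K. \<bar>x\<bar> \<le> real K \<Longrightarrow> (\<Sum>m\<in>{-int K..int K}. \<theta> (x - of_int m)) = 1"
    by (rule smooth_partition_function) blast
  have D\<theta>: "D 0 s = \<theta> s" for s using derivs_onD(1)[OF D] by simp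
  define A' where "A' l = 1 + (\<Sum>n\<le>l. \<bar>A n\<bar>)" for l
  have A': "\<bar>D n s\<bar> \<le> A' l" if "n \<le> l" for n l s
  proof -
    have "\<bar>A n\<bar> \<le> (\<Sum>n\<le>l. \<bar>A n\<bar>)" using that by (intro member_le_sum) auto
    then show ?thesis using DA[of n s] unfolding A'_def by linarith
  qed
  have A'pos: "0 < A' l" for l unfolding A'_def by (intro add_pos_nonneg sum_nonneg) auto
  let ?d = "real DIM('a)"
  define C where "C l = (4 * ?d) ^ l * (3 * A' l) ^ DIM('a)" for l
  show thesis
  proof (rule that[of C])
    show "0 < C l" for l using A'pos[of l] by (simp add: C_def)
    fix r R :: real and X :: "'a set" assume r: "0 < r"
    \<comment> \<open>Two points of one cell differ by at most 2 \<delta> in each coordinate, hence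
      by at most r / 2 in the l1 norm.\<close>
    define \<delta> where "\<delta> = r / (4 * ?d)"
    have \<delta>: "0 < \<delta>" using r by (simp add: \<delta>_def)
    obtain K :: nat where K: "R / \<delta> \<le> real K" using real_arch_simple by blast
    define L where "L = PiE (Basis :: 'a set) (\<lambda>_. {-int K..int K})"
    have finL: "finite L" by (simp add: L_def finite_PiE)
    define S where "S = {g\<in>L. \<exists>y\<in>X. \<forall>b\<in>Basis. \<bar>y \<bullet> b / \<delta> - of_int (g b)\<bar> \<le> 1}"
    have finS: "finite S" "S \<subseteq> L" using finL by (auto simp: S_def)
    define \<eta> where "\<eta> bs z = (\<Sum>g\<in>S. 1 * cell \<delta> D g bs z)" for bs z
    have supp: "\<bar>z \<bullet> b / \<delta> - of_int (g b)\<bar> \<le> 1" if "cell \<delta> D g bs z \<noteq> 0" "b \<in> Basis" for g bs z b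
    proof (rule ccontr)
      assume "\<not> ?thesis"
      then have "D (count_list bs b) (z \<bullet> b / \<delta> - of_int (g b)) = 0" using D0 by simp
      then have "(\<Prod>b\<in>Basis. D (count_list bs b) (z \<bullet> b / \<delta> - of_int (g b))) = 0"
        using that(2) by (intro prod_zero) auto
      then show False using that(1) by (simp add: cell_def)
    qed
    have part\<eta>: "partials_on UNIV \<eta>"
      unfolding \<eta>_def[abs_def] by (intro partials_on_lincomb partials_on_cell[OF D])
    have one: "\<eta> [] z = 1" if z: "z \<in> X" "norm z \<le> R" for z
    proof -
      have "\<eta> [] z = (\<Sum>g\<in>L. cell \<delta> D g [] z)"
        unfolding \<eta>_def mult_1
      proof (rule sum.mono_neutral_left[OF finL finS(2)], rule ballI)
        fix g assume "g \<in> L - S"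
        then show "cell \<delta> D g [] z = 0" using z(1) supp[of g "[]" z] by (auto simp: S_def)
      qed
      also have "\<dots> = (\<Sum>g\<in>L. \<Prod>b\<in>Basis. \<theta> (z \<bullet> b / \<delta> - of_int (g b)))" by (simp add: cell_def D\<theta>)
      also have "\<dots> = (\<Prod>b\<in>Basis. \<Sum>m\<in>{-int K..int K}. \<theta> (z \<bullet> b / \<delta> - of_int m))"
        unfolding L_def by (rule prod_sum_PiE[symmetric]) auto
      also have "\<dots> = (\<Prod>b\<in>(Basis::'a set). 1)"
      proof (intro prod.cong refl part)
        fix b :: 'a assume "b \<in> Basis"
        then have "\<bar>z \<bullet> b\<bar> / \<delta> \<le> R / \<delta>" using z(2) Basis_le_norm[of b z] \<delta> by (intro divide_right_mono) auto
        then show "\<bar>z \<bullet> b / \<delta>\<bar> \<le> real K" using K \<delta> by simp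
      qed
      finally show ?thesis by simp
    qed
    have zero: "\<eta> bs z = 0" if z: "\<forall>y\<in>X. r \<le> norm (z - y)" for bs z
      unfolding \<eta>_def
    proof (intro sum.neutral ballI, rule ccontr)
      fix g assume g: "g \<in> S" and "1 * cell \<delta> D g bs z \<noteq> 0"
      then have near: "\<bar>z \<bullet> b / \<delta> - of_int (g b)\<bar> \<le> 1" if "b \<in> Basis" for b using supp that by simp
      obtain y where y: "y \<in> X" "\<And>b. b \<in> Basis \<Longrightarrow> \<bar>y \<bullet> b / \<delta> - of_int (g b)\<bar> \<le> 1" using g by (auto simp: S_def)
      have "\<bar>(z - y) \<bullet> b\<bar> \<le> 2 * \<delta>" if b: "b \<in> Basis" for b
      proof -
        have "\<bar>z \<bullet> b / \<delta> - y \<bullet> b / \<delta>\<bar> \<le> 2" using near[OF b] y(2)[OF b] by linarith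
        then have "\<bar>(z - y) \<bullet> b / \<delta>\<bar> \<le> 2" by (simp add: inner_diff_left diff_divide_distrib)
        then show ?thesis using \<delta> by (simp add: pos_divide_le_eq)
      qed
      then have "(\<Sum>b\<in>Basis. \<bar>(z - y) \<bullet> b\<bar>) \<le> (\<Sum>b\<in>(Basis::'a set). 2 * \<delta>)" by (intro sum_mono)
      also have "\<dots> = r / 2" by (simp add: \<delta>_def)
      finally have "norm (z - y) < r" using norm_le_l1[of "z - y"] r by linarith
      then show False using z y(1) by force
    qed
    have bound: "\<bar>\<eta> bs z\<bar> \<le> C (length bs) * (1 / r) ^ length bs" for bs z
    proof -
      let ?l = "length bs"
      have "\<bar>\<eta> bs z\<bar> \<le> (\<Sum>g\<in>S. \<bar>cell \<delta> D g bs z\<bar>)" unfolding \<eta>_def mult_1 by (rule sum_abs)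
      also have "\<dots> \<le> (\<Sum>g\<in>L. \<bar>cell \<delta> D g bs z\<bar>)" by (rule sum_mono2[OF finL finS(2)]) auto
      also have "\<dots> = (1 / \<delta>) ^ ?l * (\<Sum>g\<in>L. \<Prod>b\<in>Basis. \<bar>D (count_list bs b) (z \<bullet> b / \<delta> - of_int (g b))\<bar>)"
        unfolding cell_def sum_distrib_left using \<delta> by (simp add: abs_mult abs_prod power_abs)
      also have "(\<Sum>g\<in>L. \<Prod>b\<in>Basis. \<bar>D (count_list bs b) (z \<bullet> b / \<delta> - of_int (g b))\<bar>)
          = (\<Prod>b\<in>Basis. \<Sum>m\<in>{-int K..int K}. \<bar>D (count_list bs b) (z \<bullet> b / \<delta> - of_int m)\<bar>)"
        unfolding L_def by (rule prod_sum_PiE[symmetric]) auto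
      also have "(1 / \<delta>) ^ ?l * \<dots> \<le> (1 / \<delta>) ^ ?l * (\<Prod>b\<in>(Basis::'a set). 3 * A' ?l)"
        using \<delta> by (intro mult_left_mono prod_mono conjI sum_nonneg sum_unit_translates_bound D0 A' count_le_length) auto
      also have "\<dots> = C ?l * (1 / r) ^ ?l" by (simp add: C_def \<delta>_def power_divide power_mult_distrib)
      finally show ?thesis .
    qed
    show "\<exists>\<eta>. partials_on UNIV \<eta> \<and> (\<forall>z\<in>X. norm z \<le> R \<longrightarrow> \<eta> [] z = 1) \<and>
        (\<forall>bs z. (\<forall>y\<in>X. r \<le> norm (z - y)) \<longrightarrow> \<eta> bs z = 0) \<and>
        (\<forall>bs z. \<bar>\<eta> bs z\<bar> \<le> C (length bs) * (1 / r) ^ length bs)"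
      using part\<eta> one zero bound by (intro exI[of _ \<eta>]) blast
  qed
qed

section \<open>Extrapolation and extension across the boundary\<close>

text \<open>Weights of the polynomial extrapolation to 0 from the nodes t, 2 t, ..., (m + 1) t. They
  come from solving the vanishing (m + 1)-st difference of a polynomial of degree at most m for its
  term i = 0.\<close>

definition extrap_coeff :: "nat \<Rightarrow> nat \<Rightarrow> real" where
  "extrap_coeff m i = - ((-1) ^ i * real (Suc m choose i))"

lemma extrap_monomial:
  assumes j: "j \<le> m" and t: "0 \<le> t"
  shows "(\<Sum>i=1..Suc m. extrap_coeff m i * (real i * t - a) ^ j) = (- a) ^ j"
proof -
  define D where "D k s = (if k \<le> j then fact j / fact (j - k) * (s - a) ^ (j - k) else 0)" for k and s :: real
  have "derivs_on UNIV (\<lambda>s. (s - a) ^ j) D"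
  proof (rule derivs_onI)
    fix k s
    consider "k < j" | "j \<le> k" by linarith
    then show "(D k has_real_derivative D (Suc k) s) (at s)"
    proof cases
      case 1
      then obtain n where n: "j - k = Suc n" "j - Suc k = n" by (metis Suc_diff_Suc)
      have "((\<lambda>s. (s - a) ^ Suc n) has_real_derivative (1 + real n) * (s - a) ^ n) (at s)"
        using DERIV_power_Suc[OF DERIV_diff[OF DERIV_ident[of "at s"] DERIV_const[where k=a]], where n=n] by simp
      from DERIV_cmult[OF this, of "fact j / fact (Suc n)"]
      have "((\<lambda>s. fact j / fact (Suc n) * (s - a) ^ Suc n) has_real_derivative fact j / fact (Suc n) * ((1 + real n) * (s - a) ^ n)) (at s)" .
      moreover have "fact j / fact (Suc n) * ((1 + real n) * (s - a) ^ n) = fact j / fact n * (s - a) ^ n" by simp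
      ultimately show ?thesis
        using 1 n by (simp add: D_def[abs_def] del: power_Suc fact_Suc)
    next
      case 2
      then show ?thesis by (cases "k = j") (auto simp: D_def[abs_def])
    qed
  qed (auto simp: D_def)
  \<comment> \<open>The derivative of order m + 1 > j is 0, so the difference is bounded by
    0.\<close>
  from pure_difference_bound[OF this, of 0 "Suc m" t 0] have "(\<Sum>i\<le>Suc m. (-1) ^ i * real (Suc m choose i) * (0 + real i * t - a) ^ j) = 0"
    using j t by (simp add: D_def)
  moreover have "{..Suc m} = insert 0 {1..Suc m}" by auto
  ultimately have "(- a) ^ j + (\<Sum>i=1..Suc m. (-1) ^ i * real (Suc m choose i) * (real i * t - a) ^ j) = 0"
    by simp
  then show ?thesis by (simp add: extrap_coeff_def sum_negf)
qed

lemma sum_abs_extrap_coeff: "(\<Sum>i=1..Suc m. \<bar>extrap_coeff m i\<bar>) \<le> 2 ^ Suc m"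
proof -
  have "(\<Sum>i=1..Suc m. \<bar>extrap_coeff m i\<bar>) = (\<Sum>i=1..Suc m. real (Suc m choose i))"
    by (simp add: extrap_coeff_def abs_mult)
  also have "\<dots> \<le> (\<Sum>i\<le>Suc m. real (Suc m choose i))" by (rule sum_mono2) auto
  also have "\<dots> = 2 ^ Suc m" using choose_row_sum[of "Suc m"] by (metis of_nat_numeral of_nat_power of_nat_sum)
  finally show ?thesis .
qed

lemma extrap_bound:
  assumes "\<And>i. 1 \<le> i \<Longrightarrow> i \<le> Suc m \<Longrightarrow> \<bar>R i\<bar> \<le> A"
  shows "\<bar>\<Sum>i=1..Suc m. extrap_coeff m i * R i\<bar> \<le> 2 ^ Suc m * A"
proof -
  have A: "0 \<le> A" using assms[of 1] by (simp add: order_trans[OF abs_ge_zero])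
  have "\<bar>\<Sum>i=1..Suc m. extrap_coeff m i * R i\<bar> \<le> (\<Sum>i=1..Suc m. \<bar>extrap_coeff m i\<bar> * A)"
    by (intro order_trans[OF sum_abs] sum_mono) (use assms in \<open>auto simp: abs_mult intro!: mult_left_mono\<close>)
  also have "\<dots> \<le> 2 ^ Suc m * A"
    unfolding sum_distrib_right[symmetric] by (rule mult_right_mono[OF sum_abs_extrap_coeff A])
  finally show ?thesis .
qed

text \<open>Both extrapolations are exact on the Taylor polynomial of degree m' and give its value
  at 0, so only the Taylor remainders survive. The expansion point is t, the smallest node, because
  nothing is known between 0 and t.\<close>

lemma extrap_difference:
  fixes E :: "nat \<Rightarrow> real \<Rightarrow> real"
  assumes der: "\<And>j s. t \<le> s \<Longrightarrow> s \<le> H \<Longrightarrow> (E j has_real_derivative E (Suc j) s) (at s)"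
    and A: "\<And>s. t \<le> s \<Longrightarrow> s \<le> H \<Longrightarrow> \<bar>E (Suc m') s\<bar> \<le> A"
    and m: "m' \<le> m" and t: "0 < t" and H: "2 * real (Suc m) * t \<le> H"
  shows "\<bar>(\<Sum>i=1..Suc m. extrap_coeff m i * E 0 (real i * t)) - (\<Sum>i=1..Suc m'. extrap_coeff m' i * E 0 (real i * (2 * t)))\<bar>
    \<le> 2 ^ (m + 2) * A * (2 * real (Suc m) * t) ^ Suc m'"
proof -
  define P where "P s = (\<Sum>j<Suc m'. E j t / fact j * (s - t) ^ j)" for s
  have P_extrap: "(\<Sum>i=1..Suc n. extrap_coeff n i * P (real i * u)) = P 0" if "m' \<le> n" "0 \<le> u" for n u
  proof -
    have "(\<Sum>i=1..Suc n. extrap_coeff n i * P (real i * u))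
        = (\<Sum>j<Suc m'. E j t / fact j * (\<Sum>i=1..Suc n. extrap_coeff n i * (real i * u - t) ^ j))"
      unfolding P_def sum_distrib_left by (subst sum.swap) (simp add: mult_ac)
    also have "\<dots> = P 0"
      unfolding P_def
    proof (intro sum.cong refl)
      fix j assume "j \<in> {..<Suc m'}"
      then have "j \<le> n" using that by auto
      then show "E j t / fact j * (\<Sum>i=1..Suc n. extrap_coeff n i * (real i * u - t) ^ j) = E j t / fact j * (0 - t) ^ j"
        using extrap_monomial[OF _ that(2), of j n t] by simp
    qed
    finally show ?thesis .
  qed
  let ?Z = "A * (2 * real (Suc m) * t) ^ Suc m'"
  have R: "\<bar>E 0 s - P s\<bar> \<le> ?Z" if s: "t \<le> s" "s \<le> 2 * real (Suc m) * t" for s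
  proof -
    have A0: "0 \<le> A" using A[of t] H s by (smt (verit) abs_ge_zero)
    show ?thesis
    proof (cases "s = t")
      case True
      have "P t = (\<Sum>j<Suc m'. if j = 0 then E 0 t else 0)"
        unfolding P_def by (intro sum.cong) (auto simp: power_0_left)
      then have "P t = E 0 t" by simp
      then show ?thesis using True A0 t by simp
    next
      case False
      have "\<exists>\<xi>. t < \<xi> \<and> \<xi> < s \<and> E 0 s = (\<Sum>j<Suc m'. E j t / fact j * (s - t) ^ j) + E (Suc m') \<xi> / fact (Suc m') * (s - t) ^ Suc m'"
        by (rule Taylor_up[where a=t]) (use der s H False in auto)
      then obtain \<xi> where \<xi>: "t < \<xi>" "\<xi> < s" "E 0 s - P s = E (Suc m') \<xi> / fact (Suc m') * (s - t) ^ Suc m'"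
        unfolding P_def by force
      have "\<bar>E 0 s - P s\<bar> = \<bar>E (Suc m') \<xi>\<bar> / fact (Suc m') * (s - t) ^ Suc m'"
        unfolding \<xi>(3) abs_mult abs_divide using s by (simp del: power_Suc fact_Suc)
      also have "\<dots> \<le> A / 1 * (2 * real (Suc m) * t) ^ Suc m'"
        using A[of \<xi>] \<xi> s H A0 t by (intro mult_mono frac_le power_mono fact_ge_1) auto
      finally show ?thesis by simp
    qed
  qed
  have 1: "\<bar>\<Sum>i=1..Suc m. extrap_coeff m i * (E 0 (real i * t) - P (real i * t))\<bar> \<le> 2 ^ Suc m * ?Z"
  proof (intro extrap_bound R)
    fix i assume i: "1 \<le> i" "i \<le> Suc m"
    show "t \<le> real i * t" using i t by simp
    have "real i * t \<le> real (Suc m) * t" using i t by (intro mult_right_mono) auto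
    moreover have "0 \<le> real (Suc m) * t" using t by simp
    ultimately show "real i * t \<le> 2 * real (Suc m) * t" by linarith
  qed
  have 2: "\<bar>\<Sum>i=1..Suc m'. extrap_coeff m' i * (E 0 (real i * (2 * t)) - P (real i * (2 * t)))\<bar> \<le> 2 ^ Suc m' * ?Z"
  proof (intro extrap_bound R)
    fix i assume i: "1 \<le> i" "i \<le> Suc m'"
    have "1 * t \<le> real i * t" using i t by (intro mult_right_mono) auto
    then show "t \<le> real i * (2 * t)" using t by simp
    have "real i * t \<le> real (Suc m) * t" using i t m by (intro mult_right_mono) auto
    then show "real i * (2 * t) \<le> 2 * real (Suc m) * t" by linarith
  qed
  have Z0: "0 \<le> ?Z" using R[of t] t by (smt (verit) mult_le_cancel_right2 of_nat_Suc of_nat_0_le_iff abs_ge_zero)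
  have "(2::real) ^ Suc m' \<le> 2 ^ Suc m" using m by (intro power_increasing) auto
  then have "2 ^ Suc m' * ?Z \<le> 2 ^ Suc m * ?Z" using Z0 by (rule mult_right_mono)
  moreover have "(\<Sum>i=1..Suc m. extrap_coeff m i * E 0 (real i * t)) = (\<Sum>i=1..Suc m. extrap_coeff m i * (E 0 (real i * t) - P (real i * t))) + P 0"
    using P_extrap[OF m, of t] t by (simp add: right_diff_distrib sum_subtractf del: sum.cl_ivl_Suc)
  moreover have "(\<Sum>i=1..Suc m'. extrap_coeff m' i * E 0 (real i * (2 * t))) = (\<Sum>i=1..Suc m'. extrap_coeff m' i * (E 0 (real i * (2 * t)) - P (real i * (2 * t)))) + P 0"
    using P_extrap[of m' "2 * t"] t by (simp add: right_diff_distrib sum_subtractf del: sum.cl_ivl_Suc)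
  moreover have "2 ^ (m + 2) * A * (2 * real (Suc m) * t) ^ Suc m' = 2 ^ Suc m * ?Z + 2 ^ Suc m * ?Z" by simp
  ultimately show ?thesis using 1 2 by linarith
qed

text \<open>m k is the largest order up to k for which all constants so far are at most (3/2)^k,
  with 0 as default while there is none. No rate is asked of m, so any sequence K is admissible.
  Since 3/2 < 2, a factor of order 2^-k still beats these constants.\<close>

lemma slowly_increasing_choice:
  fixes K :: "nat \<Rightarrow> real"
  obtains m where "\<And>k. m k \<le> m (Suc k)" "\<And>k. m k \<le> k" "filterlim m at_top sequentially"
    "\<forall>\<^sub>F k in sequentially. K (m k) \<le> (3/2) ^ k"
proof -
  define T where "T k = {j. j \<le> k \<and> (\<forall>i\<le>j. K i \<le> (3/2) ^ k)}" for k
  have fin: "finite (T k)" for k by (rule finite_subset[of _ "{..k}"]) (auto simp: T_def)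
  have T_mono: "T k \<subseteq> T (Suc k)" for k
  proof -
    have "(3/2::real) ^ k \<le> (3/2) ^ Suc k" by simp
    then show ?thesis unfolding T_def using order_trans by (smt (verit) Collect_mono le_SucI)
  qed
  define m where "m k = Max (insert 0 (T k))" for k
  have ev: "\<forall>\<^sub>F k in sequentially. N \<in> T k" for N
  proof -
    have "\<forall>\<^sub>F k in sequentially. \<forall>i\<in>{..N}. K i \<le> (3/2) ^ k"
    proof (rule eventually_ball_finite, simp, intro ballI)
      fix i
      obtain n where n: "K i < (3/2) ^ n" using real_arch_pow[of "3/2" "K i"] by auto
      have "K i \<le> (3/2) ^ k" if "n \<le> k" for k
        using n power_increasing[OF that, of "3/2::real"] by linarith
      then show "\<forall>\<^sub>F k in sequentially. K i \<le> (3/2) ^ k" unfolding eventually_sequentially by blast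
    qed
    with eventually_ge_at_top[of N] show ?thesis by eventually_elim (auto simp: T_def)
  qed
  show thesis
  proof (rule that[of m])
    show "m k \<le> m (Suc k)" for k
      unfolding m_def using fin T_mono by (intro Max_mono) auto
    show "m k \<le> k" for k unfolding m_def using fin by (auto simp: T_def)
    show "filterlim m at_top sequentially"
      unfolding filterlim_at_top
    proof
      fix N
      show "\<forall>\<^sub>F k in sequentially. N \<le> m k"
        using ev[of N] by eventually_elim (use fin in \<open>auto simp: m_def intro!: Max_ge\<close>)
    qed
    show "\<forall>\<^sub>F k in sequentially. K (m k) \<le> (3/2) ^ k"
      using ev[of 0]
    proof eventually_elim
      case (elim k)
      then have "m k = Max (T k)" by (simp add: m_def insert_absorb)
      then have "m k \<in> T k" using Max_in[OF fin] elim by auto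
      then show ?case by (auto simp: T_def)
    qed
  qed
qed

lemma partials_on_local:
  fixes D :: "'a::euclidean_space list \<Rightarrow> 'a \<Rightarrow> real"
  assumes "\<And>x. x \<in> U \<Longrightarrow> \<exists>V E. open V \<and> x \<in> V \<and> partials_on V E \<and> (\<forall>bs. \<forall>z\<in>V. D bs z = E bs z)"
  shows "partials_on U D"
proof (rule partials_onI)
  fix bs :: "'a list" assume bs: "set bs \<subseteq> Basis"
  show "continuous_on U (D bs)"
  proof (rule continuous_at_imp_continuous_on, rule ballI)
    fix x assume "x \<in> U"
    then obtain V E where V: "open V" "x \<in> V" "partials_on V E" "\<forall>bs. \<forall>z\<in>V. D bs z = E bs z" using assms by blast
    have "continuous_on V (D bs) \<longleftrightarrow> continuous_on V (E bs)" by (rule continuous_on_cong) (use V in auto)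
    then show "isCont (D bs) x" using partials_onD(1)[OF V(3) bs] V(1,2) by (simp add: continuous_on_eq_continuous_at)
  qed
  fix b x :: 'a assume b: "b \<in> Basis" and "x \<in> U"
  then obtain V E where V: "open V" "x \<in> V" "partials_on V E" "\<forall>bs. \<forall>z\<in>V. D bs z = E bs z" using assms by blast
  have op: "open ((\<lambda>t. x + t *\<^sub>R b) -` V)" by (rule open_vimage[OF V(1)]) (auto intro!: continuous_intros)
  have "((\<lambda>t. E bs (x + t *\<^sub>R b)) has_real_derivative D (b # bs) x) (at 0)"
    using partials_onD(2)[OF V(3) bs b V(2)] V(2,4) by simp
  then show "((\<lambda>t. D bs (x + t *\<^sub>R b)) has_real_derivative D (b # bs) x) (at 0)"
    by (rule has_field_derivative_transform_within_open[OF _ op]) (use V in auto)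
qed

text \<open>The extension is \<open>\<eta>\<^sub>0 g\<^sub>0 + (\<Sum>k\<ge>1. \<eta>\<^sub>k (g\<^sub>k - g\<^sub>k\<^sub>-\<^sub>1))\<close>, where \<open>g\<^sub>k\<close> extrapolates \<open>f\<close> from the points
  \<open>z + i t\<^sub>k e\<close>, \<open>1 \<le> i \<le> m\<^sub>k + 1\<close>, with \<open>t\<^sub>k\<close> of order \<open>2\<^sup>-\<^sup>k\<close>. By the cusp property these points lie in the interior
  as soon as \<open>z\<close> is within \<open>c t\<^sub>k\<^sup>p\<close> of \<open>X\<close>, and \<open>\<eta>\<^sub>k\<close> is a cutoff at this scale. Then \<open>g\<^sub>k - g\<^sub>k\<^sub>-\<^sub>1 = O(t\<^sub>k\<^sup>m)\<close> for all \<open>m\<close>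
  outweighs the derivatives of \<open>\<eta>\<^sub>k\<close>, provided that \<open>m\<^sub>k \<rightarrow> \<infinity>\<close> slowly.\<close>

lemma smooth_extension_at_cusp:
  fixes X :: "'a::euclidean_space set" and f :: "'a \<Rightarrow> real"
  assumes D: "partials_on (interior X) D" and Df: "\<And>y. y \<in> interior X \<Longrightarrow> D [] y = f y"
    and bnd: "\<And>l R. \<exists>B. \<forall>y bs. y \<in> interior X \<longrightarrow> norm (y - x) \<le> R \<longrightarrow> length bs = l \<and> set bs \<subseteq> Basis \<longrightarrow> \<bar>D bs y\<bar> \<le> B"
    and pos: "0 < c" "0 < h" "0 < \<epsilon>" "0 < p"
    and cusp: "\<And>y s. y \<in> X \<Longrightarrow> norm (y - x) < \<epsilon> \<Longrightarrow> 0 < s \<Longrightarrow> s < h \<Longrightarrow> ball (y + s *\<^sub>R e) (c * s ^ p) \<subseteq> X"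
    and lim: "\<And>y. y \<in> X \<Longrightarrow> norm (y - x) < \<epsilon> \<Longrightarrow> ((\<lambda>s. f (y + s *\<^sub>R e)) \<longlongrightarrow> f y) (at_right 0)"
  shows "\<exists>U F. open U \<and> x \<in> U \<and> smooth_on U F \<and> (\<forall>y\<in>U \<inter> X. F y = f y)"
proof -
  define c1 where "c1 = min c 1"
  have c1: "0 < c1" "c1 \<le> c" "c1 \<le> 1" using pos by (auto simp: c1_def)
  \<comment> \<open>2 h1 < h also admits the nodes of the preceding step size 2 t, and h1 \<le>
    \<epsilon> / 2 keeps the base points in X within \<epsilon> of x.\<close>
  define h1 where "h1 = min (min 1 (h / 4)) (\<epsilon> / 2)"
  have h1: "0 < h1" "h1 \<le> 1" "2 * h1 < h" "h1 \<le> \<epsilon> / 2"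
  proof -
    show "0 < h1" "h1 \<le> 1" "h1 \<le> \<epsilon> / 2" using pos by (auto simp: h1_def)
    have "h1 \<le> h / 4" unfolding h1_def by linarith
    then show "2 * h1 < h" using pos by linarith
  qed
  define U where "U = ball x (\<epsilon> / 2)"
  have U: "open U" "x \<in> U" using pos by (auto simp: U_def)
  define t where "t k = h1 * (1/2) ^ k" for k
  have t: "0 < t k" "t k \<le> (1/2) ^ k" "t k \<le> h1" "t k = 2 * t (Suc k)" "t (Suc k) \<le> t k" for k
  proof -
    show "0 < t k" using h1 by (simp add: t_def)
    show "t k \<le> (1/2) ^ k" using mult_right_mono[OF h1(2), of "(1/2) ^ k"] by (simp add: t_def)
    show "t k \<le> h1" using h1 by (simp add: t_def mult_left_le power_le_one)
    show "t k = 2 * t (Suc k)" "t (Suc k) \<le> t k" using h1 by (auto simp: t_def)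
  qed
  define r where "r k = c1 * t k ^ p" for k
  have r: "0 < r k" "r k \<le> 1" "r k \<le> h1" for k
  proof -
    show "0 < r k" using c1 t(1)[of k] by (simp add: r_def)
    have "t k ^ p \<le> t k" using pos t(1)[of k] t(3)[of k] h1 power_decreasing[of 1 p "t k"] by simp
    then have "t k ^ p \<le> h1" using t(3)[of k] by linarith
    moreover have "c1 * t k ^ p \<le> 1 * t k ^ p" using c1 t(1)[of k] by (intro mult_right_mono) auto
    ultimately show "r k \<le> h1" "r k \<le> 1" using h1 by (auto simp: r_def)
  qed
  define N where "N k = U \<inter> (\<Union>y\<in>X. ball y (r k))" for k
  have N_open: "open (N k)" for k unfolding N_def using U by auto
  \<comment> \<open>z is within r k of some y in X, and y + s e has a ball of radius c s^p \<ge> r k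
    in X for every height s \<ge> t k.\<close>
  have inO: "z + s *\<^sub>R e \<in> interior X" if z: "z \<in> N k" and s: "t k \<le> s" "s < h" for z k s
  proof -
    obtain y where y: "y \<in> X" "norm (z - y) < r k" and zU: "norm (z - x) < \<epsilon> / 2"
      using z by (auto simp: N_def U_def dist_norm norm_minus_commute)
    have "norm (y - x) \<le> norm (z - y) + norm (z - x)"
      using norm_triangle_ineq4[of "z - x" "z - y"] by (simp add: add.commute)
    then have yx: "norm (y - x) < \<epsilon>" using y(2) zU r(3)[of k] h1 by linarith
    have "r k \<le> c * s ^ p"
      unfolding r_def using c1 s t(1)[of k] by (intro mult_mono power_mono) auto
    then have "z + s *\<^sub>R e \<in> ball (y + s *\<^sub>R e) (c * s ^ p)" using y(2) by (simp add: dist_norm norm_minus_commute)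
    moreover have "0 < s" using s t(1)[of k] by linarith
    then have "ball (y + s *\<^sub>R e) (c * s ^ p) \<subseteq> interior X"
      using s by (intro interior_maximal cusp[OF y(1) yx]) auto
    ultimately show ?thesis by blast
  qed
  define R where "R = \<epsilon> + h * norm e"
  obtain B where B: "\<And>l y bs. y \<in> interior X \<Longrightarrow> norm (y - x) \<le> R \<Longrightarrow> length bs = l \<Longrightarrow> set bs \<subseteq> Basis \<Longrightarrow> \<bar>D bs y\<bar> \<le> B l"
  proof -
    have "\<forall>l. \<exists>B. \<forall>y bs. y \<in> interior X \<longrightarrow> norm (y - x) \<le> R \<longrightarrow> length bs = l \<and> set bs \<subseteq> Basis \<longrightarrow> \<bar>D bs y\<bar> \<le> B"
      using bnd[where R=R] by blast
    from choice[OF this] show thesis using that by blast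
  qed
  define Bd where "Bd n = (\<Sum>l\<le>n. \<bar>B l\<bar>)" for n
  have Bd_mono: "Bd n \<le> Bd n'" if "n \<le> n'" for n n' unfolding Bd_def using that by (intro sum_mono2) auto
  have Bd0: "0 \<le> Bd n" for n by (auto simp: Bd_def intro!: sum_nonneg)
  have Bd: "\<bar>D bs (z + s *\<^sub>R e)\<bar> \<le> Bd n"
    if z: "z \<in> N k" and s: "t k \<le> s" "s < h" and bs: "set bs \<subseteq> Basis" "length bs \<le> n" for z k s bs n
  proof -
    have "norm (z - x) < \<epsilon> / 2" using z by (simp add: N_def U_def dist_norm norm_minus_commute)
    moreover have "norm (s *\<^sub>R e) \<le> h * norm e" using s t(1)[of k] by (auto intro!: mult_right_mono)
    moreover have "norm (z + s *\<^sub>R e - x) \<le> norm (z - x) + norm (s *\<^sub>R e)" using norm_triangle_ineq[of "z - x" "s *\<^sub>R e"] by (simp add: algebra_simps)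
    ultimately have "norm (z + s *\<^sub>R e - x) \<le> R" unfolding R_def using pos by linarith
    then have "\<bar>D bs (z + s *\<^sub>R e)\<bar> \<le> B (length bs)" using inO[OF z s] bs by (intro B) auto
    also have "\<dots> \<le> \<bar>B (length bs)\<bar>" by simp
    also have "\<dots> \<le> Bd n" unfolding Bd_def using bs by (intro member_le_sum) auto
    finally show ?thesis .
  qed
  define S where "S = 1 + (\<Sum>b\<in>Basis. \<bar>e \<bullet> b\<bar>)"
  have S: "1 \<le> S" "0 \<le> (\<Sum>b\<in>Basis. \<bar>e \<bullet> b\<bar>)" "(\<Sum>b\<in>Basis. \<bar>e \<bullet> b\<bar>) \<le> S" by (auto simp: S_def sum_nonneg)
  obtain C where C: "\<And>l. 0 < C l"
    and cut: "\<And>r R (X :: 'a set). 0 < r \<Longrightarrow> \<exists>\<eta>. partials_on UNIV \<eta> \<and>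
      (\<forall>z\<in>X. norm z \<le> R \<longrightarrow> \<eta> [] z = 1) \<and> (\<forall>bs z. (\<forall>y\<in>X. r \<le> norm (z - y)) \<longrightarrow> \<eta> bs z = 0) \<and>
      (\<forall>bs z. \<bar>\<eta> bs z\<bar> \<le> C (length bs) * (1 / r) ^ length bs)"
    by (rule smooth_cutoff[where 'a='a]) blast
  define Cm where "Cm l = (\<Sum>j\<le>l. C j)" for l
  have Cm: "C j \<le> Cm l" if "j \<le> l" for j l unfolding Cm_def using that C by (intro member_le_sum) (auto intro: less_imp_le)
  have Cm0: "0 \<le> Cm l" for l unfolding Cm_def by (intro sum_nonneg less_imp_le C)
  have Cm_mono: "Cm l \<le> Cm l'" if "l \<le> l'" for l l' unfolding Cm_def using that C by (intro sum_mono2) (auto intro: less_imp_le)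
  \<comment> \<open>The cutoffs use half the radius r k, so that N k is a neighbourhood of the
    support of \<eta> k in U and each term can be continued by 0.\<close>
  obtain \<eta> where \<eta>: "\<And>k. partials_on UNIV (\<eta> k)" and \<eta>1: "\<And>k z. z \<in> X \<Longrightarrow> norm z \<le> norm x + \<epsilon> \<Longrightarrow> \<eta> k [] z = 1"
    and \<eta>0: "\<And>k bs z. (\<forall>y\<in>X. r k / 2 \<le> norm (z - y)) \<Longrightarrow> \<eta> k bs z = 0"
    and \<eta>b: "\<And>k bs z. \<bar>\<eta> k bs z\<bar> \<le> C (length bs) * (1 / (r k / 2)) ^ length bs"
  proof -
    have "\<forall>k. \<exists>\<eta>. partials_on UNIV \<eta> \<and> (\<forall>z\<in>X. norm z \<le> norm x + \<epsilon> \<longrightarrow> \<eta> [] z = 1) \<and>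
        (\<forall>bs z. (\<forall>y\<in>X. r k / 2 \<le> norm (z - y)) \<longrightarrow> \<eta> bs z = 0) \<and>
        (\<forall>bs z. \<bar>\<eta> bs z\<bar> \<le> C (length bs) * (1 / (r k / 2)) ^ length bs)"
      by (rule allI, rule cut) (use r(1) in simp)
    from choice[OF this] obtain \<eta> where *: "\<forall>k. partials_on UNIV (\<eta> k) \<and> (\<forall>z\<in>X. norm z \<le> norm x + \<epsilon> \<longrightarrow> \<eta> k [] z = 1) \<and>
        (\<forall>bs z. (\<forall>y\<in>X. r k / 2 \<le> norm (z - y)) \<longrightarrow> \<eta> k bs z = 0) \<and>
        (\<forall>bs z. \<bar>\<eta> k bs z\<bar> \<le> C (length bs) * (1 / (r k / 2)) ^ length bs)" ..
    show thesis by (rule that[of \<eta>]) (use * in blast)+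
  qed
  \<comment> \<open>The constant from \<open>extrap_difference\<close>; the order 2 m + 1 accounts
    for up to m derivatives in bs and up to m + 1 along e. Below, K1 and K2 collect the constants of
    \<open>T_bound\<close> and \<open>g_err\<close>.\<close>
  define Q where "Q m = 2 ^ (m + 2) * (S ^ Suc m * Bd (2 * m + 1)) * (2 * real (Suc m)) ^ Suc m" for m
  have Q0: "0 \<le> Q m" for m using S Bd0[of "2 * m + 1"] by (simp add: Q_def)
  define K1 where "K1 m = 2 ^ m * (Cm m * (2 / c1) ^ m * Q m)" for m
  define K2 where "K2 m = 2 ^ Suc m * (S * Bd 1 * real (Suc m))" for m
  have K0: "0 \<le> K1 m" "0 \<le> K2 m" for m
    using Q0[of m] Cm0[of m] c1 S Bd0[of 1] by (auto simp: K1_def K2_def)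
  obtain m where m_Suc: "\<And>k. m k \<le> m (Suc k)" and m_le: "\<And>k. m k \<le> k" and m_top: "filterlim m at_top sequentially"
    and m_K: "\<forall>\<^sub>F k in sequentially. K1 (m k) + K2 (m k) \<le> (3/2) ^ k"
    using slowly_increasing_choice[of "\<lambda>m. K1 m + K2 m"] by blast
  have mt: "real (Suc (m k)) * t k \<le> h1" for k
  proof -
    have "real (Suc (m k)) \<le> 2 ^ k"
    proof -
      have "Suc (m k) \<le> Suc k" using m_le[of k] by simp
      also have "\<dots> \<le> 2 ^ k" by (induction k) auto
      finally have "real (Suc (m k)) \<le> real (2 ^ k)" using of_nat_le_iff by blast
      then show ?thesis by simp
    qed
    then have "real (Suc (m k)) * t k \<le> 2 ^ k * t k" using t(1)[of k] by (intro mult_right_mono) auto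
    also have "\<dots> = h1" by (simp add: t_def power_divide)
    finally show ?thesis .
  qed
  have it: "t k \<le> real i * t k" "real i * t k \<le> h1" "real i * t k < h" if i: "i \<in> {1..Suc (m k)}" for i k
  proof -
    show "t k \<le> real i * t k" using i t(1)[of k] by simp
    have "real i * t k \<le> real (Suc (m k)) * t k" using i t(1)[of k] by (intro mult_right_mono) auto
    then show "real i * t k \<le> h1" using mt[of k] by linarith
    then show "real i * t k < h" using h1 by linarith
  qed
  define g where "g k bs z = (\<Sum>i=1..Suc (m k). extrap_coeff (m k) i * D bs (z + (real i * t k) *\<^sub>R e))" for k bs z
  define \<Delta> where "\<Delta> k bs z = (case k of 0 \<Rightarrow> g 0 bs z | Suc j \<Rightarrow> g (Suc j) bs z - g j bs z)" for k bs z
  \<comment> \<open>The samples of g j have heights at least t j \<ge> t k, so on N k both g k and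
    its predecessor sample f in the interior.\<close>
  have pg: "partials_on (N k) (g j)" if "t k \<le> t j" for k j
    unfolding g_def[abs_def]
    by (rule partials_on_lincomb, rule partials_on_translate[OF D])
       (use it that in \<open>auto intro!: inO order_trans[OF that]\<close>)
  have p\<Delta>: "partials_on (N k) (\<Delta> k)" for k
  proof (cases k)
    case 0
    then show ?thesis using pg[of 0 0] by (simp add: \<Delta>_def[abs_def])
  next
    case (Suc j)
    have "partials_on (N (Suc j)) (\<lambda>bs z. g (Suc j) bs z - g j bs z)"
      by (intro partials_on_diff pg t(5) order_refl)
    then show ?thesis by (simp add: Suc \<Delta>_def[abs_def])
  qed
  define T where "T k bs z = (if z \<in> N k then leibniz (\<eta> k) (\<Delta> k) bs z else 0)" for k bs z
  have pT: "partials_on U (T k)" for k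
  proof (rule partials_on_local)
    fix z assume z: "z \<in> U"
    show "\<exists>V E. open V \<and> z \<in> V \<and> partials_on V E \<and> (\<forall>bs. \<forall>z\<in>V. T k bs z = E bs z)"
    proof (cases "z \<in> N k")
      case True
      have "partials_on (N k) (leibniz (\<eta> k) (\<Delta> k))"
        by (rule partials_on_leibniz[OF partials_on_subset[OF \<eta>] p\<Delta>]) simp
      then show ?thesis using True N_open[of k] by (intro exI[of _ "N k"] exI[of _ "leibniz (\<eta> k) (\<Delta> k)"]) (auto simp: T_def)
    next
      case False
      have "T k bs z' = 0" if z': "z' \<in> ball z (r k / 2)" for bs z'
      proof -
        have far: "r k / 2 \<le> norm (z' - y)" if "y \<in> X" for y
        proof -
          have "r k \<le> norm (z - y)" using False z that by (auto simp: N_def dist_norm norm_minus_commute not_less)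
          also have "norm (z - y) \<le> norm (z - z') + norm (z' - y)" using norm_triangle_ineq[of "z - z'" "z' - y"] by simp
          finally show ?thesis using z' by (simp add: dist_norm)
        qed
        then have "\<eta> k bs z' = 0" for bs using \<eta>0 by blast
        then show ?thesis by (simp add: T_def leibniz_def)
      qed
      moreover have "partials_on (ball z (r k / 2)) (\<lambda>_ _. 0)" by (rule partials_onI) auto
      ultimately show ?thesis using r(1)[of k] by (intro exI[of _ "ball z (r k / 2)"] exI[of _ "\<lambda>_ _. 0"]) auto
    qed
  qed
  have \<Delta>_bound: "\<bar>\<Delta> (Suc j) bs z\<bar> \<le> Q (m (Suc j)) * t (Suc j) ^ Suc (m j)"
    if z: "z \<in> N (Suc j)" and bs: "set bs \<subseteq> Basis" "length bs \<le> m (Suc j)" for j bs z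
  proof -
    define mm where "mm = m (Suc j)"
    define E where "E i s = line_deriv e D i bs (z + s *\<^sub>R e)" for i s
    have mj: "m j \<le> mm" using m_Suc by (simp add: mm_def)
    have "\<bar>(\<Sum>i=1..Suc mm. extrap_coeff mm i * E 0 (real i * t (Suc j))) - (\<Sum>i=1..Suc (m j). extrap_coeff (m j) i * E 0 (real i * (2 * t (Suc j))))\<bar>
        \<le> 2 ^ (mm + 2) * (S ^ Suc mm * Bd (2 * mm + 1)) * (2 * real (Suc mm) * t (Suc j)) ^ Suc (m j)"
    proof (rule extrap_difference[where H="2 * h1"])
      fix i s assume s: "t (Suc j) \<le> s" "s \<le> 2 * h1"
      then have s': "s < h" using h1 by linarith
      show "(E i has_real_derivative E (Suc i) s) (at s)"
        unfolding E_def[abs_def] by (rule line_deriv_DERIV[OF open_interior D bs(1) inO[OF z s(1) s']])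
      have "\<bar>E (Suc (m j)) s\<bar> \<le> (\<Sum>b\<in>Basis. \<bar>e \<bullet> b\<bar>) ^ Suc (m j) * Bd (2 * mm + 1)"
        unfolding E_def
        by (rule line_deriv_bound[where n="2 * mm + 1"]) (use Bd[OF z s(1) s'] bs mj in \<open>auto simp: mm_def\<close>)
      also have "\<dots> \<le> S ^ Suc (m j) * Bd (2 * mm + 1)" using S Bd0 by (intro mult_right_mono power_mono) auto
      also have "\<dots> \<le> S ^ Suc mm * Bd (2 * mm + 1)" using S Bd0 mj by (intro mult_right_mono power_increasing) auto
      finally show "\<bar>E (Suc (m j)) s\<bar> \<le> S ^ Suc mm * Bd (2 * mm + 1)" .
    next
      show "2 * real (Suc mm) * t (Suc j) \<le> 2 * h1" using mt[of "Suc j"] unfolding mm_def mult.assoc by linarith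
    qed (use mj t(1) in auto)
    also have "(2 * real (Suc mm) * t (Suc j)) ^ Suc (m j) = (2 * real (Suc mm)) ^ Suc (m j) * t (Suc j) ^ Suc (m j)"
      by (rule power_mult_distrib)
    also have "2 ^ (mm + 2) * (S ^ Suc mm * Bd (2 * mm + 1)) * ((2 * real (Suc mm)) ^ Suc (m j) * t (Suc j) ^ Suc (m j))
        \<le> 2 ^ (mm + 2) * (S ^ Suc mm * Bd (2 * mm + 1)) * ((2 * real (Suc mm)) ^ Suc mm * t (Suc j) ^ Suc (m j))"
      using S Bd0[of "2 * mm + 1"] t(1)[of "Suc j"] mj by (intro mult_left_mono mult_right_mono power_increasing) auto
    also have "\<dots> = Q mm * t (Suc j) ^ Suc (m j)" by (simp add: Q_def)
    finally show ?thesis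
      by (simp add: \<Delta>_def g_def E_def mm_def t(4)[of j] del: sum.cl_ivl_Suc)
  qed
  \<comment> \<open>The derivatives of the cutoff cost up to \<open>t ^ (p * length bs)\<close> in
    the denominator, while the difference of extrapolations gains \<open>t ^ Suc (m j)\<close>; the
    condition on \<open>m j\<close> leaves a factor t^2.\<close>
  have T_bound: "\<bar>T (Suc j) bs z\<bar> \<le> K1 (m (Suc j)) * t (Suc j) ^ 2"
    if bs: "set bs \<subseteq> Basis" and mj: "length bs \<le> m j" "p * length bs + 1 \<le> m j" for j bs z
  proof (cases "z \<in> N (Suc j)")
    case False
    then show ?thesis using K0 by (simp add: T_def)
  next
    case True
    let ?l = "length bs" and ?k = "Suc j"
    have l: "?l \<le> m ?k" using mj m_Suc[of j] by linarith
    have "\<bar>leibniz (\<eta> ?k) (\<Delta> ?k) bs z\<bar> \<le> 2 ^ ?l * ((Cm ?l * (1 / (r ?k / 2)) ^ ?l) * (Q (m ?k) * t ?k ^ Suc (m j)))"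
    proof (rule leibniz_bound)
      fix s assume "s \<in> set (splits bs)"
      note s = splits_props[OF this]
      have "\<bar>\<eta> ?k (fst s) z\<bar> \<le> C (length (fst s)) * (1 / (r ?k / 2)) ^ length (fst s)" by (rule \<eta>b)
      also have "\<dots> \<le> Cm ?l * (1 / (r ?k / 2)) ^ ?l"
        using s r(1,2)[of ?k] C Cm0 by (intro mult_mono Cm power_increasing) (auto simp: field_simps)
      finally have 1: "\<bar>\<eta> ?k (fst s) z\<bar> \<le> Cm ?l * (1 / (r ?k / 2)) ^ ?l" .
      have 2: "\<bar>\<Delta> ?k (snd s) z\<bar> \<le> Q (m ?k) * t ?k ^ Suc (m j)"
        by (rule \<Delta>_bound[OF True]) (use s bs l in auto)
      show "\<bar>\<eta> ?k (fst s) z * \<Delta> ?k (snd s) z\<bar> \<le> (Cm ?l * (1 / (r ?k / 2)) ^ ?l) * (Q (m ?k) * t ?k ^ Suc (m j))"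
        unfolding abs_mult by (rule mult_mono[OF 1 2]) (use Cm0[of ?l] r(1)[of ?k] in auto)
    qed
    also have "\<dots> = (2 ^ ?l * (Cm ?l * (2 / c1) ^ ?l * Q (m ?k))) * (t ?k ^ Suc (m j) / (t ?k ^ p) ^ ?l)"
      using c1 t(1)[of ?k] by (simp add: r_def power_divide power_mult_distrib)
    also have "t ?k ^ Suc (m j) / (t ?k ^ p) ^ ?l = t ?k ^ (Suc (m j) - p * ?l)"
      using mj t(1)[of ?k] by (simp add: power_diff flip: power_mult)
    also have "(2 ^ ?l * (Cm ?l * (2 / c1) ^ ?l * Q (m ?k))) * t ?k ^ (Suc (m j) - p * ?l) \<le> K1 (m ?k) * t ?k ^ 2"
    proof (rule mult_mono)
      have "2 / c1 \<ge> 1" using c1 by simp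
      then show "2 ^ ?l * (Cm ?l * (2 / c1) ^ ?l * Q (m ?k)) \<le> K1 (m ?k)"
        unfolding K1_def using l Q0[of "m ?k"] Cm0[of ?l] Cm0[of "m ?k"] less_imp_le[OF c1(1)]
        by (intro mult_mono power_increasing Cm_mono mult_nonneg_nonneg zero_le_power) auto
      have "t ?k \<le> 1" using t(3)[of ?k] h1 by linarith
      then show "t ?k ^ (Suc (m j) - p * ?l) \<le> t ?k ^ 2" using mj t(1)[of ?k] by (intro power_decreasing) auto
    qed (use K0 t(1)[of ?k] in auto)
    finally show ?thesis using True by (simp add: T_def)
  qed
  have series: "partials_on U (\<lambda>bs z. \<Sum>k. T k bs z)"
  proof (rule partials_on_series[OF U(1) pT])
    fix bs :: "'a list" assume bs: "set bs \<subseteq> Basis"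
    have "\<forall>\<^sub>F j in sequentially. max (length bs) (p * length bs + 1) \<le> m j"
      using m_top unfolding filterlim_at_top by blast
    moreover have "\<forall>\<^sub>F j in sequentially. K1 (m (Suc j)) + K2 (m (Suc j)) \<le> (3/2) ^ Suc j"
      using m_K eventually_sequentially_Suc[of "\<lambda>k. K1 (m k) + K2 (m k) \<le> (3/2) ^ k"] by blast
    ultimately have "\<forall>\<^sub>F j in sequentially. \<forall>z\<in>U. \<bar>T (Suc j) bs z\<bar> \<le> (3/8) ^ Suc j"
    proof eventually_elim
      case (elim j)
      show ?case
      proof
        fix z
        have K1_le: "K1 (m (Suc j)) \<le> (3/2) ^ Suc j" using elim(2) K0(2)[of "m (Suc j)"] by linarith
        have "\<bar>T (Suc j) bs z\<bar> \<le> K1 (m (Suc j)) * t (Suc j) ^ 2" using elim by (intro T_bound[OF bs]) auto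
        also have "\<dots> \<le> (3/2) ^ Suc j * ((1/2) ^ Suc j) ^ 2"
          using t(1,2)[of "Suc j"] by (intro mult_mono[OF K1_le] power_mono) auto
        also have "\<dots> = (3/8) ^ Suc j"
          by (simp only: power2_eq_square power_mult_distrib[symmetric]) simp
        finally show "\<bar>T (Suc j) bs z\<bar> \<le> (3/8) ^ Suc j" .
      qed
    qed
    then have "\<forall>\<^sub>F k in sequentially. \<forall>z\<in>U. \<bar>T k bs z\<bar> \<le> (3/8) ^ k"
      using eventually_sequentially_Suc[of "\<lambda>k. \<forall>z\<in>U. \<bar>T k bs z\<bar> \<le> (3/8) ^ k"] by blast
    moreover have "summable (\<lambda>k. (3/8::real) ^ k)" by simp
    ultimately show "\<exists>a. summable a \<and> (\<forall>\<^sub>F k in sequentially. \<forall>z\<in>U. \<bar>T k bs z\<bar> \<le> a k)" by blast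
  qed
  have agree: "(\<Sum>k. T k [] z) = f z" if z: "z \<in> U" "z \<in> X" for z
  proof -
    have zN: "z \<in> N k" for k using z r(1)[of k] by (auto simp: N_def intro!: bexI[of _ z])
    have zx: "norm (z - x) < \<epsilon> / 2" using z(1) by (simp add: U_def dist_norm norm_minus_commute)
    have zx2: "norm (z - x) < \<epsilon>" using zx pos by linarith
    have "norm z \<le> norm x + norm (z - x)" using norm_triangle_ineq[of x "z - x"] by simp
    then have "norm z \<le> norm x + \<epsilon>" using zx pos by linarith
    then have T_eq: "T k [] z = \<Delta> k [] z" for k using zN \<eta>1[OF z(2)] by (simp add: T_def leibniz_Nil)
    have tel: "(\<Sum>k<Suc n. T k [] z) = g n [] z" for n
      by (induction n) (simp_all add: T_eq \<Delta>_def)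
    have inO': "z + s *\<^sub>R e \<in> interior X" if "0 < s" "s < h" for s
    proof -
      have "z + s *\<^sub>R e \<in> ball (z + s *\<^sub>R e) (c * s ^ p)" using pos that by simp
      then show ?thesis using interior_maximal[OF cusp[OF z(2) zx2 that] open_ball] by blast
    qed
    \<comment> \<open>The mean value theorem applies at positive heights only; \<open>lim\<close>
      carries the estimate down to z itself, which may be a boundary point.\<close>
    have lip: "\<bar>f (z + s *\<^sub>R e) - f z\<bar> \<le> S * Bd 1 * s" if s: "0 < s" "s < h" for s
    proof -
      have near: "\<bar>f (z + s *\<^sub>R e) - f (z + s' *\<^sub>R e)\<bar> \<le> S * Bd 1 * s" if s': "0 < s'" "s' < s" for s'
      proof -
        have "\<exists>\<xi>. s' < \<xi> \<and> \<xi> < s \<and> line_deriv e D 0 [] (z + s *\<^sub>R e) - line_deriv e D 0 [] (z + s' *\<^sub>R e) = (s - s') * line_deriv e D (Suc 0) [] (z + \<xi> *\<^sub>R e)"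
          by (rule MVT2[OF s'(2)], rule line_deriv_DERIV[OF open_interior D]) (use s s' inO' in auto)
        then obtain \<xi> where \<xi>: "s' < \<xi>" "\<xi> < s" "f (z + s *\<^sub>R e) - f (z + s' *\<^sub>R e) = (s - s') * line_deriv e D (Suc 0) [] (z + \<xi> *\<^sub>R e)"
          using Df inO' s s' by (auto simp del: line_deriv.simps(2))
        \<comment> \<open>\<open>Bd\<close> speaks of heights from some t k on; every positive
          height qualifies, since z lies in all N k.\<close>
        obtain k where k: "t k \<le> \<xi>"
        proof -
          have "\<forall>\<^sub>F k in sequentially. (1/2::real) ^ k < \<xi>"
            using order_tendstoD(2)[OF LIMSEQ_realpow_zero[of "1/2::real"], of \<xi>] \<xi> s' by simp
          then obtain k where "(1/2::real) ^ k < \<xi>" by (auto simp: eventually_sequentially)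
          then show thesis using that[of k] t(2)[of k] by linarith
        qed
        have "\<bar>line_deriv e D (Suc 0) [] (z + \<xi> *\<^sub>R e)\<bar> \<le> (\<Sum>b\<in>Basis. \<bar>e \<bullet> b\<bar>) ^ Suc 0 * Bd 1"
          by (rule line_deriv_bound[where n=1]) (use Bd[OF zN k] \<xi> s in auto)
        also have "\<dots> \<le> S * Bd 1" using S Bd0[of 1] by (simp add: mult_right_mono)
        finally have "(s - s') * \<bar>line_deriv e D (Suc 0) [] (z + \<xi> *\<^sub>R e)\<bar> \<le> s * (S * Bd 1)"
          using s s' by (intro mult_mono) auto
        then show ?thesis unfolding \<xi>(3) abs_mult using s' by (simp add: mult_ac del: line_deriv.simps(2))
      qed
      have "((\<lambda>s'. \<bar>f (z + s *\<^sub>R e) - f (z + s' *\<^sub>R e)\<bar>) \<longlongrightarrow> \<bar>f (z + s *\<^sub>R e) - f z\<bar>) (at_right 0)"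
        by (intro tendsto_intros lim z zx2)
      moreover have "\<forall>\<^sub>F s' in at_right 0. \<bar>f (z + s *\<^sub>R e) - f (z + s' *\<^sub>R e)\<bar> \<le> S * Bd 1 * s"
        unfolding eventually_at_right_field using near s by blast
      ultimately show ?thesis using tendsto_upperbound trivial_limit_at_right_real by blast
    qed
    have g_err: "\<bar>g n [] z - f z\<bar> \<le> K2 (m n) * t n" for n
    proof -
      have one: "(\<Sum>i=1..Suc (m n). extrap_coeff (m n) i) = 1"
        using extrap_monomial[of 0 "m n" 0 0] by simp
      have "g n [] z - f z = (\<Sum>i=1..Suc (m n). extrap_coeff (m n) i * (D [] (z + (real i * t n) *\<^sub>R e) - f z))"
        unfolding right_diff_distrib sum_subtractf sum_distrib_right[symmetric] one by (simp add: g_def)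
      also have "\<bar>\<dots>\<bar> \<le> 2 ^ Suc (m n) * (S * Bd 1 * (real (Suc (m n)) * t n))"
      proof (rule extrap_bound)
        fix i assume i: "1 \<le> i" "i \<le> Suc (m n)"
        have s: "0 < real i * t n" "real i * t n < h" using i it[of i n] t(1)[of n] by auto
        have "\<bar>D [] (z + (real i * t n) *\<^sub>R e) - f z\<bar> \<le> S * Bd 1 * (real i * t n)"
          using lip[OF s] Df[OF inO'[OF s]] by simp
        also have "\<dots> \<le> S * Bd 1 * (real (Suc (m n)) * t n)"
          using i S Bd0[of 1] t(1)[of n] by (intro mult_left_mono mult_right_mono) auto
        finally show "\<bar>D [] (z + (real i * t n) *\<^sub>R e) - f z\<bar> \<le> S * Bd 1 * (real (Suc (m n)) * t n)" .
      qed
      also have "\<dots> = K2 (m n) * t n" by (simp add: K2_def mult_ac)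
      finally show ?thesis .
    qed
    have "(\<lambda>n. g n [] z - f z) \<longlonglongrightarrow> 0"
    proof (rule Lim_null_comparison)
      show "\<forall>\<^sub>F n in sequentially. norm (g n [] z - f z) \<le> (3/4) ^ n"
        using m_K
      proof eventually_elim
        case (elim n)
        have "K2 (m n) \<le> (3/2) ^ n" using elim K0(1)[of "m n"] by linarith
        then have "K2 (m n) * t n \<le> (3/2) ^ n * (1/2) ^ n" using t(1,2)[of n] by (intro mult_mono) auto
        also have "\<dots> = (3/4) ^ n" by (simp flip: power_mult_distrib)
        finally show ?case using g_err[of n] by simp
      qed
      show "(\<lambda>n. (3/4::real) ^ n) \<longlonglongrightarrow> 0" by (rule LIMSEQ_realpow_zero) auto
    qed
    then have "(\<lambda>n. \<Sum>k<Suc n. T k [] z) \<longlonglongrightarrow> f z" unfolding tel by (simp add: LIM_zero_iff)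
    then have "(\<lambda>n. \<Sum>k<n. T k [] z) \<longlonglongrightarrow> f z" by (rule LIMSEQ_imp_Suc)
    then show ?thesis by (simp add: sums_def[symmetric] sums_iff)
  qed
  have "smooth_on U (\<lambda>z. \<Sum>k. T k [] z)"
    unfolding smooth_on_iff_partials_on using series by (intro exI[of _ "\<lambda>bs z. \<Sum>k. T k bs z"]) simp
  then show ?thesis using U agree by (intro exI[of _ U] exI[of _ "\<lambda>z. \<Sum>k. T k [] z"]) auto
qed

section \<open>Composition with curves\<close>

text \<open>This algebra of functions is closed under differentiation, which replaces the formula of Faa di Bruno.\<close>

inductive_set chain_algebra :: "('a::euclidean_space list \<Rightarrow> 'a \<Rightarrow> real) \<Rightarrow> (nat \<Rightarrow> real \<Rightarrow> 'a) \<Rightarrow> (real \<Rightarrow> real) set"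
  for D C where
  comp: "set bs \<subseteq> Basis \<Longrightarrow> (\<lambda>t. D bs (C 0 t)) \<in> chain_algebra D C"
| coord: "(\<lambda>t. C k t \<bullet> b) \<in> chain_algebra D C"
| zero: "(\<lambda>t. 0) \<in> chain_algebra D C"
| add: "g \<in> chain_algebra D C \<Longrightarrow> h \<in> chain_algebra D C \<Longrightarrow> (\<lambda>t. g t + h t) \<in> chain_algebra D C"
| mult: "g \<in> chain_algebra D C \<Longrightarrow> h \<in> chain_algebra D C \<Longrightarrow> (\<lambda>t. g t * h t) \<in> chain_algebra D C"

lemma chain_algebra_sum:
  "(\<And>i. i \<in> I \<Longrightarrow> g i \<in> chain_algebra D C) \<Longrightarrow> (\<lambda>t. \<Sum>i\<in>I. g i t) \<in> chain_algebra D C"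
proof (induction I rule: infinite_finite_induct)
  case (insert i I)
  then show ?case using chain_algebra.add[of "g i" D C "\<lambda>t. \<Sum>i\<in>I. g i t"] by simp
qed (simp_all add: chain_algebra.zero)

lemma chain_algebra_deriv:
  fixes D :: "'a::euclidean_space list \<Rightarrow> 'a \<Rightarrow> real"
  assumes U: "open U" and D: "partials_on U D" and C: "curve_derivs c C" and S: "\<And>t. t \<in> S \<Longrightarrow> c t \<in> U"
    and g: "g \<in> chain_algebra D C"
  shows "\<exists>g'\<in>chain_algebra D C. \<forall>t\<in>S. (g has_real_derivative g' t) (at t)"
  using g
proof induction
  have C0: "C 0 = c" and Cd: "\<And>k t. (C k has_vector_derivative C (Suc k) t) (at t)"
    using C by (auto simp: curve_derivs_def)
  {
    case (comp bs)
    let ?g' = "\<lambda>t. \<Sum>b\<in>Basis. (C (Suc 0) t \<bullet> b) * D (b # bs) (C 0 t)"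
    have "?g' \<in> chain_algebra D C"
      using comp by (intro chain_algebra_sum chain_algebra.mult chain_algebra.coord chain_algebra.comp) simp
    moreover have "((\<lambda>t. D bs (C 0 t)) has_real_derivative ?g' t) (at t)" if "t \<in> S" for t
    proof -
      have dC: "(C 0 has_derivative (\<lambda>h. h *\<^sub>R C (Suc 0) t)) (at t)" using Cd[of 0 t] by (simp add: has_vector_derivative_def)
      have "C 0 t \<in> U" using S[OF that] C0 by simp
      from has_derivative_compose[OF dC partials_on_has_derivative[OF U D comp this]] have "((\<lambda>t. D bs (C 0 t)) has_derivative (\<lambda>h. \<Sum>b\<in>Basis. ((h *\<^sub>R C (Suc 0) t) \<bullet> b) * D (b # bs) (C 0 t))) (at t)" .
      moreover have "(\<lambda>h. \<Sum>b\<in>Basis. ((h *\<^sub>R C (Suc 0) t) \<bullet> b) * D (b # bs) (C 0 t)) = (*) (?g' t)"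
        by (auto simp: sum_distrib_left sum_distrib_right mult_ac)
      ultimately show ?thesis by (simp add: has_field_derivative_def)
    qed
    ultimately show ?case by (intro bexI[of _ ?g'] ballI)
  next
    case (coord k b)
    have "((\<lambda>t. C k t \<bullet> b) has_real_derivative C (Suc k) t \<bullet> b) (at t)" for t
      using bounded_linear.has_vector_derivative[OF bounded_linear_inner_left[of b] Cd[of k t]]
      by (simp add: has_real_derivative_iff_has_vector_derivative)
    then show ?case by (intro bexI[of _ "\<lambda>t. C (Suc k) t \<bullet> b"] ballI chain_algebra.coord)
  next
    case zero
    show ?case by (intro bexI[of _ "\<lambda>t. 0"] ballI DERIV_const chain_algebra.zero)
  next
    case (add g h)
    then obtain g' h' where "g' \<in> chain_algebra D C" "h' \<in> chain_algebra D C"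
      "\<forall>t\<in>S. (g has_real_derivative g' t) (at t)" "\<forall>t\<in>S. (h has_real_derivative h' t) (at t)" by blast
    then show ?case by (intro bexI[of _ "\<lambda>t. g' t + h' t"] ballI DERIV_add chain_algebra.add) simp_all
  next
    case (mult g h)
    then obtain g' h' where "g' \<in> chain_algebra D C" "h' \<in> chain_algebra D C"
      "\<forall>t\<in>S. (g has_real_derivative g' t) (at t)" "\<forall>t\<in>S. (h has_real_derivative h' t) (at t)" by blast
    with mult.hyps show ?case
      by (intro bexI[of _ "\<lambda>t. g t * h' t + g' t * h t"] ballI DERIV_mult' chain_algebra.add chain_algebra.mult) simp_all
  }
qed

lemma smooth_on_compose_curve:
  fixes F :: "'a::euclidean_space \<Rightarrow> real"
  assumes U: "open U" and F: "smooth_on U F" and c: "smooth_curve c" and S: "\<And>t. t \<in> S \<Longrightarrow> c t \<in> U"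
  shows "\<exists>E. derivs_on S (F \<circ> c) E"
proof -
  obtain D where D: "\<forall>x\<in>U. D [] x = F x" "partials_on U D" using F by (auto simp: smooth_on_iff_partials_on)
  obtain C where C: "curve_derivs c C" using c by (auto simp: smooth_curve_def)
  obtain d where d: "\<And>g. g \<in> chain_algebra D C \<Longrightarrow> d g \<in> chain_algebra D C"
    "\<And>g t. g \<in> chain_algebra D C \<Longrightarrow> t \<in> S \<Longrightarrow> (g has_real_derivative d g t) (at t)"
  proof -
    have "\<forall>g\<in>chain_algebra D C. \<exists>g'. g' \<in> chain_algebra D C \<and> (\<forall>t\<in>S. (g has_real_derivative g' t) (at t))"
      using chain_algebra_deriv[OF U D(2) C, of S] S by blast
    from bchoice[OF this] show thesis using that by blast
  qed
  define E where "E k = (d ^^ k) (\<lambda>t. D [] (C 0 t))" for k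
  have E: "E k \<in> chain_algebra D C" for k
    unfolding E_def by (induction k) (auto intro: d chain_algebra.comp)
  have "derivs_on S (F \<circ> c) E"
  proof (rule derivs_onI)
    show "E 0 t = (F \<circ> c) t" if "t \<in> S" for t using D(1) S[OF that] C by (simp add: E_def curve_derivs_def)
    show "(E k has_real_derivative E (Suc k) t) (at t)" if "t \<in> S" for k t
      using d(2)[OF E[of k] that] by (simp add: E_def)
  qed
  then show ?thesis by blast
qed

section \<open>The three inclusions\<close>

lemma Cinf_subset_Ainf:
  fixes X :: "'a::euclidean_space set"
  shows "Cinf X \<subseteq> Ainf X"
proof
  fix f assume f: "f \<in> Cinf X"
  have "smooth_curve (f \<circ> c)" if c: "c \<in> smooth_curves_in X" for c
  proof (rule smooth_curve_local)
    fix t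
    have cs: "smooth_curve c" and cX: "c s \<in> X" for s using c by (auto simp: smooth_curves_in_def)
    obtain U F where U: "open U" "c t \<in> U" "smooth_on U F" "\<forall>y\<in>U \<inter> X. F y = f y"
      using f cX[of t] unfolding Cinf_def by blast
    obtain C where C: "curve_derivs c C" using cs by (auto simp: smooth_curve_def)
    have "continuous_on UNIV c"
    proof (rule continuous_at_imp_continuous_on, rule ballI)
      fix s
      have "(c has_vector_derivative C (Suc 0) s) (at s)" using C by (auto simp: curve_derivs_def)
      then show "isCont c s" by (rule has_vector_derivative_continuous)
    qed
    then have op: "open (c -` U)" using U(1) by (simp add: continuous_on_open_vimage)
    obtain E where "derivs_on (c -` U) (F \<circ> c) E" using smooth_on_compose_curve[OF U(1,3) cs, of "c -` U"] by auto
    then have "derivs_on (c -` U) (f \<circ> c) E" by (rule derivs_on_cong) (use U(4) cX in auto)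
    then show "\<exists>S D. open S \<and> t \<in> S \<and> derivs_on S (f \<circ> c) D" using op U(2) by blast
  qed
  then show "f \<in> Ainf X" by (simp add: Ainf_def)
qed

lemma Ainf_subset_AinfM: "Ainf X \<subseteq> AinfM M X"
  by (auto simp: Ainf_def AinfM_def smooth_curves_in_def DC_curves_in_def smooth_curve_def)

lemma AinfM_subset_Cinf:
  fixes X :: "'a::euclidean_space set"
  assumes X: "hoelder_set X" and M: "\<And>k. 0 < M k" and nq: "non_quasianalytic M"
  shows "AinfM M X \<subseteq> Cinf X"
proof
  fix f assume f: "f \<in> AinfM M X"
  define G where "G = partial_lim f"
  have closed: "closed X" using X by (auto simp: hoelder_set_def alpha_set_def)
  have E: "expands_on (interior X) f G"
    unfolding G_def by (rule expands_on_partial_lim) (rule AinfM_interior_lines[OF f M nq])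
  note cont = AinfM_continuous_on_interior[OF f M nq]
  have G: "partials_on (interior X) G" and Gf: "\<And>y. y \<in> interior X \<Longrightarrow> G [] y = f y"
    using expands_on_partials_on[OF E open_interior cont] by auto
  have loc: "\<exists>B r. 0 < r \<and> (\<forall>y hs. y \<in> interior X \<longrightarrow> norm (y - x) < r \<longrightarrow> length hs = l \<and> set hs \<subseteq> Basis \<longrightarrow> \<bar>G hs y\<bar> \<le> B)"
    if x: "x \<in> X" for x l
  proof (cases "x \<in> interior X")
    case True
    then obtain \<epsilon> where \<epsilon>: "0 < \<epsilon>" "ball x \<epsilon> \<subseteq> X" by (auto simp: mem_interior)
    have "\<exists>B r. 0 < r \<and> (\<forall>y hs. y \<in> interior X \<longrightarrow> norm (y - x) < r \<longrightarrow> length hs = l \<longrightarrow> set hs \<subseteq> Basis \<longrightarrow> \<bar>G hs y\<bar> \<le> B)"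
    proof (rule partials_bounded_near_cusp[OF f M nq E x, where c=1 and h="\<epsilon> / 2" and \<epsilon>="\<epsilon> / 2" and q=1 and e=0])
      fix y u assume y: "norm (y - x) < \<epsilon> / 2" and u: "\<bar>u\<bar> < \<epsilon> / 2"
      have "ball y \<bar>u\<bar> \<subseteq> ball x \<epsilon>"
      proof
        fix z assume "z \<in> ball y \<bar>u\<bar>"
        then show "z \<in> ball x \<epsilon>" using y u dist_triangle[of x z y] by (simp add: dist_norm norm_minus_commute)
      qed
      then show "ball (y + u\<^sup>2 *\<^sub>R 0) (1 * \<bar>u\<bar> ^ 1) \<subseteq> X" using \<epsilon> by auto
    qed (use \<epsilon> in auto)
    then show ?thesis by (simp add: imp_conjL)
  next
    case False
    obtain e p c h \<epsilon> where pos: "0 < c" "0 < h" "0 < \<epsilon>" "0 < (p::nat)"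
      and cusp: "\<And>y s. y \<in> X \<Longrightarrow> norm (y - x) < \<epsilon> \<Longrightarrow> 0 < s \<Longrightarrow> s < h \<Longrightarrow> ball (y + s *\<^sub>R e) (c * s ^ p) \<subseteq> X"
      by (rule hoelder_set_cusp[OF X x False]) blast
    \<comment> \<open>With s = u^2 the arc is defined for both signs of u, and s^p becomes u^(2p),
      so q = 2 p.\<close>
    have even: "ball (y + u\<^sup>2 *\<^sub>R e) (c * \<bar>u\<bar> ^ (2 * p)) \<subseteq> X"
      if u: "y \<in> X" "norm (y - x) < \<epsilon>" "u \<noteq> 0" "\<bar>u\<bar> < sqrt h" for y u
    proof -
      have "u\<^sup>2 < h" using real_sqrt_less_iff[of "u\<^sup>2" h] u(4) by simp
      then show ?thesis using cusp[OF u(1,2), of "u\<^sup>2"] u(3) by (simp add: power_mult)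
    qed
    have "\<exists>B r. 0 < r \<and> (\<forall>y hs. y \<in> interior X \<longrightarrow> norm (y - x) < r \<longrightarrow> length hs = l \<longrightarrow> set hs \<subseteq> Basis \<longrightarrow> \<bar>G hs y\<bar> \<le> B)"
      by (rule partials_bounded_near_cusp[OF f M nq E x pos(1) _ pos(3), where h="sqrt h" and q="2 * p" and e=e])
         (use pos in simp, use pos in simp, rule even)
    then show ?thesis by (simp add: imp_conjL)
  qed
  have bnd: "\<exists>B. \<forall>y bs. y \<in> interior X \<longrightarrow> norm (y - x) \<le> R \<longrightarrow> length bs = l \<and> set bs \<subseteq> Basis \<longrightarrow> \<bar>G bs y\<bar> \<le> B" for l R x
    by (rule bounded_on_compact_of_local[OF loc closed interior_subset])
  have "\<exists>U F. open U \<and> x \<in> U \<and> smooth_on U F \<and> (\<forall>y\<in>U \<inter> X. F y = f y)" if x: "x \<in> X" for x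
  proof (cases "x \<in> interior X")
    case True
    have "smooth_on (interior X) f" unfolding smooth_on_iff_partials_on using G Gf by blast
    then show ?thesis using True by (intro exI[of _ "interior X"] exI[of _ f]) auto
  next
    case False
    obtain e p c h \<epsilon> where pos: "0 < c" "0 < h" "0 < \<epsilon>" "0 < (p::nat)"
      and cusp: "\<And>y s. y \<in> X \<Longrightarrow> norm (y - x) < \<epsilon> \<Longrightarrow> 0 < s \<Longrightarrow> s < h \<Longrightarrow> ball (y + s *\<^sub>R e) (c * s ^ p) \<subseteq> X"
      by (rule hoelder_set_cusp[OF X x False]) blast
    have even: "ball (y + u\<^sup>2 *\<^sub>R e) (c * \<bar>u\<bar> ^ (2 * p)) \<subseteq> X"
      if u: "y \<in> X" "norm (y - x) < \<epsilon>" "u \<noteq> 0" "\<bar>u\<bar> < sqrt h" for y u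
    proof -
      have "u\<^sup>2 < h" using real_sqrt_less_iff[of "u\<^sup>2" h] u(4) by simp
      then show ?thesis using cusp[OF u(1,2), of "u\<^sup>2"] u(3) by (simp add: power_mult)
    qed
    \<comment> \<open>Used for w = 0 and order 0: a smooth arc through y, with u = sqrt s, gives
      continuity of f at y along e, also at boundary points.\<close>
    have "\<exists>B r. 0 < r \<and> (\<forall>y w. y \<in> X \<longrightarrow> norm (y - x) < r \<longrightarrow> norm w \<le> c / 2 \<longrightarrow>
      (\<exists>D. derivs_on {-r<..<r} (\<lambda>u. f (y + u\<^sup>2 *\<^sub>R e + u ^ (2 * p) *\<^sub>R w)) D \<and> (\<forall>u. \<bar>u\<bar> < r \<longrightarrow> \<bar>D 0 u\<bar> \<le> B)))"
      by (rule bounded_derivatives_along_cusps[OF f M nq x pos(1) _ pos(3), where h="sqrt h"])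
         (use pos in simp, use pos in simp, rule even)
    then obtain B r where r: "0 < r" and along: "\<forall>y w. y \<in> X \<longrightarrow> norm (y - x) < r \<longrightarrow> norm w \<le> c / 2 \<longrightarrow>
      (\<exists>D. derivs_on {-r<..<r} (\<lambda>u. f (y + u\<^sup>2 *\<^sub>R e + u ^ (2 * p) *\<^sub>R w)) D \<and> (\<forall>u. \<bar>u\<bar> < r \<longrightarrow> \<bar>D 0 u\<bar> \<le> B))"
      by blast
    have lim: "((\<lambda>s. f (y + s *\<^sub>R e)) \<longlongrightarrow> f y) (at_right 0)" if y: "y \<in> X" "norm (y - x) < r" for y
    proof -
      obtain D where D: "derivs_on {-r<..<r} (\<lambda>u. f (y + u\<^sup>2 *\<^sub>R e)) D"
        using along[rule_format, OF y, of 0] pos by auto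
      have "isCont (D 0) 0" using derivs_onD(2)[OF D, of 0 0] r DERIV_isCont by auto
      moreover have "((\<lambda>s. sqrt s) \<longlongrightarrow> 0) (at_right 0)" by (auto intro!: tendsto_eq_intros)
      ultimately have "((\<lambda>s. D 0 (sqrt s)) \<longlongrightarrow> D 0 0) (at_right 0)" by (rule isCont_tendsto_compose)
      moreover have "D 0 0 = f y" using derivs_onD(1)[OF D, of 0] r by simp
      ultimately have "((\<lambda>s. D 0 (sqrt s)) \<longlongrightarrow> f y) (at_right 0)" by simp
      moreover have "\<forall>\<^sub>F s in at_right 0. D 0 (sqrt s) = f (y + s *\<^sub>R e)"
      proof -
        have "D 0 (sqrt s) = f (y + s *\<^sub>R e)" if "0 < s" "s < r\<^sup>2" for s
        proof -
          have "sqrt s < r" using that r by (simp add: real_less_lsqrt)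
          moreover have "- r < sqrt s" using r real_sqrt_gt_zero[OF that(1)] by linarith
          ultimately show ?thesis using derivs_onD(1)[OF D, of "sqrt s"] that by simp
        qed
        then show ?thesis unfolding eventually_at_right_field using r by (intro exI[of _ "r\<^sup>2"]) auto
      qed
      ultimately show ?thesis by (rule Lim_transform_eventually)
    qed
    show ?thesis
    proof (rule smooth_extension_at_cusp[OF G Gf bnd pos(1,2) _ pos(4), where \<epsilon>="min \<epsilon> r" and e=e])
      show "ball (y + s *\<^sub>R e) (c * s ^ p) \<subseteq> X" if "y \<in> X" "norm (y - x) < min \<epsilon> r" "0 < s" "s < h" for y s
        using that by (intro cusp) auto
      show "((\<lambda>s. f (y + s *\<^sub>R e)) \<longlongrightarrow> f y) (at_right 0)" if "y \<in> X" "norm (y - x) < min \<epsilon> r" for y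
        using that by (intro lim) auto
    qed (use pos(3) r in auto)
  qed
  then show "f \<in> Cinf X" by (simp add: Cinf_def)
qed

theorem theorem1p13:
  fixes X :: "'a::euclidean_space set" and M :: "nat \<Rightarrow> real"
  assumes "hoelder_set X"
    and "\<forall>k. M k > 0"
    and "log_convex_seq M"
    and "non_quasianalytic M"
  shows "AinfM M X = Ainf X \<and> Ainf X = Cinf X"
  using Cinf_subset_Ainf[of X] Ainf_subset_AinfM[of X M] AinfM_subset_Cinf[of X M] assms by auto

end
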